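(* Let $n\ge 1$, $n<p<\infty$, and let $\rho$ be an admissible measure on $\mathbb{R}^n$. Then there is a nonconstant $u\in\mathcal{D}^{1,p}(\mathbb{R}^n)$ with $$[u]_\rho=C_*\|Du\|_p.$$
   Context: $\mathcal{D}^{1,p}(\mathbb{R}^n)$ is the space of $u\in L^1_{\rm loc}(\mathbb{R}^n)$ whose weak partial derivatives $u_{x_i}$, $i=1,\dots,n$, all belong to $L^p(\mathbb{R}^n)$. Since $p>n$, each $u$ is identified with its $(1-n/p)$-Hölder continuous representative. $\|Du\|_p:=\left(\int_{\mathbb{R}^n}|Du|^p\,dx\right)^{1/p}$. An admissible measure is a signed Borel measure $\rho$ on $\mathbb{R}^n$ with compact support, $\rho(\mathbb{R}^n)=0$, and $\int_{\mathbb{R}^n}y\,d\rho(y)\ne 0$. $\mathcal{S}(n)$ is the set of similarity transformations $S(y)=\lambda Oy+z$ of $\mathbb{R}^n$ with $\lambda>0$, $O\in\mathrm{O}(n)$, $z\in\mathbb{R}^n$. The push forward is $(S_\#\rho)(A)=\rho(S^{-1}(A))$ for Borel $A\subset\mathbb{R}^n$. For $u\in\mathcal{D}^{1,p}(\mathbb{R}^n)$, $$[u]_\rho:=\sup\left\{\frac{\left|\int u\,d\mu\right|}{\left|\int x\,d\mu(x)\right|^{1-n/p}}:\ \mu=S_\#\rho,\ S\in\mathcal{S}(n)\right\}.$$ $C_*$ is the smallest constant $C$ such that the generalized Morrey inequality $[u]_\rho\le C\|Du\|_p$ holds for all $u\in\mathcal{D}^{1,p}(\mathbb{R}^n)$.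 *)

theory Defs
  imports "HOL-Analysis.Analysis"
begin

section \<open>Signed Borel measures\<close>

text \<open>
  A signed Borel measure is a countably additive real-valued function on the Borel sets. Finiteness
  is no restriction here: a signed measure with finite total mass takes only finite values.
  The values of the set function on non-Borel sets are irrelevant.
\<close>

definition signed_borel_measure :: "('a::topological_space set \<Rightarrow> real) \<Rightarrow> bool" where
  "signed_borel_measure \<rho> \<longleftrightarrow> \<rho> {} = 0 \<and>
     (\<forall>A :: nat \<Rightarrow> 'a set. range A \<subseteq> sets borel \<longrightarrow> disjoint_family A \<longrightarrow>
        (\<lambda>i. \<rho> (A i)) sums \<rho> (\<Union>i. A i))"

text \<open>
  The positive variation \<open>\<rho>\<^sup>+(A) = sup {\<rho>(B) : B \<subseteq> A Borel}\<close>; the coercion to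
  \<open>ennreal\<close> truncates negative values to 0, which does not affect the supremum since
  \<open>\<rho> {} = 0\<close>. The negative variation is the positive variation of \<open>- \<rho>\<close>.
\<close>

definition pos_variation :: "('a::topological_space set \<Rightarrow> real) \<Rightarrow> 'a set \<Rightarrow> ennreal" where
  "pos_variation \<rho> A = (SUP B \<in> {B \<in> sets borel. B \<subseteq> A}. ennreal (\<rho> B))"

definition pos_part :: "('a::topological_space set \<Rightarrow> real) \<Rightarrow> 'a measure" where
  "pos_part \<rho> = measure_of UNIV (sets borel) (pos_variation \<rho>)"

text \<open>The set function handed to \<open>measure_of\<close> above is indeed a measure.\<close>

lemma signed_finite_Un:
  assumes "signed_borel_measure \<rho>" "A \<in> sets borel" "B \<in> sets borel" "A \<inter> B = {}"
  shows "\<rho> (A \<union> B) = \<rho> A + \<rho> B"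
proof -
  have r: "range (binaryset A B) \<subseteq> sets borel" "disjoint_family (binaryset A B)"
    using assms by (auto simp: range_binaryset_eq disjoint_family_on_def binaryset_def)
  then have "(\<lambda>i. \<rho> (binaryset A B i)) sums \<rho> (\<Union>i. binaryset A B i)"
    using assms(1) unfolding signed_borel_measure_def by blast
  moreover have "(\<lambda>i. \<rho> (binaryset A B i)) sums (\<rho> A + \<rho> B)"
    by (rule binaryset_sums) (use assms in \<open>simp add: signed_borel_measure_def\<close>)
  ultimately show ?thesis
    by (simp add: UN_binaryset_eq sums_unique2)
qed

lemma pos_variation_superadd:
  assumes s: "signed_borel_measure \<rho>" and d: "A \<inter> B = {}"
  shows "pos_variation \<rho> A + pos_variation \<rho> B \<le> pos_variation \<rho> (A \<union> B)"
proof -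
  have ne: "{B \<in> sets borel. B \<subseteq> X} \<noteq> {}" for X :: "'a set" by auto
  have *: "ennreal (\<rho> C) + ennreal (\<rho> D) \<le> pos_variation \<rho> (A \<union> B)"
    if "C \<in> sets borel" "C \<subseteq> A" "D \<in> sets borel" "D \<subseteq> B" for C D
  proof -
    define C' where "C' = (if \<rho> C \<le> 0 then {} else C)"
    define D' where "D' = (if \<rho> D \<le> 0 then {} else D)"
    have z: "\<rho> {} = 0" using s by (simp add: signed_borel_measure_def)
    have "C' \<in> sets borel" "C' \<subseteq> A" "D' \<in> sets borel" "D' \<subseteq> B" "\<rho> C' \<ge> 0" "\<rho> D' \<ge> 0"
      "ennreal (\<rho> C) = ennreal (\<rho> C')" "ennreal (\<rho> D) = ennreal (\<rho> D')"
      using that z by (auto simp: C'_def D'_def ennreal_neg)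
    moreover from this have "\<rho> (C' \<union> D') = \<rho> C' + \<rho> D'"
      using d by (intro signed_finite_Un[OF s]) auto
    ultimately have "ennreal (\<rho> C) + ennreal (\<rho> D) = ennreal (\<rho> (C' \<union> D'))" by simp
    also have "\<dots> \<le> pos_variation \<rho> (A \<union> B)"
      unfolding pos_variation_def
      using \<open>C' \<in> sets borel\<close> \<open>C' \<subseteq> A\<close> \<open>D' \<in> sets borel\<close> \<open>D' \<subseteq> B\<close> by (intro SUP_upper) auto
    finally show ?thesis .
  qed
  have "pos_variation \<rho> A + ennreal (\<rho> D) \<le> pos_variation \<rho> (A \<union> B)"
    if D: "D \<in> sets borel" "D \<subseteq> B" for D
    unfolding pos_variation_def[of \<rho> A]
    by (subst ennreal_SUP_add_left[symmetric]) (use ne * D in \<open>auto intro!: SUP_least\<close>)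
  then have "(SUP D \<in> {D \<in> sets borel. D \<subseteq> B}. ennreal (\<rho> D) + pos_variation \<rho> A)
      \<le> pos_variation \<rho> (A \<union> B)"
    by (intro SUP_least) (auto simp: add.commute)
  moreover have "(SUP D \<in> {D \<in> sets borel. D \<subseteq> B}. ennreal (\<rho> D) + pos_variation \<rho> A)
      = pos_variation \<rho> B + pos_variation \<rho> A"
    unfolding pos_variation_def[of \<rho> B] using ne by (rule ennreal_SUP_add_left)
  ultimately show ?thesis by (simp add: add.commute)
qed

lemma pos_variation_mono: "A \<subseteq> B \<Longrightarrow> pos_variation \<rho> A \<le> pos_variation \<rho> B"
  unfolding pos_variation_def by (intro SUP_subset_mono) auto

lemma emeasure_pos_part:
  assumes s: "signed_borel_measure \<rho>" and A: "A \<in> sets borel"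
  shows "emeasure (pos_part \<rho>) A = pos_variation \<rho> A"
proof (rule emeasure_measure_of[OF pos_part_def])
  show "sets borel \<subseteq> Pow UNIV" by simp
  show "A \<in> sets (pos_part \<rho>)" using A sets.sigma_sets_eq[of borel] by (simp add: pos_part_def)
  have 0: "pos_variation \<rho> {} = 0"
  proof -
    have "{B \<in> sets borel. B \<subseteq> {}} = {{}::'a set}" by auto
    then show ?thesis using s by (simp add: pos_variation_def signed_borel_measure_def)
  qed
  show "positive (sets (pos_part \<rho>)) (pos_variation \<rho>)" using 0 by (simp add: positive_def)
  show "countably_additive (sets (pos_part \<rho>)) (pos_variation \<rho>)"
  proof (rule countably_additiveI)
    fix F :: "nat \<Rightarrow> 'a set"
    assume "range F \<subseteq> sets (pos_part \<rho>)" and d: "disjoint_family F"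
    then have F: "F i \<in> sets borel" for i
      using sets.sigma_sets_eq[of borel] by (auto simp: pos_part_def)
    show "(\<Sum>i. pos_variation \<rho> (F i)) = pos_variation \<rho> (\<Union>i. F i)"
    proof (rule antisym)
      have "(\<Sum>i<n. pos_variation \<rho> (F i)) \<le> pos_variation \<rho> (\<Union>i<n. F i)" for n
      proof (induction n)
        case 0 then show ?case by simp
      next
        case (Suc n)
        have "(\<Sum>i<Suc n. pos_variation \<rho> (F i)) \<le> pos_variation \<rho> (\<Union>i<n. F i) + pos_variation \<rho> (F n)"
          using Suc by (simp add: add_right_mono)
        also have "\<dots> \<le> pos_variation \<rho> ((\<Union>i<n. F i) \<union> F n)"
          using disjoint_family_onD[OF d, of _ n] by (intro pos_variation_superadd[OF s]) fastforce
        also have "(\<Union>i<n. F i) \<union> F n = (\<Union>i<Suc n. F i)" by (auto simp: less_Suc_eq)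
        finally show ?case .
      qed
      then have "(\<Sum>i<n. pos_variation \<rho> (F i)) \<le> pos_variation \<rho> (\<Union>i. F i)" for n
        by (rule order_trans) (auto intro!: pos_variation_mono)
      then show "(\<Sum>i. pos_variation \<rho> (F i)) \<le> pos_variation \<rho> (\<Union>i. F i)"
        by (intro suminf_le_const) auto
    next
      show "pos_variation \<rho> (\<Union>i. F i) \<le> (\<Sum>i. pos_variation \<rho> (F i))"
        unfolding pos_variation_def[of \<rho> "\<Union>i. F i"]
      proof (safe intro!: SUP_least)
        fix B assume B: "B \<in> sets borel" "B \<subseteq> (\<Union>i. F i)"
        have "range (\<lambda>i. B \<inter> F i) \<subseteq> sets borel"
          using B F by auto
        moreover have "disjoint_family (\<lambda>i. B \<inter> F i)"
          using d by (rule disjoint_family_on_bisimulation) auto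
        ultimately have "(\<lambda>i. \<rho> (B \<inter> F i)) sums \<rho> (\<Union>i. B \<inter> F i)"
          using s unfolding signed_borel_measure_def by blast
        moreover have "(\<Union>i. B \<inter> F i) = B" using B by blast
        ultimately have lim: "(\<lambda>n. \<Sum>i<n. \<rho> (B \<inter> F i)) \<longlonglongrightarrow> \<rho> B" by (simp add: sums_def)
        have "ennreal (\<Sum>i<n. \<rho> (B \<inter> F i)) \<le> (\<Sum>i. pos_variation \<rho> (F i))" for n
        proof -
          have "ennreal (\<Sum>i<n. \<rho> (B \<inter> F i)) \<le> ennreal (\<Sum>i<n. max 0 (\<rho> (B \<inter> F i)))"
            by (intro ennreal_leI sum_mono) auto
          also have "\<dots> = (\<Sum>i<n. ennreal (\<rho> (B \<inter> F i)))"
          proof -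
            have "ennreal (max 0 (\<rho> (B \<inter> F i))) = ennreal (\<rho> (B \<inter> F i))" for i
              by (auto simp: max_def ennreal_neg)
            then show ?thesis by (subst sum_ennreal[symmetric]) auto
          qed
          also have "\<dots> \<le> (\<Sum>i<n. pos_variation \<rho> (F i))"
            unfolding pos_variation_def using B F by (intro sum_mono SUP_upper) auto
          also have "\<dots> \<le> (\<Sum>i. pos_variation \<rho> (F i))" by (rule sum_le_suminf) auto
          finally show ?thesis .
        qed
        moreover have "(\<lambda>n. ennreal (\<Sum>i<n. \<rho> (B \<inter> F i))) \<longlonglongrightarrow> ennreal (\<rho> B)"
          using lim by (rule tendsto_ennrealI)
        ultimately show "ennreal (\<rho> B) \<le> (\<Sum>i. pos_variation \<rho> (F i))"
          by (intro LIMSEQ_le_const2[where X = "\<lambda>n. ennreal (\<Sum>i<n. \<rho> (B \<inter> F i))"]) auto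
      qed
    qed
  qed
qed

definition neg_part :: "('a::topological_space set \<Rightarrow> real) \<Rightarrow> 'a measure" where
  "neg_part \<rho> = pos_part (\<lambda>A. - \<rho> A)"

definition signed_integral ::
    "('a::topological_space set \<Rightarrow> real) \<Rightarrow> ('a \<Rightarrow> 'b::{banach, second_countable_topology}) \<Rightarrow> 'b" where
  "signed_integral \<rho> f = integral\<^sup>L (pos_part \<rho>) f - integral\<^sup>L (neg_part \<rho>) f"

text \<open>The support of the total variation \<open>\<bar>\<rho>\<bar> = \<rho>\<^sup>+ + \<rho>\<^sup>-\<close>.\<close>

definition signed_support :: "('a::topological_space set \<Rightarrow> real) \<Rightarrow> 'a set" where
  "signed_support \<rho> =
     {x. \<forall>U. open U \<longrightarrow> x \<in> U \<longrightarrow> emeasure (pos_part \<rho>) U + emeasure (neg_part \<rho>) U \<noteq> 0}"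

definition push_forward :: "('a \<Rightarrow> 'b) \<Rightarrow> ('a set \<Rightarrow> real) \<Rightarrow> 'b set \<Rightarrow> real" where
  "push_forward S \<rho> A = \<rho> (S -` A)"

definition admissible_measure :: "((real^'n) set \<Rightarrow> real) \<Rightarrow> bool" where
  "admissible_measure \<rho> \<longleftrightarrow> signed_borel_measure \<rho> \<and> compact (signed_support \<rho>) \<and>
     \<rho> UNIV = 0 \<and> signed_integral \<rho> (\<lambda>y. y) \<noteq> 0"


section \<open>Similarities\<close>

definition similarities :: "(real^'n \<Rightarrow> real^'n) set" where
  "similarities = {S. \<exists>l O' z. l > 0 \<and> orthogonal_transformation O' \<and> S = (\<lambda>y. l *\<^sub>R O' y + z)}"


section \<open>The space of functions with weak gradient in \<open>L\<^sup>p\<close>\<close>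

definition partial :: "'n \<Rightarrow> (real^'n \<Rightarrow> real) \<Rightarrow> real^'n \<Rightarrow> real" where
  "partial i f x = frechet_derivative f (at x) (axis i 1)"

primrec C_k :: "nat \<Rightarrow> (real^'n \<Rightarrow> real) \<Rightarrow> bool" where
  "C_k 0 f \<longleftrightarrow> continuous_on UNIV f"
| "C_k (Suc k) f \<longleftrightarrow> (\<forall>x. f differentiable (at x)) \<and> (\<forall>i. C_k k (partial i f))"

definition test_function :: "(real^'n \<Rightarrow> real) \<Rightarrow> bool" where
  "test_function \<phi> \<longleftrightarrow> (\<forall>k. C_k k \<phi>) \<and> compact (closure {x. \<phi> x \<noteq> 0})"

definition L1_loc :: "(real^'n \<Rightarrow> real) set" where
  "L1_loc = {f. \<forall>K. compact K \<longrightarrow> set_integrable lebesgue K f}"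

definition L_p :: "real \<Rightarrow> (real^'n \<Rightarrow> real) set" where
  "L_p p = {f \<in> borel_measurable lebesgue. integrable lebesgue (\<lambda>x. \<bar>f x\<bar> powr p)}"

definition has_weak_partial :: "'n \<Rightarrow> (real^'n \<Rightarrow> real) \<Rightarrow> (real^'n \<Rightarrow> real) \<Rightarrow> bool" where
  "has_weak_partial i u g \<longleftrightarrow> g \<in> L1_loc \<and>
     (\<forall>\<phi>. test_function \<phi> \<longrightarrow>
        (LINT x|lebesgue. u x * partial i \<phi> x) = - (LINT x|lebesgue. g x * \<phi> x))"

text \<open>Weak derivatives are unique only up to null sets; an arbitrary representative is chosen.\<close>

definition weak_partial :: "'n \<Rightarrow> (real^'n \<Rightarrow> real) \<Rightarrow> real^'n \<Rightarrow> real" where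
  "weak_partial i u = (SOME g. has_weak_partial i u g)"

definition weak_gradient :: "(real^'n \<Rightarrow> real) \<Rightarrow> real^'n \<Rightarrow> real^'n" where
  "weak_gradient u x = (\<chi> i. weak_partial i u x)"

definition grad_norm :: "real \<Rightarrow> (real^'n \<Rightarrow> real) \<Rightarrow> real" where
  "grad_norm p u = (LINT x|lebesgue. norm (weak_gradient u x) powr p) powr (1 / p)"

definition hoelder_continuous :: "real \<Rightarrow> ('a::metric_space \<Rightarrow> 'b::metric_space) \<Rightarrow> bool" where
  "hoelder_continuous \<alpha> f \<longleftrightarrow> (\<exists>C. \<forall>x y. dist (f x) (f y) \<le> C * dist x y powr \<alpha>)"

text \<open>
  Functions are not taken modulo null sets. For \<open>p > n\<close> every equivalence class contains exactly
  one \<open>(1 - n/p)\<close>-Hoelder continuous function, and \<open>D1\<close> consists of these representatives.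
\<close>

definition D1 :: "real \<Rightarrow> (real^'n \<Rightarrow> real) set" where
  "D1 p = {u \<in> L1_loc. (\<forall>i. \<exists>g \<in> L_p p. has_weak_partial i u g) \<and>
             hoelder_continuous (1 - real CARD('n) / p) u}"


section \<open>The generalized Morrey seminorm and the sharp constant\<close>

definition morrey_seminorm ::
    "real \<Rightarrow> ((real^'n) set \<Rightarrow> real) \<Rightarrow> (real^'n \<Rightarrow> real) \<Rightarrow> ereal" where
  "morrey_seminorm p \<rho> u =
     (SUP \<mu> \<in> {push_forward S \<rho> | S. S \<in> similarities}.
        ereal (\<bar>signed_integral \<mu> u\<bar> /
               norm (signed_integral \<mu> (\<lambda>x. x)) powr (1 - real CARD('n) / p)))"

definition morrey_constant :: "real \<Rightarrow> ((real^'n) set \<Rightarrow> real) \<Rightarrow> real" where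
  "morrey_constant p \<rho> =
     (LEAST C. \<forall>u \<in> D1 p. morrey_seminorm p \<rho> u \<le> ereal (C * grad_norm p u))"

end

theory Submission
  imports Defs
begin

text \<open>
  The functional \<open>L u = \<integral> u d\<rho>\<close> annihilates constants, so Morrey's inequality bounds it by the gradient
  norm. Composition with a similarity of ratio \<open>l\<close> multiplies \<open>\<parallel>Du\<parallel>\<^sub>p\<close> by \<open>l powr (1 - n/p)\<close>, which is
  also the factor picked up by the denominator of the seminorm; hence the sharp constant is the supremum
  of \<open>L\<close> on the unit ball of the gradient norm, divided by a power of \<open>\<bar>\<integral> x d\<rho>\<bar>\<close>. A maximizing sequence
  for this supremum is Cauchy in the gradient norm by uniform convexity of \<open>L\<^sup>p\<close>, so no weak compactness
  is needed: normalized to vanish at \<open>0\<close>, it converges locally uniformly by Morrey's inequality, and the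
  limit is extremal.
\<close>

section \<open>Signed measures of finite total variation\<close>

text \<open>Two points shape the argument. The supremum in the seminorm runs over a noncompact group
  of similarities, along which a maximizing sequence could degenerate; the scaling identity lets the
  group act on the function instead, and only \<rho> itself has to be studied. Membership in
  \<open>D1\<close> gives a Hoelder constant, but one unrelated to the gradient. This qualitative
  information seeds a self-improvement: averaging \<open>u\<close> near two points costs a fixed
  fraction of the Hoelder constant, and the rest is controlled by the weak gradient, so the
  inequality can be iterated against itself until only the gradient term is left. The supremum of
  \<open>L\<close> must also be positive, or the extremal could be constant. Here the moment enters:
  on the linear function with slope \<open>m\<close>, the integral of \<open>y\<close> against
  \<rho>, the functional equals the square of the length of \<open>m\<close>. That function has
  infinite energy, but it may be cut off away from the support. Positivity is used three times: to
  make midpoints of near-maximizers carry almost full energy, to force gradient norm exactly 1 in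
  the limit, and to exclude constants.\<close>

lemma signed_borel_measure_uminus:
  "signed_borel_measure \<rho> \<Longrightarrow> signed_borel_measure (\<lambda>A. - \<rho> A)"
  unfolding signed_borel_measure_def by (auto intro: sums_minus)

lemma sets_pos_part [simp, measurable_cong]: "sets (pos_part \<rho>) = sets borel"
  unfolding pos_part_def using sets.sigma_sets_eq[of borel] by simp

lemma space_pos_part [simp]: "space (pos_part \<rho>) = UNIV"
  unfolding pos_part_def by simp

lemma sets_neg_part [simp, measurable_cong]: "sets (neg_part \<rho>) = sets borel"
  unfolding neg_part_def by simp

lemma space_neg_part [simp]: "space (neg_part \<rho>) = UNIV"
  unfolding neg_part_def by simp

lemma signed_finite_Diff:
  assumes "signed_borel_measure \<rho>" "A \<in> sets borel" "C \<in> sets borel" "C \<subseteq> A"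
  shows "\<rho> (A - C) = \<rho> A - \<rho> C"
proof -
  have "(A - C) \<inter> C = {}" "A - C \<union> C = A" using assms by auto
  then show ?thesis using signed_finite_Un[OF assms(1), of "A - C" C] assms by simp
qed

lemma pos_variation_Un:
  assumes s: "signed_borel_measure \<rho>" and A: "A \<in> sets borel" "B \<in> sets borel" "A \<inter> B = {}"
  shows "pos_variation \<rho> (A \<union> B) = pos_variation \<rho> A + pos_variation \<rho> B"
  using plus_emeasure[of A "pos_part \<rho>" B] A emeasure_pos_part[OF s] by simp

text \<open>A piece \<open>C\<close> with \<open>\<rho> C\<close> above
  \<open>1 + \<bar>\<rho> A\<bar>\<close> is so heavy that its complement in \<open>A\<close> also
  has \<open>\<bar>\<rho>\<bar>\<close> above 1. By additivity one of the two pieces keeps infinite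
  variation and becomes \<open>B\<close>; whichever it is, the piece split off is heavy
  enough.\<close>

lemma infinite_pos_variation_split:
  assumes s: "signed_borel_measure \<rho>" and A: "A \<in> sets borel" "pos_variation \<rho> A = top"
  shows "\<exists>B. B \<in> sets borel \<and> B \<subseteq> A \<and> pos_variation \<rho> B = top \<and> 1 \<le> \<bar>\<rho> (A - B)\<bar>"
proof -
  have "ennreal (1 + \<bar>\<rho> A\<bar>) < pos_variation \<rho> A" using A by simp
  then obtain C where C: "C \<in> sets borel" "C \<subseteq> A" "ennreal (1 + \<bar>\<rho> A\<bar>) < ennreal (\<rho> C)"
    unfolding pos_variation_def less_SUP_iff by auto
  then have c: "1 + \<bar>\<rho> A\<bar> < \<rho> C" by (subst (asm) ennreal_less_iff) auto
  have d: "\<rho> (A - C) = \<rho> A - \<rho> C" using signed_finite_Diff[OF s] A C by blast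
  have "pos_variation \<rho> A = pos_variation \<rho> C + pos_variation \<rho> (A - C)"
    using pos_variation_Un[OF s, of C "A - C"] A C by (simp add: Un_absorb1)
  then consider "pos_variation \<rho> C = top" | "pos_variation \<rho> (A - C) = top"
    using A by (metis ennreal_add_eq_top)
  then show ?thesis
  proof cases
    case 1 then show ?thesis using C c d by (intro exI[of _ C]) auto
  next
    case 2
    have "A - (A - C) = C" using C by auto
    then show ?thesis using 2 C A c by (intro exI[of _ "A - C"]) auto
  qed
qed

text \<open>If the variation were infinite, splitting off pieces with \<open>\<bar>\<rho>\<bar> \<ge> 1\<close> forever would
  contradict the summability of \<open>\<rho>\<close> along a disjoint sequence.\<close>

lemma pos_variation_finite:
  assumes s: "signed_borel_measure \<rho>"
  shows "pos_variation \<rho> UNIV \<noteq> top"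
proof
  assume top: "pos_variation \<rho> UNIV = top"
  have "\<exists>A. \<forall>n::nat. (A n \<in> sets borel \<and> pos_variation \<rho> (A n) = top) \<and>
    (A (Suc n) \<subseteq> A n \<and> 1 \<le> \<bar>\<rho> (A n - A (Suc n))\<bar>)"
  proof (rule dependent_nat_choice)
    show "\<exists>A. A \<in> sets borel \<and> pos_variation \<rho> A = top" using top by (intro exI[of _ UNIV]) auto
  qed (use infinite_pos_variation_split[OF s] in blast)
  then obtain A where A: "\<And>n::nat. A n \<in> sets borel" "\<And>n. A (Suc n) \<subseteq> A n"
    "\<And>n. 1 \<le> \<bar>\<rho> (A n - A (Suc n))\<bar>" by blast
  have mono: "m \<le> n \<Longrightarrow> A n \<subseteq> A m" for m n using lift_Suc_antimono_le[of A m n] A(2) by auto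
  define D where "D n = A n - A (Suc n)" for n
  have "D m \<inter> D n = {}" if "m < n" for m n
    using mono[of "Suc m" n] that by (auto simp: D_def)
  then have "disjoint_family D"
    unfolding disjoint_family_on_def by (metis inf_commute linorder_neqE_nat)
  moreover have "range D \<subseteq> sets borel" using A(1) by (auto simp: D_def)
  ultimately have "(\<lambda>n. \<rho> (D n)) sums \<rho> (\<Union>n. D n)"
    using s unfolding signed_borel_measure_def by blast
  then have "(\<lambda>n. \<rho> (D n)) \<longlonglongrightarrow> 0" by (intro summable_LIMSEQ_zero) (rule sums_summable)
  then have "\<exists>N. \<forall>n\<ge>N. \<bar>\<rho> (D n)\<bar> < 1" by (auto simp: LIMSEQ_def dist_real_def dest: spec[of _ 1])
  then show False using A(3) unfolding D_def by (meson linorder_not_less order_refl)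
qed

lemma finite_measure_pos_part:
  "signed_borel_measure \<rho> \<Longrightarrow> finite_measure (pos_part \<rho>)"
  by (intro finite_measureI) (simp add: emeasure_pos_part pos_variation_finite)

lemma finite_measure_neg_part:
  "signed_borel_measure \<rho> \<Longrightarrow> finite_measure (neg_part \<rho>)"
  unfolding neg_part_def by (intro finite_measure_pos_part signed_borel_measure_uminus)

text \<open>Because \<rho> has total mass zero, passing to the complement turns the value
  \<open>\<rho> B\<close> into \<open>- \<rho> B\<close>, so both variations are suprema of the same
  numbers. This is what makes the integral of a constant vanish.\<close>

lemma emeasure_neg_part_UNIV:
  assumes s: "signed_borel_measure \<rho>" and z: "\<rho> UNIV = 0"
  shows "emeasure (neg_part \<rho>) UNIV = emeasure (pos_part \<rho>) UNIV"
proof -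
  have m: "\<rho> (- B) = - \<rho> B" if "B \<in> sets borel" for B
    using signed_finite_Diff[OF s _ that, of UNIV] z by (simp add: Compl_eq_Diff_UNIV)
  have "pos_variation \<rho> UNIV \<le> pos_variation (\<lambda>A. - \<rho> A) UNIV"
    unfolding pos_variation_def
  proof (rule SUP_mono)
    fix B assume "B \<in> {B \<in> sets borel. B \<subseteq> (UNIV :: 'a set)}"
    then show "\<exists>C\<in>{B \<in> sets borel. B \<subseteq> UNIV}. ennreal (\<rho> B) \<le> ennreal (- \<rho> C)"
      using m by (intro bexI[of _ "- B"]) auto
  qed
  moreover have "pos_variation (\<lambda>A. - \<rho> A) UNIV \<le> pos_variation \<rho> UNIV"
    unfolding pos_variation_def
  proof (rule SUP_mono)
    fix B assume "B \<in> {B \<in> sets borel. B \<subseteq> (UNIV :: 'a set)}"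
    then show "\<exists>C\<in>{B \<in> sets borel. B \<subseteq> UNIV}. ennreal (- \<rho> B) \<le> ennreal (\<rho> C)"
      using m by (intro bexI[of _ "- B"]) auto
  qed
  ultimately show ?thesis
    unfolding neg_part_def by (simp add: emeasure_pos_part[OF s] emeasure_pos_part[OF signed_borel_measure_uminus[OF s]])
qed

text \<open>The complement of the support is a union of null open sets, in general an uncountable
  one. Second countability (Lindelof) extracts a countable subfamily with the same union.\<close>

lemma compl_signed_support_null:
  fixes \<rho> :: "'a::second_countable_topology set \<Rightarrow> real"
  shows "emeasure (pos_part \<rho>) (- signed_support \<rho>) = 0"
    and "emeasure (neg_part \<rho>) (- signed_support \<rho>) = 0"
proof -
  define F where "F = {U. open U \<and> emeasure (pos_part \<rho>) U + emeasure (neg_part \<rho>) U = 0}"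
  obtain F' where F': "F' \<subseteq> F" "countable F'" "\<Union>F' = \<Union>F"
    using Lindelof[of F] unfolding F_def by blast
  have eq: "- signed_support \<rho> = \<Union>F'"
    unfolding F'(3) signed_support_def F_def by auto
  have "emeasure (pos_part \<rho>) U = 0" "emeasure (neg_part \<rho>) U = 0" "U \<in> sets borel" if "U \<in> F'" for U
    using that F' unfolding F_def by auto
  then have "(\<Union>U\<in>F'. U) \<in> null_sets (pos_part \<rho>)" "(\<Union>U\<in>F'. U) \<in> null_sets (neg_part \<rho>)"
    using F'(2) by (intro null_sets_UN'; simp add: null_sets_def)+
  then show "emeasure (pos_part \<rho>) (- signed_support \<rho>) = 0" "emeasure (neg_part \<rho>) (- signed_support \<rho>) = 0"
    unfolding eq by auto
qed

text \<open>A homeomorphism puts the Borel subsets of \<open>A\<close> in bijection with those of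
  its preimage, so both suprema run over the same values of \<rho>. Injectivity matters: a map that
  merges points can cancel positive against negative mass.\<close>

lemma pos_part_push_forward:
  assumes s: "signed_borel_measure \<rho>" and S: "homeomorphism UNIV UNIV S T"
  shows "pos_part (push_forward S \<rho>) = distr (pos_part \<rho>) borel S"
proof -
  have ST: "S (T x) = x" "T (S y) = y" for x y using S by (auto simp: homeomorphism_def)
  have [measurable]: "S \<in> borel_measurable borel" "T \<in> borel_measurable borel"
    using S by (auto simp: homeomorphism_def intro: borel_measurable_continuous_onI)
  have S': "S -` A \<in> sets borel" if "A \<in> sets borel" for A
    using measurable_sets_borel[of S borel A] that by simp
  have T': "T -` A \<in> sets borel" if "A \<in> sets borel" for A
    using measurable_sets_borel[of T borel A] that by simp
  have s': "signed_borel_measure (push_forward S \<rho>)"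
    unfolding signed_borel_measure_def push_forward_def
  proof (intro conjI allI impI)
    show "\<rho> (S -` {}) = 0" using s by (simp add: signed_borel_measure_def)
    fix A :: "nat \<Rightarrow> 'b set" assume "range A \<subseteq> sets borel" "disjoint_family A"
    then have "range (\<lambda>i. S -` A i) \<subseteq> sets borel" "disjoint_family (\<lambda>i. S -` A i)"
      using S' by (auto simp: disjoint_family_on_def)
    then have "(\<lambda>i. \<rho> (S -` A i)) sums \<rho> (\<Union>i. S -` A i)"
      using s unfolding signed_borel_measure_def by blast
    then show "(\<lambda>i. \<rho> (S -` A i)) sums \<rho> (S -` (\<Union>i. A i))" by (simp add: vimage_UN)
  qed
  show ?thesis
  proof (rule measure_eqI)
    fix A assume "A \<in> sets (pos_part (push_forward S \<rho>))"
    then have A: "A \<in> sets borel" by simp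
    have "pos_variation (push_forward S \<rho>) A = pos_variation \<rho> (S -` A)"
      unfolding pos_variation_def push_forward_def
    proof (intro antisym SUP_mono)
      fix B assume "B \<in> {B \<in> sets borel. B \<subseteq> A}"
      then show "\<exists>C\<in>{B \<in> sets borel. B \<subseteq> S -` A}. ennreal (\<rho> (S -` B)) \<le> ennreal (\<rho> C)"
        using S' by (intro bexI[of _ "S -` B"]) auto
    next
      fix B assume "B \<in> {B \<in> sets borel. B \<subseteq> S -` A}"
      moreover have "S -` T -` B = B" using ST by auto
      moreover from \<open>B \<in> _\<close> have "T -` B \<subseteq> A" using ST by fastforce
      ultimately show "\<exists>C\<in>{B \<in> sets borel. B \<subseteq> A}. ennreal (\<rho> B) \<le> ennreal (\<rho> (S -` C))"
        using T' by (intro bexI[of _ "T -` B"]) auto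
    qed
    then show "emeasure (pos_part (push_forward S \<rho>)) A = emeasure (distr (pos_part \<rho>) borel S) A"
      using A S' by (simp add: emeasure_pos_part[OF s] emeasure_pos_part[OF s'] emeasure_distr)
  qed simp
qed

lemma neg_part_push_forward:
  assumes s: "signed_borel_measure \<rho>" and S: "homeomorphism UNIV UNIV S T"
  shows "neg_part (push_forward S \<rho>) = distr (neg_part \<rho>) borel S"
  using pos_part_push_forward[OF signed_borel_measure_uminus[OF s] S]
  unfolding neg_part_def push_forward_def .

lemma signed_integral_push_forward:
  assumes s: "signed_borel_measure \<rho>" and S: "homeomorphism UNIV UNIV S T"
    and f: "f \<in> borel_measurable borel"
  shows "signed_integral (push_forward S \<rho>) f = signed_integral \<rho> (\<lambda>x. f (S x))"
proof -
  have "S \<in> borel_measurable borel"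
    using S by (auto simp: homeomorphism_def intro: borel_measurable_continuous_onI)
  then show ?thesis
    unfolding signed_integral_def pos_part_push_forward[OF s S] neg_part_push_forward[OF s S]
    using f by (simp add: integral_distr)
qed

section \<open>Integration of continuous functions against a compactly supported signed measure of
  total mass zero\<close>

locale balanced_compact_measure =
  fixes \<rho> :: "'a::{second_countable_topology, t2_space} set \<Rightarrow> real"
  assumes signed: "signed_borel_measure \<rho>" and compact_support: "compact (signed_support \<rho>)"
    and balanced: "\<rho> UNIV = 0"
begin

lemma AE_support: "AE x in pos_part \<rho>. x \<in> signed_support \<rho>" "AE x in neg_part \<rho>. x \<in> signed_support \<rho>"
proof -
  have "- signed_support \<rho> \<in> sets borel" using compact_imp_closed[OF compact_support] by (intro borel_open) (simp add: open_Compl)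
  then have "- signed_support \<rho> \<in> null_sets (pos_part \<rho>)" "- signed_support \<rho> \<in> null_sets (neg_part \<rho>)"
    using compl_signed_support_null[of \<rho>] by auto
  then show "AE x in pos_part \<rho>. x \<in> signed_support \<rho>" "AE x in neg_part \<rho>. x \<in> signed_support \<rho>"
    by (auto dest!: AE_not_in)
qed

lemma finite_pos: "finite_measure (pos_part \<rho>)" and finite_neg: "finite_measure (neg_part \<rho>)"
  using finite_measure_pos_part finite_measure_neg_part signed by auto

text \<open>Both parts are finite and carried by the compact support, on which a continuous function
  is bounded.\<close>

lemma integrable_parts:
  fixes f :: "'a \<Rightarrow> 'b::{banach, second_countable_topology}"
  assumes "continuous_on UNIV f"
  shows "integrable (pos_part \<rho>) f" "integrable (neg_part \<rho>) f"
proof -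
  have m: "f \<in> borel_measurable borel" using assms by (rule borel_measurable_continuous_onI)
  have "bounded (f ` signed_support \<rho>)"
    using compact_support assms by (intro compact_imp_bounded compact_continuous_image) (auto intro: continuous_on_subset)
  then obtain B where B: "\<And>x. x \<in> signed_support \<rho> \<Longrightarrow> norm (f x) \<le> B"
    unfolding bounded_iff by auto
  show "integrable (pos_part \<rho>) f"
    using AE_support(1) B m by (intro finite_measure.integrable_const_bound[OF finite_pos, of _ B]) auto
  show "integrable (neg_part \<rho>) f"
    using AE_support(2) B m by (intro finite_measure.integrable_const_bound[OF finite_neg, of _ B]) auto
qed

lemma signed_integral_add:
  fixes f g :: "'a \<Rightarrow> 'b::{banach, second_countable_topology}"
  assumes "continuous_on UNIV f" "continuous_on UNIV g"
  shows "signed_integral \<rho> (\<lambda>x. f x + g x) = signed_integral \<rho> f + signed_integral \<rho> g"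
  unfolding signed_integral_def using assms by (simp add: integrable_parts)

lemma signed_integral_bounded_linear:
  fixes f :: "'a \<Rightarrow> 'b::{banach, second_countable_topology}"
    and T :: "'b \<Rightarrow> 'c::{banach, second_countable_topology}"
  assumes "continuous_on UNIV f" "bounded_linear T"
  shows "signed_integral \<rho> (\<lambda>x. T (f x)) = T (signed_integral \<rho> f)"
  unfolding signed_integral_def using assms integrable_parts[OF assms(1)]
  by (simp add: integral_bounded_linear[OF assms(2)] linear_diff bounded_linear.linear)

lemma signed_integral_const [simp]:
  fixes c :: "'b::{banach, second_countable_topology}"
  shows "signed_integral \<rho> (\<lambda>x. c) = 0"
  unfolding signed_integral_def using emeasure_neg_part_UNIV[OF signed balanced]
  by (simp add: measure_def)

lemma signed_integral_LIMSEQ: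
  fixes f :: "nat \<Rightarrow> 'a \<Rightarrow> 'b::{banach, second_countable_topology}"
  assumes c: "\<And>k. continuous_on UNIV (f k)" and g: "continuous_on UNIV g"
    and lim: "\<And>x. x \<in> signed_support \<rho> \<Longrightarrow> (\<lambda>k. f k x) \<longlonglongrightarrow> g x"
    and B: "\<And>k x. x \<in> signed_support \<rho> \<Longrightarrow> norm (f k x) \<le> B"
  shows "(\<lambda>k. signed_integral \<rho> (f k)) \<longlonglongrightarrow> signed_integral \<rho> g"
  unfolding signed_integral_def
proof (rule tendsto_diff)
  have m: "f k \<in> borel_measurable borel" "g \<in> borel_measurable borel" for k
    using c g by (auto intro: borel_measurable_continuous_onI)
  interpret p: finite_measure "pos_part \<rho>" by (rule finite_pos)
  interpret n: finite_measure "neg_part \<rho>" by (rule finite_neg)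
  show "(\<lambda>k. integral\<^sup>L (pos_part \<rho>) (f k)) \<longlonglongrightarrow> integral\<^sup>L (pos_part \<rho>) g"
    using AE_support(1) m lim B by (intro integral_dominated_convergence[where w="\<lambda>_. B"]) auto
  show "(\<lambda>k. integral\<^sup>L (neg_part \<rho>) (f k)) \<longlonglongrightarrow> integral\<^sup>L (neg_part \<rho>) g"
    using AE_support(2) m lim B by (intro integral_dominated_convergence[where w="\<lambda>_. B"]) auto
qed

text \<open>\<open>C\<close> is the total mass of the two parts. The bound \<open>B\<close> is asked
  for on the support only, since functions in \<open>D1\<close> may be unbounded.\<close>

lemma signed_integral_bounded:
  obtains C where "0 \<le> C"
    "\<And>f B. \<lbrakk>continuous_on UNIV f; \<And>x. x \<in> signed_support \<rho> \<Longrightarrow> \<bar>f x\<bar> \<le> B; 0 \<le> B\<rbrakk> \<Longrightarrow> \<bar>signed_integral \<rho> f\<bar> \<le> C * (B::real)"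
proof
  define C where "C = measure (pos_part \<rho>) UNIV + measure (neg_part \<rho>) UNIV"
  show "0 \<le> C" by (simp add: C_def)
  fix f :: "'a \<Rightarrow> real" and B
  assume f: "continuous_on UNIV f" and B: "\<And>x. x \<in> signed_support \<rho> \<Longrightarrow> \<bar>f x\<bar> \<le> B"
  interpret p: finite_measure "pos_part \<rho>" by (rule finite_pos)
  interpret n: finite_measure "neg_part \<rho>" by (rule finite_neg)
  have "\<bar>integral\<^sup>L (pos_part \<rho>) f\<bar> \<le> (\<integral>x. B \<partial>pos_part \<rho>)"
    by (rule order_trans[OF integral_abs_bound], rule integral_mono_AE) (use AE_support(1) B integrable_parts[OF f] in auto)
  moreover have "\<bar>integral\<^sup>L (neg_part \<rho>) f\<bar> \<le> (\<integral>x. B \<partial>neg_part \<rho>)"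
    by (rule order_trans[OF integral_abs_bound], rule integral_mono_AE) (use AE_support(2) B integrable_parts[OF f] in auto)
  ultimately show "\<bar>signed_integral \<rho> f\<bar> \<le> C * B"
    unfolding signed_integral_def C_def by (simp add: algebra_simps)
qed

end


section \<open>Change of variables under similarities\<close>

text \<open>The classical uniqueness argument for translation-invariant measures. Fubini's theorem,
  translations and a reflection show that the measure of the preimage of \<open>A\<close> times that
  of \<open>B\<close> equals the measure of \<open>A\<close> times that of the preimage of
  \<open>B\<close>. For the ball \<open>B\<close> whose preimage is the unit ball, the factor can be
  read off from the volumes of the two balls.\<close>

lemma emeasure_similarity_vimage:
  fixes l :: real and z :: "real^'n" and O' :: "real^'n \<Rightarrow> real^'n"
  defines "S \<equiv> \<lambda>x. l *\<^sub>R O' x + z"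
  assumes l: "l > 0" and O: "orthogonal_transformation O'" and A: "A \<in> sets borel"
  shows "emeasure lborel A = ennreal (l ^ CARD('n)) * emeasure lborel (S -` A)"
proof -
  have lin: "linear O'" using O by (rule orthogonal_transformation_linear)
  have cS: "continuous_on UNIV S"
    unfolding S_def using lin by (intro continuous_intros linear_continuous_on linear_conv_bounded_linear[THEN iffD1])
  have mS[measurable]: "S \<in> borel_measurable borel"
    using cS by (rule borel_measurable_continuous_onI)
  obtain T where T: "linear T" "\<And>x. O' (T x) = x" "\<And>x. T (O' x) = x"
  proof
    show "linear (inv O')" using orthogonal_transformation_inv[OF O] by (rule orthogonal_transformation_linear)
    show "O' (inv O' x) = x" "inv O' (O' x) = x" for x
      using orthogonal_transformation_bij[OF O] by (simp_all add: bij_def surj_f_inv_f)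
  qed
  \<comment> \<open>A shift of the argument by \<open>- T (y /\<^sub>R l)\<close> shifts the value
    of \<open>S\<close> by \<open>- y\<close>. Translating \<open>x\<close> in this way moves the
    variable \<open>y\<close> from the factor with \<open>B\<close> to the factor with
    \<open>A\<close>.\<close>
  have sh: "S (x - T (y /\<^sub>R l)) = S x - y" for x y
    unfolding S_def using l by (simp add: linear_diff[OF lin] T algebra_simps)
  have vimage_ind: "(\<integral>\<^sup>+x. indicator C (S x) \<partial>lborel) = emeasure lborel (S -` C)" if [measurable]: "C \<in> sets borel" for C
  proof -
    have "(\<lambda>x. indicator C (S x) :: ennreal) = indicator (S -` C)" by (auto simp: indicator_def fun_eq_iff)
    then show ?thesis using measurable_sets_borel[OF mS that] by simp
  qed
  define B where "B = ball z l"
  have [measurable]: "A \<in> sets borel" "B \<in> sets borel" using A by (auto simp: B_def)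
  have V: "0 < unit_ball_vol (real CARD('n))" by simp
  have SB: "S -` B = ball 0 1"
  proof -
    have "norm (O' x) = norm x" for x using O by (simp add: orthogonal_transformation_norm)
    then show ?thesis using l by (auto simp: S_def B_def dist_norm)
  qed
  have tr: "(\<integral>\<^sup>+y. f (y + c) \<partial>lborel) = (\<integral>\<^sup>+y. f y \<partial>lborel)" if [measurable]: "f \<in> borel_measurable borel" for f :: "real^'n \<Rightarrow> ennreal" and c
    by (subst (2) lborel_distr_plus[of c, symmetric]) (simp add: nn_integral_distr add.commute)
  have refl: "(\<integral>\<^sup>+y. f (c - y) \<partial>lborel) = (\<integral>\<^sup>+y. f y \<partial>lborel)" if [measurable]: "f \<in> borel_measurable borel" for f :: "real^'n \<Rightarrow> ennreal" and c
    by (subst (2) lborel_affine[of "-1" c]) (simp_all add: nn_integral_distr nn_integral_density)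
  have "emeasure lborel (S -` A) * emeasure lborel B
    = (\<integral>\<^sup>+x. (\<integral>\<^sup>+y. indicator A (S x) * indicator B y \<partial>lborel) \<partial>lborel)"
    by (simp add: nn_integral_cmult nn_integral_multc vimage_ind)
  also have "\<dots> = (\<integral>\<^sup>+x. (\<integral>\<^sup>+y. indicator A (S x) * indicator B (y + S x) \<partial>lborel) \<partial>lborel)"
  proof (rule nn_integral_cong)
    fix x
    show "(\<integral>\<^sup>+y. indicator A (S x) * indicator B y \<partial>lborel) = (\<integral>\<^sup>+y. indicator A (S x) * indicator B (y + S x) \<partial>lborel)"
      using tr[of "\<lambda>y. indicator A (S x) * indicator B y" "S x"] by simp
  qed
  also have "\<dots> = (\<integral>\<^sup>+y. (\<integral>\<^sup>+x. indicator A (S x) * indicator B (y + S x) \<partial>lborel) \<partial>lborel)"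
    by (rule lborel_pair.Fubini') measurable
  also have "\<dots> = (\<integral>\<^sup>+y. (\<integral>\<^sup>+x. indicator A (S x - y) * indicator B (S x) \<partial>lborel) \<partial>lborel)"
  proof (rule nn_integral_cong)
    fix y
    show "(\<integral>\<^sup>+x. indicator A (S x) * indicator B (y + S x) \<partial>lborel) = (\<integral>\<^sup>+x. indicator A (S x - y) * indicator B (S x) \<partial>lborel)"
      using tr[of "\<lambda>x. indicator A (S x) * indicator B (y + S x)" "- T (y /\<^sub>R l)"] sh[of _ y] by simp
  qed
  also have "\<dots> = (\<integral>\<^sup>+x. (\<integral>\<^sup>+y. indicator A (S x - y) * indicator B (S x) \<partial>lborel) \<partial>lborel)"
    by (rule lborel_pair.Fubini') measurable
  also have "\<dots> = emeasure lborel A * emeasure lborel (S -` B)"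
    by (simp add: nn_integral_cmult nn_integral_multc refl vimage_ind)
  finally have "emeasure lborel (S -` A) * ennreal (unit_ball_vol (real CARD('n)) * l ^ CARD('n)) = emeasure lborel A * ennreal (unit_ball_vol (real CARD('n)))"
    unfolding SB using l by (simp add: B_def emeasure_ball)
  then have "ennreal (unit_ball_vol (real CARD('n))) * (ennreal (l ^ CARD('n)) * emeasure lborel (S -` A))
      = ennreal (unit_ball_vol (real CARD('n))) * emeasure lborel A"
    using V l by (subst (asm) ennreal_mult) (simp_all only: zero_le_power less_imp_le ac_simps)
  then show ?thesis using V
    by (subst (asm) ennreal_mult_cancel_left) (auto simp only: ennreal_eq_0_iff ennreal_neq_top)
qed


text \<open>The Borel identity passes to the completion because Lebesgue measure and its image under
  \<open>S\<close> have the same null sets, the factor \<open>l ^ CARD('n)\<close> being positive;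
  completion then commutes with taking image and density.\<close>

lemma
  fixes l :: real and z :: "real^'n" and O' :: "real^'n \<Rightarrow> real^'n"
  defines "S \<equiv> \<lambda>x. l *\<^sub>R O' x + z"
  assumes l: "l > 0" and O: "orthogonal_transformation O'"
  shows measurable_lebesgue_similarity: "S \<in> lebesgue \<rightarrow>\<^sub>M lebesgue"
    and lebesgue_eq_density_similarity: "lebesgue = density (distr lebesgue lebesgue S) (\<lambda>_. ennreal (l ^ CARD('n)))"
proof -
  have "linear O'" using O by (rule orthogonal_transformation_linear)
  then have "continuous_on UNIV S"
    unfolding S_def by (intro continuous_intros linear_continuous_on linear_conv_bounded_linear[THEN iffD1])
  then have S_borel[measurable]: "S \<in> borel \<rightarrow>\<^sub>M borel"
    by (rule borel_measurable_continuous_onI)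
  have em: "emeasure lborel A = ennreal (l ^ CARD('n)) * emeasure lborel (S -` A)" if "A \<in> sets borel" for A
    using emeasure_similarity_vimage[OF l O that] unfolding S_def .
  have lb: "lborel = density (distr lborel borel S) (\<lambda>_. ennreal (l ^ CARD('n)))"
  proof (rule measure_eqI)
    fix A :: "(real^'n) set" assume "A \<in> sets lborel"
    then show "emeasure lborel A = emeasure (density (distr lborel borel S) (\<lambda>_. ennreal (l ^ CARD('n)))) A"
      using em[of A] by (simp add: emeasure_density emeasure_distr nn_integral_cmult)
  qed simp
  have eq: "null_sets lborel = null_sets (distr lebesgue lborel S)"
  proof -
    have "emeasure lborel A = 0 \<longleftrightarrow> emeasure (distr lebesgue lborel S) A = 0" if "A \<in> sets borel" for A
      using em[OF that] that l by (simp add: distr_completion emeasure_distr cong: distr_cong)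
    then show ?thesis by (auto simp: null_sets_def)
  qed
  show "S \<in> lebesgue \<rightarrow>\<^sub>M lebesgue"
    by (simp add: completion.measurable_completion2 eq measurable_completion)
  have "lebesgue = completion (density (distr lborel borel S) (\<lambda>_. ennreal (l ^ CARD('n))))"
    by (subst lb) simp
  also have "\<dots> = density (completion (distr lebesgue lborel S)) (\<lambda>_. ennreal (l ^ CARD('n)))"
    using l by (auto intro!: always_eventually completion_density_eq simp: distr_completion cong: distr_cong)
  also have "\<dots> = density (distr lebesgue lebesgue S) (\<lambda>_. ennreal (l ^ CARD('n)))"
    by (subst completion.completion_distr_eq) (auto simp: eq measurable_completion)
  finally show "lebesgue = density (distr lebesgue lebesgue S) (\<lambda>_. ennreal (l ^ CARD('n)))" .
qed

lemma
  fixes l :: real and z :: "real^'n" and O' :: "real^'n \<Rightarrow> real^'n" and f :: "real^'n \<Rightarrow> 'b::{banach, second_countable_topology}"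
  assumes l: "l > 0" and O: "orthogonal_transformation O'" and f: "integrable lebesgue f"
  shows integrable_similarity: "integrable lebesgue (\<lambda>x. f (l *\<^sub>R O' x + z))"
    and integral_similarity: "(LINT x|lebesgue. f (l *\<^sub>R O' x + z)) = (LINT x|lebesgue. f x) /\<^sub>R l ^ CARD('n)"
proof -
  note m = measurable_lebesgue_similarity[OF l O, of z]
  have fm: "f \<in> borel_measurable lebesgue" using f by simp
  have "integrable (density (distr lebesgue lebesgue (\<lambda>x. l *\<^sub>R O' x + z)) (\<lambda>_. ennreal (l ^ CARD('n)))) f"
    using f by (subst lebesgue_eq_density_similarity[OF l O, of z, symmetric])
  then have "integrable lebesgue (\<lambda>x. l ^ CARD('n) *\<^sub>R f (l *\<^sub>R O' x + z))"
    using fm m l by (subst (asm) integrable_density) (auto simp: integrable_distr_eq)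
  from integrable_scaleR_right[OF this, of "inverse (l ^ CARD('n))"]
  show "integrable lebesgue (\<lambda>x. f (l *\<^sub>R O' x + z))" using l by simp
  have "(LINT x|lebesgue. f x) = (LINT x|density (distr lebesgue lebesgue (\<lambda>x. l *\<^sub>R O' x + z)) (\<lambda>_. ennreal (l ^ CARD('n))). f x)"
    by (subst lebesgue_eq_density_similarity[OF l O, of z, symmetric]) simp
  also have "\<dots> = (LINT x|lebesgue. l ^ CARD('n) *\<^sub>R f (l *\<^sub>R O' x + z))"
    using fm m l by (subst integral_density) (auto simp: integral_distr)
  finally show "(LINT x|lebesgue. f (l *\<^sub>R O' x + z)) = (LINT x|lebesgue. f x) /\<^sub>R l ^ CARD('n)"
    using l by simp
qed


section \<open>Smooth functions\<close>

lemma partial_eq: "(f has_derivative F) (at x) \<Longrightarrow> partial i f x = F (axis i 1)"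
  unfolding partial_def by (simp add: frechet_derivative_at[symmetric])

lemma has_derivative_partials:
  fixes f :: "real^'n \<Rightarrow> real"
  assumes "f differentiable (at x)"
  shows "(f has_derivative (\<lambda>h. \<Sum>i\<in>UNIV. h $ i * partial i f x)) (at x)"
proof -
  have d: "(f has_derivative frechet_derivative f (at x)) (at x)"
    using assms frechet_derivative_works by blast
  have "frechet_derivative f (at x) h = (\<Sum>i\<in>UNIV. h $ i * partial i f x)" for h
  proof -
    have lin: "linear (frechet_derivative f (at x))" using d by (rule has_derivative_linear)
    have "frechet_derivative f (at x) (\<Sum>i\<in>UNIV. h $ i *\<^sub>R axis i 1) = (\<Sum>i\<in>UNIV. h $ i * partial i f x)"
      unfolding partial_def linear_sum[OF lin] by (simp add: linear_scale[OF lin])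
    then show ?thesis using basis_expansion[of h] by (simp add: scalar_mult_eq_scaleR)
  qed
  then show ?thesis using d by presburger
qed

lemma partial_add:
  assumes "f differentiable (at x)" "g differentiable (at x)"
  shows "partial i (\<lambda>x. f x + g x) x = partial i f x + partial i g x"
  using partial_eq[OF has_derivative_add] assms unfolding partial_def frechet_derivative_works by blast

lemma partial_mult:
  assumes "f differentiable (at x)" "g differentiable (at x)"
  shows "partial i (\<lambda>x. f x * g x) x = f x * partial i g x + partial i f x * g x"
  using partial_eq[OF has_derivative_mult] assms unfolding partial_def frechet_derivative_works by blast

lemma C_k_const [simp]: "C_k k (\<lambda>x. c)"
proof (induction k arbitrary: c)
  case (Suc k)
  have "partial i (\<lambda>x. c) = (\<lambda>x. 0)" for i :: 'a
    by (rule ext) (simp add: partial_eq[OF has_derivative_const])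
  then show ?case using Suc by simp
qed simp

lemma C_k_Suc_D: "C_k (Suc k) f \<Longrightarrow> C_k k f"
proof (induction k arbitrary: f)
  case 0
  then show ?case by (auto intro!: continuous_at_imp_continuous_on differentiable_imp_continuous_within)
next
  case (Suc k)
  then show ?case by (metis C_k.simps(2))
qed

lemma C_k_add: "C_k k f \<Longrightarrow> C_k k g \<Longrightarrow> C_k k (\<lambda>x. f x + g x)"
proof (induction k arbitrary: f g)
  case (Suc k)
  have "partial i (\<lambda>x. f x + g x) = (\<lambda>x. partial i f x + partial i g x)" for i
    using Suc.prems by (intro ext partial_add) auto
  then show ?case using Suc by (auto intro: differentiable_add)
qed (auto intro: continuous_on_add)

lemma C_k_mult: "C_k k f \<Longrightarrow> C_k k g \<Longrightarrow> C_k k (\<lambda>x. f x * g x)"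
proof (induction k arbitrary: f g)
  case (Suc k)
  have "partial i (\<lambda>x. f x * g x) = (\<lambda>x. f x * partial i g x + partial i f x * g x)" for i
    using Suc.prems by (intro ext partial_mult) auto
  moreover have "C_k k f" "C_k k g" using Suc.prems C_k_Suc_D by blast+
  ultimately show ?case using Suc by (auto intro!: differentiable_mult C_k_add)
qed (auto intro: continuous_on_mult)

lemma C_k_sum: "(\<And>i. i \<in> I \<Longrightarrow> C_k k (f i)) \<Longrightarrow> C_k k (\<lambda>x. \<Sum>i\<in>I. f i x)"
  by (induction I rule: infinite_finite_induct) (auto intro: C_k_add)

lemma C_k_prod: "(\<And>i. i \<in> I \<Longrightarrow> C_k k (f i)) \<Longrightarrow> C_k k (\<lambda>x. \<Prod>i\<in>I. f i x)"
  by (induction I rule: infinite_finite_induct) (auto intro: C_k_mult)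

lemma has_derivative_affine_comp:
  fixes f :: "real^'n \<Rightarrow> real" and T :: "real^'m \<Rightarrow> real^'n"
  assumes T: "linear T" and f: "f differentiable (at (T x + z))"
  shows "((\<lambda>x. f (T x + z)) has_derivative (\<lambda>h. \<Sum>j\<in>UNIV. T h $ j * partial j f (T x + z))) (at x)"
proof -
  have "((\<lambda>x. T x + z) has_derivative T) (at x)"
    using has_derivative_add[OF linear_imp_has_derivative[OF T] has_derivative_const] by simp
  from has_derivative_compose[OF this has_derivative_partials[OF f]] show ?thesis .
qed

lemma C_k_affine:
  fixes T :: "real^'m \<Rightarrow> real^'n"
  assumes T: "linear T"
  shows "C_k k f \<Longrightarrow> C_k k (\<lambda>x. f (T x + z))"
proof (induction k arbitrary: f)
  case 0
  have "continuous_on UNIV (\<lambda>x. T x + z)"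
    using T by (intro continuous_intros linear_continuous_on linear_conv_bounded_linear[THEN iffD1])
  then show ?case using 0 by (auto intro: continuous_on_compose2)
next
  case (Suc k)
  note d = has_derivative_affine_comp[OF T, of f _ z]
  have "partial i (\<lambda>x. f (T x + z)) = (\<lambda>x. \<Sum>j\<in>UNIV. T (axis i 1) $ j * partial j f (T x + z))" for i
    using Suc.prems by (intro ext partial_eq d) auto
  moreover have "(\<lambda>x. f (T x + z)) differentiable (at x)" for x
    unfolding differentiable_def using d[of x] Suc.prems by auto
  ultimately show ?case using Suc by (auto intro!: C_k_sum C_k_mult)
qed

section \<open>Smooth functions of one variable and bump functions\<close>

text \<open>Unlike in \<open>C_k\<close>, the derivative is an existential witness, so that closure
  proofs only have to exhibit the right function.\<close>

primrec smooth_k :: "nat \<Rightarrow> (real \<Rightarrow> real) \<Rightarrow> bool" where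
  "smooth_k 0 f \<longleftrightarrow> continuous_on UNIV f"
| "smooth_k (Suc k) f \<longleftrightarrow> (\<exists>g. (\<forall>x. (f has_real_derivative g x) (at x)) \<and> smooth_k k g)"

lemma smooth_k_Suc_D: "smooth_k (Suc k) f \<Longrightarrow> smooth_k k f"
proof (induction k arbitrary: f)
  case 0
  then show ?case by (metis DERIV_isCont continuous_at_imp_continuous_on smooth_k.simps)
next
  case (Suc k)
  then show ?case by (metis smooth_k.simps(2))
qed

lemma smooth_k_add: "smooth_k k f \<Longrightarrow> smooth_k k g \<Longrightarrow> smooth_k k (\<lambda>x. f x + g x)"
proof (induction k arbitrary: f g)
  case (Suc k)
  then obtain f' g' where "\<And>x. (f has_real_derivative f' x) (at x)" "smooth_k k f'"
    "\<And>x. (g has_real_derivative g' x) (at x)" "smooth_k k g'" by auto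
  then show ?case using Suc.IH[of f' g'] by (auto intro!: exI[of _ "\<lambda>x. f' x + g' x"] DERIV_add)
qed (auto intro: continuous_on_add)

lemma smooth_k_mult: "smooth_k k f \<Longrightarrow> smooth_k k g \<Longrightarrow> smooth_k k (\<lambda>x. f x * g x)"
proof (induction k arbitrary: f g)
  case (Suc k)
  then obtain f' g' where *: "\<And>x. (f has_real_derivative f' x) (at x)" "smooth_k k f'"
    "\<And>x. (g has_real_derivative g' x) (at x)" "smooth_k k g'" by auto
  moreover have "smooth_k k f" "smooth_k k g" using Suc.prems smooth_k_Suc_D by blast+
  ultimately have "smooth_k k (\<lambda>x. f' x * g x + g' x * f x)"
    using Suc.IH by (intro smooth_k_add) auto
  then show ?case using * by (auto intro!: exI[of _ "\<lambda>x. f' x * g x + g' x * f x"] DERIV_mult)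
qed (auto intro: continuous_on_mult)

lemma smooth_k_const: "smooth_k k (\<lambda>x. c)"
  by (induction k arbitrary: c) (auto intro!: exI[of _ "\<lambda>x. 0"])

lemma smooth_k_affine: "smooth_k k f \<Longrightarrow> smooth_k k (\<lambda>x. f (c * x + d))"
proof (induction k arbitrary: f)
  case 0 then show ?case by (auto intro!: continuous_intros continuous_on_compose2[of UNIV f])
next
  case (Suc k)
  then obtain f' where f': "\<And>x. (f has_real_derivative f' x) (at x)" "smooth_k k f'" by auto
  have "((\<lambda>x. f (c * x + d)) has_real_derivative f' (c * x + d) * c) (at x)" for x
    by (rule DERIV_chain2[OF f'(1)]) (auto intro!: derivative_eq_intros)
  then show ?case using Suc.IH[OF f'(2)] smooth_k_mult[OF _ smooth_k_const]
    by (auto intro!: exI[of _ "\<lambda>x. f' (c * x + d) * c"])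
qed

lemma has_derivative_component_comp:
  "(f has_real_derivative D) (at (x $ i)) \<Longrightarrow> ((\<lambda>x. f (x $ i)) has_derivative (\<lambda>h. D * h $ i)) (at x)"
  using has_derivative_compose[OF bounded_linear_imp_has_derivative[OF bounded_linear_vec_nth], of f "\<lambda>h. D * h"]
  by (simp add: has_field_derivative_def)

lemma partial_component_comp:
  "(f has_real_derivative D) (at (x $ i)) \<Longrightarrow> partial j (\<lambda>x. f (x $ i)) x = (if j = i then D else 0)"
  by (subst partial_eq[OF has_derivative_component_comp]) (auto simp: axis_def)

lemma C_k_component:
  "smooth_k k f \<Longrightarrow> C_k k (\<lambda>x. f (x $ i))"
proof (induction k arbitrary: f)
  case 0 then show ?case by (auto intro!: continuous_intros continuous_on_compose2[of UNIV f])
next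
  case (Suc k)
  then obtain f' where f': "\<And>x. (f has_real_derivative f' x) (at x)" "smooth_k k f'" by auto
  have "partial j (\<lambda>x. f (x $ i)) = (\<lambda>x. f' (x $ i) * (if j = i then 1 else 0))" for j
    by (rule ext) (simp add: partial_component_comp[OF f'(1)])
  moreover have "(\<lambda>x. f (x $ i)) differentiable (at x)" for x
    unfolding differentiable_def using has_derivative_component_comp[OF f'(1)] by blast
  ultimately show ?case using Suc.IH[OF f'(2)] by (auto intro!: C_k_mult)
qed

definition flat :: "real poly \<Rightarrow> real \<Rightarrow> real" where
  "flat q t = (if 0 < t then poly q (1 / t) * exp (- (1 / t)) else 0)"

lemma flat_tendsto_0: "(flat q \<longlongrightarrow> 0) (at 0)"
proof -
  have "((\<lambda>x. poly q x * exp (- x)) \<longlongrightarrow> 0) at_top"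
  proof -
    have "((\<lambda>x. \<Sum>i\<le>degree q. coeff q i * (x ^ i / exp x)) \<longlongrightarrow> (\<Sum>i\<le>degree q. coeff q i * 0)) at_top"
      by (intro tendsto_sum tendsto_mult tendsto_const tendsto_power_div_exp_0)
    then show ?thesis by (simp add: poly_altdef sum_distrib_right exp_minus divide_inverse mult.assoc)
  qed
  from filterlim_compose[OF this filterlim_inverse_at_top_right]
  have "(flat q \<longlongrightarrow> 0) (at_right 0)"
    by (rule Lim_transform_eventually)
       (auto simp: flat_def inverse_eq_divide intro!: eventually_mono[OF eventually_at_right_less])
  moreover have "(flat q \<longlongrightarrow> 0) (at_left 0)"
    by (rule Lim_transform_eventually[OF tendsto_const]) (auto simp: flat_def eventually_at_left_field intro!: exI[of _ "-1"])
  ultimately show ?thesis by (simp add: filterlim_split_at)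
qed

text \<open>For positive \<open>t\<close> the inner function \<open>1 / t\<close> contributes the
  factor \<open>- (1 / t^2)\<close>, whence the polynomial \<open>x^2 (q - q')\<close> at
  \<open>x = 1 / t\<close>. At \<open>0\<close> the difference quotient of \<open>flat q\<close> is
  again in the family, with polynomial \<open>x q\<close>, and tends to 0.\<close>

lemma flat_has_derivative:
  "(flat q has_real_derivative flat ([:0, 0, 1:] * (q - pderiv q)) t) (at t)"
proof (cases t "0 :: real" rule: linorder_cases)
  case less
  have "((\<lambda>t. 0) has_real_derivative 0) (at t)" by simp
  then have "(flat q has_real_derivative 0) (at t)"
    by (rule has_field_derivative_transform_within_open[of _ _ _ "{..<0}"]) (use less in \<open>auto simp: flat_def\<close>)
  then show ?thesis using less by (simp add: flat_def)
next
  case equal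
  have "((\<lambda>h. (flat q (0 + h) - flat q 0) / h) \<longlongrightarrow> 0) (at 0)"
    by (rule Lim_transform_eventually[OF flat_tendsto_0[of "[:0, 1:] * q"]])
       (auto simp: flat_def eventually_at_filter)
  then show ?thesis using equal by (simp add: DERIV_def flat_def)
next
  case greater
  have "((\<lambda>t. poly q (1 / t) * exp (- (1 / t))) has_real_derivative
      (poly q (1 / t) * (exp (- (1 / t)) * (1 / t^2)) + poly (pderiv q) (1 / t) * (- (1 / t^2)) * exp (- (1 / t)))) (at t)"
    using greater by (auto intro!: derivative_eq_intros DERIV_chain2[OF poly_DERIV] simp: power2_eq_square)
  then have "(flat q has_real_derivative (poly q (1 / t) * (exp (- (1 / t)) * (1 / t^2)) + poly (pderiv q) (1 / t) * (- (1 / t^2)) * exp (- (1 / t)))) (at t)"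
    by (rule has_field_derivative_transform_within_open[of _ _ _ "{0<..}"]) (use greater in \<open>auto simp: flat_def\<close>)
  then show ?thesis using greater by (simp add: flat_def algebra_simps power2_eq_square)
qed

lemma smooth_k_flat: "smooth_k k (flat q)"
proof (induction k arbitrary: q)
  case 0
  have "isCont (flat q) x" for x using flat_has_derivative by (rule DERIV_isCont)
  then show ?case by (simp add: continuous_at_imp_continuous_on)
next
  case (Suc k) then show ?case using flat_has_derivative by (auto intro!: exI)
qed

text \<open>For positive \<open>c\<close> the value between \<open>a\<close> and \<open>b\<close> is
  the \<open>c\<close>-th root of the value for \<open>c = 1\<close>, and so tends to 1 as
  \<open>c\<close> grows. Thus \<open>c\<close> controls the sharpness, and indicators of open
  intervals are limits of bumps with a fixed support.\<close>

definition bump :: "real \<Rightarrow> real \<Rightarrow> real \<Rightarrow> real \<Rightarrow> real" where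
  "bump a b c t = flat 1 (c * t + - (c * a)) * flat 1 (- c * t + c * b)"

lemma smooth_k_bump: "smooth_k k (bump a b c)"
  unfolding bump_def[abs_def] by (intro smooth_k_mult smooth_k_affine smooth_k_flat)

lemma bump_eq:
  assumes "c > 0"
  shows "bump a b c t = (if a < t \<and> t < b then exp (- (1 / (t - a) + 1 / (b - t)) / c) else 0)"
proof -
  have "0 < c * t + - (c * a) \<longleftrightarrow> a < t" "0 < - c * t + c * b \<longleftrightarrow> t < b" using assms by auto
  moreover have "1 / (c * t + - (c * a)) = 1 / (t - a) / c" "1 / (- c * t + c * b) = 1 / (b - t) / c"
    by (simp_all add: algebra_simps)
  ultimately have "flat 1 (c * t + - (c * a)) = (if a < t then exp (- (1 / (t - a) / c)) else 0)"
    "flat 1 (- c * t + c * b) = (if t < b then exp (- (1 / (b - t) / c)) else 0)"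
    unfolding flat_def by (simp_all only: poly_1 mult_1)
  moreover have "exp (- (u + v) / c) = exp (- (u / c)) * exp (- (v / c))" for u v :: real
    unfolding exp_add[symmetric] by (simp add: diff_divide_distrib)
  ultimately show ?thesis
    unfolding bump_def by (cases "a < t"; cases "t < b") (simp_all only: simp_thms if_True if_False mult_zero_left mult_zero_right)
qed

lemma bump_bounds: "c > 0 \<Longrightarrow> 0 \<le> bump a b c t" "c > 0 \<Longrightarrow> bump a b c t \<le> 1"
proof -
  assume c: "c > 0"
  then show "0 \<le> bump a b c t" by (metis bump_eq exp_ge_zero order_refl)
  have "- (1 / (t - a) + 1 / (b - t)) / c \<le> 0" if "a < t" "t < b"
  proof -
    have "0 \<le> 1 / (t - a)" "0 \<le> 1 / (b - t)" using that by auto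
    then show ?thesis using c by (intro divide_nonpos_pos) linarith+
  qed
  then show "bump a b c t \<le> 1" using c by (metis bump_eq exp_le_one_iff zero_le_one)
qed

lemma bump_LIMSEQ: "(\<lambda>k. bump a b (real (Suc k)) t) \<longlonglongrightarrow> (if a < t \<and> t < b then 1 else 0)"
proof -
  have "(\<lambda>k. exp (- (1 / (t - a) + 1 / (b - t)) * inverse (real (Suc k)))) \<longlonglongrightarrow> exp (- (1 / (t - a) + 1 / (b - t)) * 0)"
    by (intro tendsto_exp tendsto_mult tendsto_const LIMSEQ_inverse_real_of_nat)
  then show ?thesis by (auto simp: bump_eq divide_inverse)
qed

definition box_bump :: "real^'n \<Rightarrow> real^'n \<Rightarrow> real \<Rightarrow> real^'n \<Rightarrow> real" where
  "box_bump a b c x = (\<Prod>i\<in>UNIV. bump (a $ i) (b $ i) c (x $ i))"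

lemma C_k_box_bump: "C_k k (box_bump a b c)"
  unfolding box_bump_def[abs_def] by (intro C_k_prod C_k_component smooth_k_bump)

lemma box_bump_bounds: "c > 0 \<Longrightarrow> 0 \<le> box_bump a b c x" "c > 0 \<Longrightarrow> box_bump a b c x \<le> 1"
  unfolding box_bump_def by (auto intro!: prod_nonneg prod_le_1 simp: bump_bounds)

lemma box_bump_eq_0: "c > 0 \<Longrightarrow> x \<notin> box a b \<Longrightarrow> box_bump a b c x = 0"
  unfolding box_bump_def by (auto simp: mem_box_cart bump_eq)

lemma box_bump_LIMSEQ: "(\<lambda>k. box_bump a b (real (Suc k)) x) \<longlonglongrightarrow> indicator (box a b) x"
proof -
  have "(\<lambda>k. box_bump a b (real (Suc k)) x) \<longlonglongrightarrow> (\<Prod>i\<in>UNIV. if a $ i < x $ i \<and> x $ i < b $ i then 1 else 0)"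
    unfolding box_bump_def by (intro tendsto_prod bump_LIMSEQ)
  also have "(\<Prod>i\<in>UNIV. if a $ i < x $ i \<and> x $ i < b $ i then 1 else 0) = (indicator (box a b) x :: real)"
    by (auto simp: mem_box_cart indicator_def)
  finally show ?thesis .
qed

section \<open>Test functions and their integrals\<close>

lemma test_functionI:
  assumes "\<And>k. C_k k f" "bounded {x. f x \<noteq> 0}"
  shows "test_function f"
  using assms unfolding test_function_def by (simp add: compact_closure)

lemma test_function_bounded_support: "test_function f \<Longrightarrow> bounded {x. f x \<noteq> 0}"
  unfolding test_function_def by simp

lemma test_function_continuous: "test_function f \<Longrightarrow> continuous_on UNIV f"
  unfolding test_function_def by (metis C_k.simps(1))

lemma test_function_differentiable: "test_function f \<Longrightarrow> f differentiable (at x)"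
  unfolding test_function_def by (metis C_k.simps(2))

lemma test_function_mult: "test_function f \<Longrightarrow> (\<And>k. C_k k g) \<Longrightarrow> test_function (\<lambda>x. g x * f x)"
  by (rule test_functionI) (auto simp: test_function_def intro: C_k_mult elim!: bounded_subset)

lemma test_function_partial:
  assumes f: "test_function f"
  shows "test_function (partial i f)"
proof (rule test_functionI)
  show "C_k k (partial i f)" for k using f unfolding test_function_def by (metis C_k.simps(2))
  have "partial i f x = 0" if "x \<notin> closure {x. f x \<noteq> 0}" for x
  proof -
    have "((\<lambda>x. 0) has_derivative (\<lambda>h. 0)) (at x)" by simp
    then have "(f has_derivative (\<lambda>h. 0)) (at x)"
      by (rule has_derivative_transform_within_open[of _ _ _ _ "- closure {x. f x \<noteq> 0}"])
         (use that closure_subset[of "{x. f x \<noteq> 0}"] in auto)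
    then show ?thesis by (rule partial_eq)
  qed
  then have "{x. partial i f x \<noteq> 0} \<subseteq> closure {x. f x \<noteq> 0}" by auto
  then show "bounded {x. partial i f x \<noteq> 0}"
    using f unfolding test_function_def by (meson bounded_subset compact_imp_bounded)
qed

lemma test_function_box_bump: "c > 0 \<Longrightarrow> test_function (box_bump a b c)"
  by (rule test_functionI[OF C_k_box_bump]) (rule bounded_subset[OF bounded_box[of a b]], auto dest: box_bump_eq_0)

lemma test_function_bounded:
  assumes "test_function f"
  obtains B where "0 \<le> B" "\<And>x. \<bar>f x\<bar> \<le> B"
proof -
  have "compact (f ` closure {x. f x \<noteq> 0})"
    using assms test_function_continuous[OF assms] unfolding test_function_def
    by (intro compact_continuous_image) (auto intro: continuous_on_subset)
  then obtain B where B: "\<And>x. x \<in> closure {x. f x \<noteq> 0} \<Longrightarrow> \<bar>f x\<bar> \<le> B"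
    by (force dest: compact_imp_bounded simp: bounded_iff)
  have "\<bar>f x\<bar> \<le> max 0 B" for x
    using B[of x] closure_subset[of "{x. f x \<noteq> 0}"] by (cases "f x = 0") (auto simp: subset_iff le_max_iff_disj)
  then show ?thesis by (intro that[of "max 0 B"]) auto
qed

lemma test_function_lipschitz:
  fixes f :: "real^'n \<Rightarrow> real"
  assumes "test_function f"
  obtains L where "0 \<le> L" "\<And>x y. \<bar>f x - f y\<bar> \<le> L * norm (x - y)"
proof -
  have "\<forall>i. \<exists>B. 0 \<le> B \<and> (\<forall>x. \<bar>partial i f x\<bar> \<le> B)"
    using test_function_bounded[OF test_function_partial[OF assms]] by metis
  then obtain B where B: "\<And>i. 0 \<le> B i" "\<And>i x. \<bar>partial i f x\<bar> \<le> B i" by metis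
  define L where "L = (\<Sum>i\<in>UNIV. B i)"
  have "norm (f x - f y) \<le> L * norm (x - y)" for x y
  proof (rule differentiable_bound[of UNIV])
    fix x
    show "(f has_derivative (\<lambda>h. \<Sum>i\<in>UNIV. h $ i * partial i f x)) (at x within UNIV)"
      using has_derivative_partials[OF test_function_differentiable[OF assms]] by simp
    show "onorm (\<lambda>h. \<Sum>i\<in>UNIV. h $ i * partial i f x) \<le> L"
    proof (rule onorm_le)
      fix h :: "real^'n"
      have "norm (\<Sum>i\<in>UNIV. h $ i * partial i f x) \<le> (\<Sum>i\<in>UNIV. norm h * B i)"
        using B component_le_norm_cart[of h] by (intro sum_norm_le) (simp add: abs_mult mult_mono)
      then show "norm (\<Sum>i\<in>UNIV. h $ i * partial i f x) \<le> L * norm h"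
        unfolding L_def by (simp add: sum_distrib_left mult.commute)
    qed
  qed auto
  then show ?thesis using B by (intro that[of L]) (auto simp: L_def intro: sum_nonneg)
qed

lemma integrable_indicator_bounded:
  fixes S :: "'a::euclidean_space set"
  assumes "bounded S" "S \<in> sets lebesgue"
  shows "integrable lebesgue (indicator S :: _ \<Rightarrow> real)"
  using bounded_set_imp_lmeasurable[OF assms] by (auto simp: fmeasurable_def intro!: integrable_real_indicator)

lemma bounded_support_integrable:
  fixes f :: "real^'n \<Rightarrow> real"
  assumes m: "f \<in> borel_measurable lebesgue" and s: "bounded {x. f x \<noteq> 0}" and B: "\<And>x. \<bar>f x\<bar> \<le> B"
  shows "integrable lebesgue f"
proof -
  obtain R where R: "{x. f x \<noteq> 0} \<subseteq> cball 0 R" using bounded_subset_ballD[OF s, of 0] ball_subset_cball by blast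
  show ?thesis
  proof (rule Bochner_Integration.integrable_bound)
    show "integrable lebesgue (\<lambda>x. B * indicator (cball 0 R) (x::real^'n))"
      by (intro integrable_mult_right integrable_indicator_bounded) auto
    have "norm (f x) \<le> norm (B * indicator (cball 0 R) x)" for x
      using R B[of x] by (cases "f x = 0") (auto simp: indicator_def)
    then show "AE x in lebesgue. norm (f x) \<le> norm (B * indicator (cball 0 R) x)" by simp
  qed (rule m)
qed

lemma continuous_imp_lebesgue_measurable:
  "continuous_on UNIV f \<Longrightarrow> f \<in> borel_measurable lebesgue"
  by (intro measurable_completion) (simp add: borel_measurable_continuous_onI)

lemma test_function_integrable: 
  assumes "test_function f" shows "integrable lebesgue f"
  by (rule test_function_bounded[OF assms])
     (rule bounded_support_integrable[OF continuous_imp_lebesgue_measurable[OF test_function_continuous[OF assms]]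
        test_function_bounded_support[OF assms]])

text \<open>Difference quotients of \<open>f\<close> in direction \<open>e\<close> have integral
  zero by translation invariance. The Lipschitz bound and the bounded support dominate them, so the
  integral of their limit is zero too.\<close>

lemma integral_partial_test_function:
  fixes f :: "real^'n \<Rightarrow> real"
  assumes f: "test_function f"
  shows "(LINT x|lebesgue. partial i f x) = 0"
proof -
  obtain L where L: "0 \<le> L" "\<And>x y. \<bar>f x - f y\<bar> \<le> L * norm (x - y)" using test_function_lipschitz[OF f] by blast
  obtain R where R: "\<And>x. f x \<noteq> 0 \<Longrightarrow> norm x \<le> R"
    using test_function_bounded_support[OF f] unfolding bounded_iff by blast
  define e :: "real^'n" where "e = axis i 1"
  define D where "D k x = (f (x + e /\<^sub>R real (Suc k)) - f x) * real (Suc k)" for k x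
  have tr: "integrable lebesgue (\<lambda>x. f (x + z)) \<and> (LINT x|lebesgue. f (x + z)) = (LINT x|lebesgue. f x)" for z
    using integrable_similarity[OF zero_less_one orthogonal_transformation_id test_function_integrable[OF f], of z]
      integral_similarity[OF zero_less_one orthogonal_transformation_id test_function_integrable[OF f], of z] by simp
  have D0: "(LINT x|lebesgue. D k x) = 0" for k
    unfolding D_def using tr[of "e /\<^sub>R real (Suc k)"] test_function_integrable[OF f] by simp
  have D: "integrable lebesgue (D k)" for k
    unfolding D_def using tr[of "e /\<^sub>R real (Suc k)"] test_function_integrable[OF f] by simp
  have lim: "(\<lambda>k. D k x) \<longlonglongrightarrow> partial i f x" for x
  proof -
    have "((\<lambda>t. x + t *\<^sub>R e) has_derivative (\<lambda>t. t *\<^sub>R e)) (at 0)"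
      by (auto intro!: derivative_eq_intros)
    moreover have "(f has_derivative (\<lambda>h. \<Sum>i\<in>UNIV. h $ i * partial i f x)) (at (x + 0 *\<^sub>R e))"
      using has_derivative_partials[OF test_function_differentiable[OF f], of x] by simp
    ultimately have "((\<lambda>t. f (x + t *\<^sub>R e)) has_derivative (\<lambda>t. \<Sum>j\<in>UNIV. (t *\<^sub>R e) $ j * partial j f x)) (at 0)"
      by (rule has_derivative_compose)
    moreover have "(\<lambda>t. \<Sum>j\<in>UNIV. (t *\<^sub>R e) $ j * partial j f x) = (\<lambda>t. partial i f x * t)"
      by (rule ext) (simp add: e_def axis_def if_distrib if_distribR sum.delta mult.commute cong: if_cong)
    ultimately have "((\<lambda>t. f (x + t *\<^sub>R e)) has_real_derivative partial i f x) (at 0)"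
      by (simp add: has_field_derivative_def)
    then have "((\<lambda>t. (f (x + t *\<^sub>R e) - f x) / t) \<longlongrightarrow> partial i f x) (at 0)"
      by (simp add: DERIV_def)
    then have "(\<lambda>k. (f (x + inverse (real (Suc k)) *\<^sub>R e) - f x) / inverse (real (Suc k))) \<longlonglongrightarrow> partial i f x"
      by (rule filterlim_compose) (simp add: filterlim_at LIMSEQ_inverse_real_of_nat del: of_nat_Suc)
    then show ?thesis unfolding D_def by (simp add: divide_inverse)
  qed
  \<comment> \<open>The radius is \<open>R + 1\<close> because the shift has length at most 1:
    outside this ball both values in the difference quotient vanish.\<close>
  have bd: "\<bar>D k x\<bar> \<le> L * indicator (cball 0 (R + 1)) x" for k x
  proof (cases "norm x \<le> R + 1")
    case True
    have "\<bar>f (x + e /\<^sub>R real (Suc k)) - f x\<bar> \<le> L * (1 / real (Suc k))"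
      using L(2)[of "x + e /\<^sub>R real (Suc k)" x] by (simp add: e_def inverse_eq_divide)
    then have "\<bar>D k x\<bar> \<le> L * (1 / real (Suc k)) * real (Suc k)"
      unfolding D_def abs_mult abs_of_nat by (intro mult_right_mono) simp_all
    then show ?thesis using True by simp
  next
    case False
    have "norm x - norm (e /\<^sub>R real (Suc k)) \<le> norm (x + e /\<^sub>R real (Suc k))" by (rule norm_diff_ineq)
    moreover have "norm (e /\<^sub>R real (Suc k)) \<le> 1" by (simp add: e_def inverse_eq_divide)
    ultimately have "f (x + e /\<^sub>R real (Suc k)) = 0" "f x = 0" using R False by force+
    then show ?thesis using L by (simp add: D_def)
  qed
  have "(\<lambda>k. LINT x|lebesgue. D k x) \<longlonglongrightarrow> (LINT x|lebesgue. partial i f x)"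
  proof (rule integral_dominated_convergence[where w="\<lambda>x. L * indicator (cball 0 (R + 1)) x"])
    show "integrable lebesgue (\<lambda>x. L * indicator (cball 0 (R + 1)) (x::real^'n))"
      by (intro integrable_mult_right integrable_indicator_bounded) auto
  qed (use lim bd D test_function_integrable[OF test_function_partial[OF f]] in auto)
  then show ?thesis unfolding D0 by (simp add: LIMSEQ_const_iff)
qed


section \<open>Weak gradients\<close>

text \<open>Only restrictions to compact sets are known to be integrable; \<open>f\<close> is the
  pointwise limit of its truncations to growing balls.\<close>

lemma L1_loc_measurable:
  assumes "f \<in> L1_loc" shows "f \<in> borel_measurable lebesgue"
proof (rule borel_measurable_LIMSEQ_real)
  show "(\<lambda>x. indicator (cball 0 (real k)) x * f x) \<in> borel_measurable lebesgue" for k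
    using assms unfolding L1_loc_def set_integrable_def by (auto dest!: spec[of _ "cball 0 (real k)"])
  show "(\<lambda>k. indicator (cball 0 (real k)) x * f x) \<longlonglongrightarrow> f x" for x
  proof (rule tendsto_eventually)
    obtain N where "norm x \<le> real N" using real_arch_simple by blast
    then show "\<forall>\<^sub>F k in sequentially. indicator (cball 0 (real k)) x * f x = f x"
      unfolding eventually_sequentially by (intro exI[of _ N]) (auto simp: indicator_def)
  qed
qed

lemma L1_loc_mult_bounded:
  fixes f h :: "real^'n \<Rightarrow> real"
  assumes f: "f \<in> L1_loc" and h: "h \<in> borel_measurable lebesgue" "bounded {x. h x \<noteq> 0}" "\<And>x. \<bar>h x\<bar> \<le> B"
  shows "integrable lebesgue (\<lambda>x. f x * h x)"
proof -
  define C where "C = closure {x. h x \<noteq> 0}"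
  have C: "compact C" "\<And>x. x \<notin> C \<Longrightarrow> h x = 0"
    using h(2) closure_subset[of "{x. h x \<noteq> 0}"] by (auto simp: C_def compact_closure)
  have "integrable lebesgue (\<lambda>x. B * (indicator C x *\<^sub>R f x))"
    using f C unfolding L1_loc_def set_integrable_def by (intro integrable_mult_right) auto
  then show ?thesis
  proof (rule Bochner_Integration.integrable_bound)
    show "(\<lambda>x. f x * h x) \<in> borel_measurable lebesgue" using L1_loc_measurable[OF f] h(1) by simp
    have "norm (f x * h x) \<le> norm (B * (indicator C x *\<^sub>R f x))" for x
      using C(2)[of x] h(3)[of x] by (cases "x \<in> C") (auto simp: abs_mult mult.commute[of "\<bar>f x\<bar>"] intro!: mult_right_mono)
    then show "AE x in lebesgue. norm (f x * h x) \<le> norm (B * (indicator C x *\<^sub>R f x))" by simp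
  qed
qed

lemma L1_loc_mult_test:
  assumes "f \<in> L1_loc" "test_function \<phi>"
  shows "integrable lebesgue (\<lambda>x. f x * \<phi> x)"
  by (rule test_function_bounded[OF assms(2)])
     (rule L1_loc_mult_bounded[OF assms(1) continuous_imp_lebesgue_measurable[OF test_function_continuous[OF assms(2)]]
        test_function_bounded_support[OF assms(2)]])

lemma L1_loc_lincomb: "f \<in> L1_loc \<Longrightarrow> g \<in> L1_loc \<Longrightarrow> (\<lambda>x. a * f x + b * g x) \<in> L1_loc"
  unfolding L1_loc_def by (auto intro!: set_integral_add(1) set_integrable_mult_right)

lemma continuous_imp_L1_loc:
  fixes f :: "real^'n \<Rightarrow> real"
  assumes "continuous_on UNIV f" shows "f \<in> L1_loc"
  unfolding L1_loc_def set_integrable_def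
proof clarify
  fix K :: "(real^'n) set" assume "compact K"
  then have "integrable lborel (\<lambda>x. indicator K x *\<^sub>R f x)"
    using assms by (intro borel_integrable_compact) (auto intro: continuous_on_subset)
  then show "integrable lebesgue (\<lambda>x. indicator K x *\<^sub>R f x)"
    by (subst integrable_completion) auto
qed

text \<open>The fundamental lemma of the calculus of variations. Box bumps of growing sharpness turn
  the hypothesis into vanishing integrals over all boxes, and Lebesgue's differentiation theorem on
  shrinking cubes recovers \<open>d\<close> almost everywhere.\<close>

lemma AE_eq_0_of_test:
  fixes d :: "real^'n \<Rightarrow> real"
  assumes d: "d \<in> L1_loc" and z: "\<And>\<phi>. test_function \<phi> \<Longrightarrow> (LINT x|lebesgue. d x * \<phi> x) = 0"
  shows "AE x in lebesgue. d x = 0"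
proof -
  have cb: "set_integrable lebesgue (cbox a b) d" for a b using d by (auto simp: L1_loc_def)
  have bx: "(LINT x|lebesgue. d x * indicator (box a b) x) = 0" for a b
  proof -
    have im: "(indicator (box a b) :: _ \<Rightarrow> real) \<in> borel_measurable lebesgue"
      by (intro borel_measurable_indicator) simp
    have "(\<lambda>k. LINT x|lebesgue. d x * box_bump a b (real (Suc k)) x) \<longlonglongrightarrow> (LINT x|lebesgue. d x * indicator (box a b) x)"
    proof (rule integral_dominated_convergence)
      show "integrable lebesgue (\<lambda>x. \<bar>d x * indicator (box a b) x\<bar>)"
      proof (intro integrable_abs L1_loc_mult_bounded[OF d, of _ 1])
        show "(indicator (box a b) :: _ \<Rightarrow> real) \<in> borel_measurable lebesgue" by (rule im)
        show "bounded {x. indicator (box a b) x \<noteq> (0::real)}"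
          by (rule bounded_subset[OF bounded_box[of a b]]) (auto simp: indicator_def)
      qed (simp add: indicator_def)
      show "(\<lambda>x. d x * indicator (box a b) x) \<in> borel_measurable lebesgue"
        using L1_loc_measurable[OF d] im by (rule borel_measurable_times)
      show "(\<lambda>x. d x * box_bump a b (real (Suc k)) x) \<in> borel_measurable lebesgue" for k
        using L1_loc_mult_test[OF d test_function_box_bump[of "real (Suc k)" a b]] by simp
      show "AE x in lebesgue. (\<lambda>k. d x * box_bump a b (real (Suc k)) x) \<longlonglongrightarrow> d x * indicator (box a b) x"
        by (intro always_eventually allI tendsto_mult tendsto_const box_bump_LIMSEQ)
      show "AE x in lebesgue. norm (d x * box_bump a b (real (Suc k)) x) \<le> \<bar>d x * indicator (box a b) x\<bar>" for k
      proof (intro always_eventually allI)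
        fix x
        show "norm (d x * box_bump a b (real (Suc k)) x) \<le> \<bar>d x * indicator (box a b) x\<bar>"
          using box_bump_bounds[of "real (Suc k)" a b x] box_bump_eq_0[of "real (Suc k)" x a b]
          by (cases "x \<in> box a b") (auto simp: abs_mult mult_left_le)
      qed
    qed
    moreover have "(LINT x|lebesgue. d x * box_bump a b (real (Suc k)) x) = 0" for k
      by (intro z test_function_box_bump) simp
    ultimately show ?thesis by (simp add: LIMSEQ_const_iff)
  qed
  have int0: "integral (cbox a b) d = 0" for a b
  proof -
    have "set_integrable lebesgue (box a b) d"
      by (rule set_integrable_subset[OF cb[of a b]]) (auto simp: box_subset_cbox)
    from set_lebesgue_integral_eq_integral(2)[OF this] bx[of a b]
    show ?thesis by (simp add: set_lebesgue_integral_def mult.commute integral_open_interval)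
  qed
  have "d integrable_on cbox a b" for a b
    using set_lebesgue_integral_eq_integral(1)[OF cb] .
  from integrable_ccontinuous_explicit[OF this] obtain N where N: "negligible N"
    and *: "\<And>x e. \<lbrakk>x \<notin> N; 0 < e\<rbrakk> \<Longrightarrow> \<exists>r>0. \<forall>h. 0 < h \<and> h < r \<longrightarrow>
       norm (integral (cbox x (x + h *\<^sub>R One)) d /\<^sub>R h ^ DIM(real^'n) - d x) < e" by blast
  have "d x = 0" if "x \<notin> N" for x
  proof (rule ccontr)
    assume "d x \<noteq> 0"
    then obtain r where r: "r > 0" "\<And>h. 0 < h \<Longrightarrow> h < r \<Longrightarrow>
       norm (integral (cbox x (x + h *\<^sub>R One)) d /\<^sub>R h ^ DIM(real^'n) - d x) < \<bar>d x\<bar>"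
      using *[OF \<open>x \<notin> N\<close>, of "\<bar>d x\<bar>"] by auto
    from r(2)[of "r / 2"] r(1) show False by (simp add: int0)
  qed
  then show ?thesis using N unfolding negligible_iff_null_sets by (auto intro: AE_I')
qed

lemma has_weak_partial_unique:
  assumes g: "has_weak_partial i u g" and h: "has_weak_partial i u h"
  shows "AE x in lebesgue. g x = h x"
proof -
  have L: "g \<in> L1_loc" "h \<in> L1_loc" using g h by (auto simp: has_weak_partial_def)
  have "AE x in lebesgue. 1 * g x + (-1) * h x = 0"
  proof (rule AE_eq_0_of_test[OF L1_loc_lincomb[OF L]])
    fix \<phi> :: "real^'a \<Rightarrow> real" assume t: "test_function \<phi>"
    then have "(LINT x|lebesgue. g x * \<phi> x) = (LINT x|lebesgue. h x * \<phi> x)"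
      using g h unfolding has_weak_partial_def by (metis neg_equal_iff_equal)
    then show "(LINT x|lebesgue. (1 * g x + (-1) * h x) * \<phi> x) = 0"
      using L1_loc_mult_test[OF L(1) t] L1_loc_mult_test[OF L(2) t] by (simp add: left_diff_distrib)
  qed
  then show ?thesis by simp
qed

text \<open>The gradient is an explicit witness here, since \<open>weak_partial\<close> is an
  arbitrary choice that does not commute with linear combinations, similarities or limits.
  \<open>grad_norm_eq\<close> leads back to the chosen representative.\<close>

definition has_weak_gradient :: "real \<Rightarrow> (real^'n \<Rightarrow> real) \<Rightarrow> (real^'n \<Rightarrow> real^'n) \<Rightarrow> bool" where
  "has_weak_gradient p u G \<longleftrightarrow> u \<in> L1_loc \<and> (\<forall>i. has_weak_partial i u (\<lambda>x. G x $ i)) \<and>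
     G \<in> borel_measurable lebesgue \<and> integrable lebesgue (\<lambda>x. norm (G x) powr p)"

text \<open>The power of the gradient norm before the root is taken: a plain integral, in which
  pointwise inequalities and dominated convergence apply directly.\<close>

definition energy :: "real \<Rightarrow> (real^'n \<Rightarrow> real^'n) \<Rightarrow> real" where
  "energy p G = (LINT x|lebesgue. norm (G x) powr p)"

lemma energy_nonneg: "0 \<le> energy p G"
  unfolding energy_def by simp

lemma borel_measurable_vec_iff:
  fixes f :: "'a \<Rightarrow> real^'n"
  shows "f \<in> borel_measurable M \<longleftrightarrow> (\<forall>i. (\<lambda>x. f x $ i) \<in> borel_measurable M)"
  unfolding borel_measurable_euclidean_space[of f] by (auto simp: Basis_vec_def inner_axis)

lemma grad_norm_eq:
  assumes "has_weak_gradient p u G"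
  shows "grad_norm p u = energy p G powr (1 / p)"
proof -
  have G: "has_weak_partial i u (\<lambda>x. G x $ i)" for i using assms by (simp add: has_weak_gradient_def)
  then have w: "has_weak_partial i u (weak_partial i u)" for i
    unfolding weak_partial_def using someI[of "has_weak_partial i u"] by blast
  have "AE x in lebesgue. \<forall>i. weak_partial i u x = G x $ i"
    using has_weak_partial_unique[OF w G] by (simp add: AE_all_countable)
  then have ae: "AE x in lebesgue. weak_gradient u x = G x"
    by (rule AE_mp) (simp add: weak_gradient_def vec_eq_iff)
  have "weak_partial i u \<in> borel_measurable lebesgue" for i
    using w[of i] by (intro L1_loc_measurable) (simp add: has_weak_partial_def)
  then have m: "weak_gradient u \<in> borel_measurable lebesgue"
    by (simp add: borel_measurable_vec_iff weak_gradient_def)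
  have "(LINT x|lebesgue. norm (weak_gradient u x) powr p) = (LINT x|lebesgue. norm (G x) powr p)"
    by (rule integral_cong_AE) (use ae m assms in \<open>auto simp: has_weak_gradient_def\<close>)
  then show ?thesis unfolding grad_norm_def energy_def by simp
qed

text \<open>The crude constant is good enough: this serves only to prove integrability and to build
  majorants.\<close>

lemma powr_add_le:
  fixes s t :: real
  assumes "0 \<le> s" "0 \<le> t" "0 \<le> p"
  shows "(s + t) powr p \<le> 2 powr p * (s powr p + t powr p)"
proof -
  have "(s + t) powr p \<le> (2 * max s t) powr p" using assms by (intro powr_mono2) auto
  also have "\<dots> = 2 powr p * max s t powr p" using assms by (simp add: powr_mult)
  also have "\<dots> \<le> 2 powr p * (s powr p + t powr p)" by (intro mult_left_mono) (auto simp: max_def)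
  finally show ?thesis .
qed

lemma norm_powr_lincomb_le:
  fixes x y :: "'a::real_normed_vector"
  assumes "0 \<le> p"
  shows "norm (a *\<^sub>R x + b *\<^sub>R y) powr p \<le> 2 powr p * (\<bar>a\<bar> powr p * norm x powr p + \<bar>b\<bar> powr p * norm y powr p)"
proof -
  have "norm (a *\<^sub>R x + b *\<^sub>R y) powr p \<le> (\<bar>a\<bar> * norm x + \<bar>b\<bar> * norm y) powr p"
    using assms norm_triangle_ineq[of "a *\<^sub>R x" "b *\<^sub>R y"] by (intro powr_mono2) auto
  also have "\<dots> \<le> 2 powr p * ((\<bar>a\<bar> * norm x) powr p + (\<bar>b\<bar> * norm y) powr p)"
    using assms by (intro powr_add_le) auto
  finally show ?thesis by (simp add: powr_mult)
qed

lemma integrable_norm_powr_lincomb: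
  fixes G H :: "'b \<Rightarrow> 'a::{banach, second_countable_topology}"
  assumes "0 \<le> p" "G \<in> borel_measurable M" "H \<in> borel_measurable M"
    "integrable M (\<lambda>x. norm (G x) powr p)" "integrable M (\<lambda>x. norm (H x) powr p)"
  shows "integrable M (\<lambda>x. norm (a *\<^sub>R G x + b *\<^sub>R H x) powr p)"
proof (rule Bochner_Integration.integrable_bound)
  show "integrable M (\<lambda>x. 2 powr p * (\<bar>a\<bar> powr p * norm (G x) powr p + \<bar>b\<bar> powr p * norm (H x) powr p))"
    using assms by (intro integrable_mult_right Bochner_Integration.integrable_add)
  show "(\<lambda>x. norm (a *\<^sub>R G x + b *\<^sub>R H x) powr p) \<in> borel_measurable M" using assms by simp
  show "AE x in M. norm (norm (a *\<^sub>R G x + b *\<^sub>R H x) powr p)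
      \<le> norm (2 powr p * (\<bar>a\<bar> powr p * norm (G x) powr p + \<bar>b\<bar> powr p * norm (H x) powr p))"
    using norm_powr_lincomb_le[OF assms(1)] by (intro always_eventually allI) (simp add: abs_mult)
qed

lemma has_weak_gradient_lincomb:
  assumes p: "0 \<le> p" and u: "has_weak_gradient p u G" and v: "has_weak_gradient p v H"
  shows "has_weak_gradient p (\<lambda>x. a * u x + b * v x) (\<lambda>x. a *\<^sub>R G x + b *\<^sub>R H x)"
  unfolding has_weak_gradient_def
proof (intro conjI allI)
  have uv: "u \<in> L1_loc" "v \<in> L1_loc" "has_weak_partial i u (\<lambda>x. G x $ i)" "has_weak_partial i v (\<lambda>x. H x $ i)" for i
    using u v by (auto simp: has_weak_gradient_def)
  show "(\<lambda>x. a * u x + b * v x) \<in> L1_loc" using uv by (intro L1_loc_lincomb)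
  show "(\<lambda>x. a *\<^sub>R G x + b *\<^sub>R H x) \<in> borel_measurable lebesgue"
    using u v unfolding has_weak_gradient_def
    by (intro borel_measurable_add borel_measurable_scaleR borel_measurable_const) auto
  show "integrable lebesgue (\<lambda>x. norm (a *\<^sub>R G x + b *\<^sub>R H x) powr p)"
    using u v p by (intro integrable_norm_powr_lincomb) (auto simp: has_weak_gradient_def)
  fix i
  have gh: "(\<lambda>x. G x $ i) \<in> L1_loc" "(\<lambda>x. H x $ i) \<in> L1_loc" using uv(3)[of i] uv(4)[of i] by (auto simp: has_weak_partial_def)
  show "has_weak_partial i (\<lambda>x. a * u x + b * v x) (\<lambda>x. (a *\<^sub>R G x + b *\<^sub>R H x) $ i)"
    unfolding has_weak_partial_def
  proof (intro conjI allI impI)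
    show "(\<lambda>x. (a *\<^sub>R G x + b *\<^sub>R H x) $ i) \<in> L1_loc" using L1_loc_lincomb[OF gh] by simp
    fix \<phi> :: "real^'a \<Rightarrow> real" assume t: "test_function \<phi>"
    have lin: "(LINT x|lebesgue. (a * f x + b * h x) * \<psi> x) = a * (LINT x|lebesgue. f x * \<psi> x) + b * (LINT x|lebesgue. h x * \<psi> x)"
      if "f \<in> L1_loc" "h \<in> L1_loc" "test_function \<psi>" for f h \<psi> :: "real^'a \<Rightarrow> real"
      using L1_loc_mult_test[OF that(1,3)] L1_loc_mult_test[OF that(2,3)] by (simp add: distrib_right mult.assoc)
    have "(LINT x|lebesgue. u x * partial i \<phi> x) = - (LINT x|lebesgue. G x $ i * \<phi> x)"
      "(LINT x|lebesgue. v x * partial i \<phi> x) = - (LINT x|lebesgue. H x $ i * \<phi> x)"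
      using uv t by (auto simp: has_weak_partial_def)
    then show "(LINT x|lebesgue. (a * u x + b * v x) * partial i \<phi> x) = - (LINT x|lebesgue. (a *\<^sub>R G x + b *\<^sub>R H x) $ i * \<phi> x)"
      using lin[OF uv(1,2) test_function_partial[OF t]] lin[OF gh t] by simp
  qed
qed

lemma has_weak_gradient_const:
  "has_weak_gradient p (\<lambda>x. c) (\<lambda>x. 0)"
  unfolding has_weak_gradient_def has_weak_partial_def
  using integral_partial_test_function
  by (auto intro!: continuous_imp_L1_loc)

text \<open>Integration by parts: the product of \<open>f\<close> with a test function is a test
  function, so its partial derivative integrates to zero, and the product rule splits this integral
  into the two required terms.\<close>

lemma has_weak_gradient_test_function:
  fixes f :: "real^'n \<Rightarrow> real"
  assumes f: "test_function f" and p: "0 < p"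
  shows "has_weak_gradient p f (\<lambda>x. \<chi> i. partial i f x)"
  unfolding has_weak_gradient_def
proof (intro conjI allI)
  have pt: "test_function (partial i f)" for i using f by (rule test_function_partial)
  show "f \<in> L1_loc" using f by (intro continuous_imp_L1_loc test_function_continuous)
  show m: "(\<lambda>x. \<chi> i. partial i f x) \<in> borel_measurable lebesgue"
    using continuous_imp_lebesgue_measurable[OF test_function_continuous[OF pt]] by (simp add: borel_measurable_vec_iff)
  show "has_weak_partial i f (\<lambda>x. (\<chi> i. partial i f x) $ i)" for i
    unfolding has_weak_partial_def
  proof (intro conjI allI impI)
    show "(\<lambda>x. (\<chi> i. partial i f x) $ i) \<in> L1_loc"
      using continuous_imp_L1_loc[OF test_function_continuous[OF pt]] by simp
    fix \<phi> :: "real^'n \<Rightarrow> real" assume t: "test_function \<phi>"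
    have "test_function (\<lambda>x. f x * \<phi> x)" using f t by (intro test_function_mult) (auto simp: test_function_def)
    from integral_partial_test_function[OF this, of i]
    have "(LINT x|lebesgue. f x * partial i \<phi> x + partial i f x * \<phi> x) = 0"
      by (simp add: partial_mult test_function_differentiable f t)
    moreover have "integrable lebesgue (\<lambda>x. f x * partial i \<phi> x)" "integrable lebesgue (\<lambda>x. partial i f x * \<phi> x)"
      using f t pt by (auto intro!: L1_loc_mult_test continuous_imp_L1_loc test_function_continuous test_function_partial)
    ultimately show "(LINT x|lebesgue. f x * partial i \<phi> x) = - (LINT x|lebesgue. (\<chi> i. partial i f x) $ i * \<phi> x)"
      by simp
  qed
  have "\<forall>i. \<exists>B. \<forall>x. \<bar>partial i f x\<bar> \<le> B" using test_function_bounded[OF pt] by metis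
  then obtain B where B: "\<And>i x. \<bar>partial i f x\<bar> \<le> B i" by metis
  have nB: "norm (\<chi> i. partial i f x) \<le> (\<Sum>i\<in>UNIV. B i)" for x
    using B by (intro order_trans[OF norm_le_l1_cart]) (auto intro!: sum_mono)
  show "integrable lebesgue (\<lambda>x. norm (\<chi> i. partial i f x) powr p)"
  proof (rule bounded_support_integrable)
    show "(\<lambda>x. norm (\<chi> i. partial i f x) powr p) \<in> borel_measurable lebesgue" using m by simp
    show "\<bar>norm (\<chi> i. partial i f x) powr p\<bar> \<le> (\<Sum>i\<in>UNIV. B i) powr p" for x
      using nB p by (simp add: powr_mono2)
    have "{x. norm (\<chi> i. partial i f x) powr p \<noteq> 0} \<subseteq> (\<Union>i. {x. partial i f x \<noteq> 0})"
      by (auto simp: vec_eq_iff)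
    moreover have "bounded (\<Union>i. {x. partial i f x \<noteq> 0})"
      using test_function_bounded_support[OF pt] by (intro bounded_UN) auto
    ultimately show "bounded {x. norm (\<chi> i. partial i f x) powr p \<noteq> 0}" by (rule bounded_subset[rotated])
  qed
qed

text \<open>\<open>D1\<close> asks for one function in \<open>L_p\<close> per coordinate, whereas
  the estimates use the Euclidean length of a vector field. Equivalence of norms on a
  finite-dimensional space matches the two conditions.\<close>

lemma D1_iff:
  fixes u :: "real^'n \<Rightarrow> real"
  assumes p: "0 < p"
  shows "u \<in> D1 p \<longleftrightarrow> (\<exists>G. has_weak_gradient p u G) \<and> hoelder_continuous (1 - real CARD('n) / p) u"
proof
  assume u: "u \<in> D1 p"
  then have "\<forall>i. \<exists>g. g \<in> L_p p \<and> has_weak_partial i u g" by (auto simp: D1_def)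
  then obtain g where g: "\<And>i. g i \<in> L_p p" "\<And>i. has_weak_partial i u (g i)" by metis
  have "integrable lebesgue (\<lambda>x. norm (\<chi> i. g i x) powr p)"
  proof (rule Bochner_Integration.integrable_bound)
    show "integrable lebesgue (\<lambda>x. real CARD('n) powr p * (\<Sum>i\<in>UNIV. \<bar>g i x\<bar> powr p))"
      using g(1) by (intro integrable_mult_right Bochner_Integration.integrable_sum) (auto simp: L_p_def)
    show "(\<lambda>x. norm (\<chi> i. g i x) powr p) \<in> borel_measurable lebesgue"
    proof -
      have "(\<lambda>x. \<chi> i. g i x) \<in> borel_measurable lebesgue" using g(1) by (simp add: L_p_def borel_measurable_vec_iff)
      then show ?thesis by simp
    qed
    show "AE x in lebesgue. norm (norm (\<chi> i. g i x) powr p) \<le> norm (real CARD('n) powr p * (\<Sum>i\<in>UNIV. \<bar>g i x\<bar> powr p))"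
    proof (intro always_eventually allI)
      fix x
      \<comment> \<open>\<open>j\<close> is the index of a largest component at \<open>x\<close>.
        The norm is then at most \<open>CARD('n)\<close> times that component, whose power is one of
        the summands of the majorant.\<close>
      obtain j where j: "\<And>i. \<bar>g i x\<bar> \<le> \<bar>g j x\<bar>"
      proof -
        have "Max (range (\<lambda>i. \<bar>g i x\<bar>)) \<in> range (\<lambda>i. \<bar>g i x\<bar>)" by (intro Max_in) auto
        then obtain j where "Max (range (\<lambda>i. \<bar>g i x\<bar>)) = \<bar>g j x\<bar>" by (rule rangeE)
        then show ?thesis using Max_ge[of "range (\<lambda>i. \<bar>g i x\<bar>)"] by (intro that[of j]) auto
      qed
      have "norm (\<chi> i. g i x) \<le> (\<Sum>i\<in>(UNIV::'n set). \<bar>g j x\<bar>)"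
        using j by (intro order_trans[OF norm_le_l1_cart sum_mono]) simp
      then have "norm (\<chi> i. g i x) powr p \<le> (real CARD('n) * \<bar>g j x\<bar>) powr p"
        using p by (intro powr_mono2) auto
      also have "\<dots> = real CARD('n) powr p * \<bar>g j x\<bar> powr p" by (simp add: powr_mult)
      also have "\<dots> \<le> real CARD('n) powr p * (\<Sum>i\<in>UNIV. \<bar>g i x\<bar> powr p)"
        by (intro mult_left_mono member_le_sum) auto
      finally show "norm (norm (\<chi> i. g i x) powr p) \<le> norm (real CARD('n) powr p * (\<Sum>i\<in>UNIV. \<bar>g i x\<bar> powr p))"
        by (simp add: abs_mult sum_nonneg)
    qed
  qed
  then have "has_weak_gradient p u (\<lambda>x. \<chi> i. g i x)"
    using u g by (auto simp: has_weak_gradient_def D1_def borel_measurable_vec_iff L_p_def)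
  then show "(\<exists>G. has_weak_gradient p u G) \<and> hoelder_continuous (1 - real CARD('n) / p) u"
    using u by (auto simp: D1_def)
next
  assume "(\<exists>G. has_weak_gradient p u G) \<and> hoelder_continuous (1 - real CARD('n) / p) u"
  then obtain G where G: "has_weak_gradient p u G" and h: "hoelder_continuous (1 - real CARD('n) / p) u" by blast
  have "(\<lambda>x. G x $ i) \<in> L_p p" for i
  proof -
    have m: "(\<lambda>x. G x $ i) \<in> borel_measurable lebesgue" using G by (simp add: has_weak_gradient_def borel_measurable_vec_iff)
    have "integrable lebesgue (\<lambda>x. \<bar>G x $ i\<bar> powr p)"
    proof (rule Bochner_Integration.integrable_bound)
      show "integrable lebesgue (\<lambda>x. norm (G x) powr p)" using G by (simp add: has_weak_gradient_def)
      show "AE x in lebesgue. norm (\<bar>G x $ i\<bar> powr p) \<le> norm (norm (G x) powr p)"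
        using p by (auto intro!: powr_mono2 component_le_norm_cart)
    qed (use m in simp)
    then show ?thesis using m by (simp add: L_p_def)
  qed
  then show "u \<in> D1 p" using G h by (auto simp: D1_def has_weak_gradient_def)
qed


section \<open>Similarities acting on functions and their weak gradients\<close>

lemma orthogonal_transformation_inverse:
  fixes O' :: "real^'n \<Rightarrow> real^'n"
  assumes O: "orthogonal_transformation O'"
  shows "O' (inv O' x) = x" "inv O' (O' x) = x" "orthogonal_transformation (inv O')"
  using orthogonal_transformation_bij[OF O] orthogonal_transformation_inv[OF O]
  by (simp_all add: bij_def surj_f_inv_f)

lemma continuous_on_similarity:
  fixes O' :: "real^'n \<Rightarrow> real^'n"
  assumes "orthogonal_transformation O'"
  shows "continuous_on A (\<lambda>x. l *\<^sub>R O' x + z)"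
  using orthogonal_transformation_linear[OF assms]
  by (intro continuous_intros linear_continuous_on linear_conv_bounded_linear[THEN iffD1])

lemma L1_loc_similarity:
  fixes f :: "real^'n \<Rightarrow> real" and O' :: "real^'n \<Rightarrow> real^'n"
  assumes l: "l > 0" and O: "orthogonal_transformation O'" and f: "f \<in> L1_loc"
  shows "(\<lambda>x. f (l *\<^sub>R O' x + z)) \<in> L1_loc"
  unfolding L1_loc_def set_integrable_def
proof clarify
  fix K :: "(real^'n) set" assume K: "compact K"
  define S where "S x = l *\<^sub>R O' x + z" for x
  define T where "T y = inv O' ((y - z) /\<^sub>R l)" for y
  have TS: "T (S x) = x" for x using l orthogonal_transformation_inverse[OF O] by (simp add: S_def T_def)
  have SK: "compact (S ` K)" unfolding S_def using K O by (intro compact_continuous_image continuous_on_similarity)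
  then have "integrable lebesgue (\<lambda>y. indicator (S ` K) y *\<^sub>R f y)"
    using f by (auto simp: L1_loc_def set_integrable_def)
  from integrable_similarity[OF l O this, of z]
  have "integrable lebesgue (\<lambda>x. indicator (S ` K) (S x) *\<^sub>R f (S x))" unfolding S_def .
  moreover have "indicator (S ` K) (S x) = (indicator K x :: real)" for x
    using TS by (auto simp: indicator_def) (metis TS)
  ultimately show "integrable lebesgue (\<lambda>x. indicator K x *\<^sub>R f (l *\<^sub>R O' x + z))" by (simp add: S_def)
qed

text \<open>The chain rule, where the transpose of \<open>O'\<close> appears as its inverse. In the
  weak formulation the test function is carried along by the inverse similarity; the Jacobian factor
  then occurs on both sides and drops out.\<close>

lemma
  fixes u :: "real^'n \<Rightarrow> real" and z :: "real^'n" and O' :: "real^'n \<Rightarrow> real^'n"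
  assumes l: "l > 0" and O: "orthogonal_transformation O'" and u: "has_weak_gradient p u G" and p: "0 < p"
  defines "H \<equiv> \<lambda>x. l *\<^sub>R inv O' (G (l *\<^sub>R O' x + z))"
  shows has_weak_gradient_similarity: "has_weak_gradient p (\<lambda>x. u (l *\<^sub>R O' x + z)) H"
    and energy_similarity: "energy p H = l powr p * energy p G / l ^ CARD('n)"
proof -
  define S where "S x = l *\<^sub>R O' x + z" for x
  define T where "T y = (1 / l) *\<^sub>R inv O' y + (1 / l) *\<^sub>R inv O' (- z)" for y
  note inv = orthogonal_transformation_inverse[OF O]
  have linT: "linear (inv O')" and linO: "linear O'" using inv(3) O orthogonal_transformation_linear by blast+
  have TS: "T (S x) = x" and ST: "S (T x) = x" for x
    using l inv by (simp_all add: S_def T_def linear_add[OF linT] linear_scale[OF linT] linear_neg[OF linT]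
      linear_diff[OF linO] linear_scale[OF linO] scaleR_add_right scaleR_diff_right)
  have nH: "norm (H x) powr p = l powr p * norm (G (S x)) powr p" for x
    using l orthogonal_transformation_norm[OF inv(3)] by (simp add: H_def S_def powr_mult)
  have uG: "u \<in> L1_loc" "\<And>i. has_weak_partial i u (\<lambda>x. G x $ i)" "G \<in> borel_measurable lebesgue"
    "integrable lebesgue (\<lambda>x. norm (G x) powr p)" using u by (auto simp: has_weak_gradient_def)
  note sim = integrable_similarity[OF l O, of _ z, folded S_def] integral_similarity[OF l O, of _ z, folded S_def]
  show "energy p H = l powr p * energy p G / l ^ CARD('n)"
    unfolding energy_def nH using sim(2)[OF uG(4)] by (simp add: divide_inverse mult.assoc)
  \<comment> \<open>Orthogonality moves \<open>inv O'\<close> across the inner product. The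
    resulting coefficients are those that the chain rule produces for
    \<open>partial i \<phi>\<close> below, which is why the two sums match term by term.\<close>
  have Hi: "H x $ i = (\<Sum>j\<in>UNIV. l * O' (axis i 1) $ j * G (S x) $ j)" for x i
  proof -
    have "H x $ i = l * (axis i 1 \<bullet> inv O' (G (S x)))" by (simp add: H_def S_def inner_axis')
    also have "axis i 1 \<bullet> inv O' (G (S x)) = O' (axis i 1) \<bullet> O' (inv O' (G (S x)))"
      using O by (simp add: orthogonal_transformation_def)
    finally show ?thesis by (simp add: inv inner_vec_def sum_distrib_left mult.assoc)
  qed
  have GL: "(\<lambda>x. G x $ j) \<in> L1_loc" for j using uG(2)[of j] by (simp add: has_weak_partial_def)
  have GSL: "(\<lambda>x. G (S x) $ j) \<in> L1_loc" for j
    using L1_loc_similarity[OF l O GL] unfolding S_def .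
  show "has_weak_gradient p (\<lambda>x. u (l *\<^sub>R O' x + z)) H"
    unfolding has_weak_gradient_def S_def[symmetric]
  proof (intro conjI allI)
    show "(\<lambda>x. u (S x)) \<in> L1_loc" unfolding S_def using l O uG(1) by (rule L1_loc_similarity)
    have "(\<lambda>x. G (S x)) \<in> borel_measurable lebesgue"
      using measurable_compose[OF measurable_lebesgue_similarity[OF l O] uG(3)] unfolding S_def .
    then have "(\<lambda>x. G (S x) $ j) \<in> borel_measurable lebesgue" for j by (simp add: borel_measurable_vec_iff)
    then show "H \<in> borel_measurable lebesgue" unfolding borel_measurable_vec_iff Hi by simp
    show "integrable lebesgue (\<lambda>x. norm (H x) powr p)"
      unfolding nH using sim(1)[OF uG(4)] by (intro integrable_mult_right)
    fix i
    show "has_weak_partial i (\<lambda>x. u (S x)) (\<lambda>x. H x $ i)"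
      unfolding has_weak_partial_def
    proof (intro conjI allI impI)
      have "(\<lambda>x. \<Sum>j\<in>J. l * O' (axis i 1) $ j * G (S x) $ j) \<in> L1_loc" if "finite J" for J
        using that
      proof induction
        case empty show ?case using continuous_imp_L1_loc[of "\<lambda>x. 0"] by simp
      next
        case (insert j J)
        then show ?case using L1_loc_lincomb[where a="l * O' (axis i 1) $ j" and b=1, OF GSL[of j] insert.IH] by simp
      qed
      then show "(\<lambda>x. H x $ i) \<in> L1_loc" unfolding Hi by simp
      fix \<phi> :: "real^'n \<Rightarrow> real" assume t: "test_function \<phi>"
      define \<psi> where "\<psi> y = \<phi> (T y)" for y
      have \<phi>: "\<phi> x = \<psi> (S x)" for x by (simp add: \<psi>_def TS)
      have t\<psi>: "test_function \<psi>"
      proof (rule test_functionI)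
        have "linear (\<lambda>y. (1 / l) *\<^sub>R inv O' y)" using linT by (intro linear_compose_scale_right)
        then show "C_k k \<psi>" for k
          unfolding \<psi>_def[abs_def] T_def using t by (intro C_k_affine) (simp_all add: test_function_def)
        have "{y. \<psi> y \<noteq> 0} \<subseteq> S ` {x. \<phi> x \<noteq> 0}"
          using ST by (auto simp: \<psi>_def image_iff) metis
        moreover have "bounded (S ` closure {x. \<phi> x \<noteq> 0})"
          unfolding S_def using t O by (intro compact_imp_bounded compact_continuous_image continuous_on_similarity) (auto simp: test_function_def)
        ultimately show "bounded {y. \<psi> y \<noteq> 0}"
          using closure_subset[of "{x. \<phi> x \<noteq> 0}"] by (meson bounded_subset image_mono)
      qed
      note t\<psi>' = test_function_partial[OF t\<psi>]
      have pd: "partial i \<phi> x = (\<Sum>j\<in>UNIV. l * O' (axis i 1) $ j * partial j \<psi> (S x))" for x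
      proof -
        have "linear (\<lambda>y. l *\<^sub>R O' y)" using linO by (intro linear_compose_scale_right)
        from has_derivative_affine_comp[OF this, of \<psi> x z] test_function_differentiable[OF t\<psi>]
        have "((\<lambda>x. \<psi> (S x)) has_derivative (\<lambda>h. \<Sum>j\<in>UNIV. l * O' h $ j * partial j \<psi> (S x))) (at x)"
          unfolding S_def by simp
        then show ?thesis using partial_eq by (simp add: \<phi>[abs_def])
      qed
      have "(LINT x|lebesgue. u (S x) * partial i \<phi> x)
          = (LINT x|lebesgue. (\<Sum>j\<in>UNIV. l * O' (axis i 1) $ j * (u (S x) * partial j \<psi> (S x))))"
        unfolding pd by (simp add: sum_distrib_left mult_ac)
      also have "\<dots> = (\<Sum>j\<in>UNIV. l * O' (axis i 1) $ j * (LINT x|lebesgue. u (S x) * partial j \<psi> (S x)))"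
        using sim(1)[OF L1_loc_mult_test[OF uG(1) t\<psi>']] by (subst Bochner_Integration.integral_sum) simp_all
      also have "\<dots> = (\<Sum>j\<in>UNIV. l * O' (axis i 1) $ j * - (LINT x|lebesgue. G (S x) $ j * \<psi> (S x)))"
      proof (intro sum.cong refl arg_cong2[where f="(*)"])
        fix j
        have "(LINT x|lebesgue. u x * partial j \<psi> x) = - (LINT x|lebesgue. G x $ j * \<psi> x)"
          using uG(2)[of j] t\<psi> by (simp add: has_weak_partial_def)
        then show "(LINT x|lebesgue. u (S x) * partial j \<psi> (S x)) = - (LINT x|lebesgue. G (S x) $ j * \<psi> (S x))"
          using sim(2)[OF L1_loc_mult_test[OF uG(1) t\<psi>']] sim(2)[OF L1_loc_mult_test[OF GL t\<psi>]] by simp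
      qed
      also have "\<dots> = - (LINT x|lebesgue. (\<Sum>j\<in>UNIV. l * O' (axis i 1) $ j * (G (S x) $ j * \<psi> (S x))))"
        using sim(1)[OF L1_loc_mult_test[OF GL t\<psi>]] by (subst Bochner_Integration.integral_sum) (simp_all add: sum_negf)
      also have "\<dots> = - (LINT x|lebesgue. H x $ i * \<phi> x)"
        unfolding Hi \<phi> sum_distrib_right by (simp only: mult_ac)
      finally show "(LINT x|lebesgue. u (S x) * partial i \<phi> x) = - (LINT x|lebesgue. H x $ i * \<phi> x)" .
    qed
  qed
qed

lemma hoelder_continuous_similarity:
  fixes u :: "real^'n \<Rightarrow> real" and O' :: "real^'n \<Rightarrow> real^'n"
  assumes O: "orthogonal_transformation O'" and l: "l > 0" and u: "hoelder_continuous a u"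
  shows "hoelder_continuous a (\<lambda>x. u (l *\<^sub>R O' x + z))"
proof -
  obtain C where C: "\<And>x y. dist (u x) (u y) \<le> C * dist x y powr a" using u by (auto simp: hoelder_continuous_def)
  have "dist (l *\<^sub>R O' x + z) (l *\<^sub>R O' y + z) = l * dist x y" for x y
    using l orthogonal_transformation_norm[OF O, of "x - y"] linear_diff[OF orthogonal_transformation_linear[OF O], of x y]
    by (simp add: dist_norm scaleR_diff_right[symmetric])
  then have "dist (u (l *\<^sub>R O' x + z)) (u (l *\<^sub>R O' y + z)) \<le> C * l powr a * dist x y powr a" for x y
    using C[of "l *\<^sub>R O' x + z" "l *\<^sub>R O' y + z"] l by (simp add: powr_mult mult.assoc)
  then show ?thesis unfolding hoelder_continuous_def by blast
qed

lemma
  fixes u :: "real^'n \<Rightarrow> real" and O' :: "real^'n \<Rightarrow> real^'n"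
  assumes l: "l > 0" and O: "orthogonal_transformation O'" and u: "u \<in> D1 p" and p: "0 < p"
  shows D1_similarity: "(\<lambda>x. u (l *\<^sub>R O' x + z)) \<in> D1 p"
    and grad_norm_similarity: "grad_norm p (\<lambda>x. u (l *\<^sub>R O' x + z)) = l powr (1 - real CARD('n) / p) * grad_norm p u"
proof -
  obtain G where G: "has_weak_gradient p u G" using u D1_iff[OF p] by blast
  note s = has_weak_gradient_similarity[OF l O G p, of z] energy_similarity[OF l O G p, of z]
  show "(\<lambda>x. u (l *\<^sub>R O' x + z)) \<in> D1 p"
    using s(1) u hoelder_continuous_similarity[OF O l] by (auto simp: D1_iff[OF p])
  have "(l powr p * energy p G / l ^ CARD('n)) powr (1 / p) = l powr (1 - real CARD('n) / p) * energy p G powr (1 / p)"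
  proof -
    have "l powr p * energy p G / l ^ CARD('n) = l powr (p - real CARD('n)) * energy p G"
      using l by (simp add: powr_diff powr_realpow)
    then show ?thesis using l p energy_nonneg[of p G] by (simp add: powr_mult powr_powr diff_divide_distrib)
  qed
  then show "grad_norm p (\<lambda>x. u (l *\<^sub>R O' x + z)) = l powr (1 - real CARD('n) / p) * grad_norm p u"
    using grad_norm_eq[OF s(1)] grad_norm_eq[OF G] s(2) by simp
qed


section \<open>Linear structure of \<open>D1\<close> and homogeneity of the gradient norm\<close>

lemma hoelder_continuous_lincomb:
  fixes u v :: "'a::metric_space \<Rightarrow> real"
  assumes "hoelder_continuous \<alpha> u" "hoelder_continuous \<alpha> v"
  shows "hoelder_continuous \<alpha> (\<lambda>x. a * u x + b * v x)"
proof -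
  obtain C D where C: "\<And>x y. \<bar>u x - u y\<bar> \<le> C * dist x y powr \<alpha>" and D: "\<And>x y. \<bar>v x - v y\<bar> \<le> D * dist x y powr \<alpha>"
    using assms unfolding hoelder_continuous_def dist_real_def by blast
  have "\<bar>(a * u x + b * v x) - (a * u y + b * v y)\<bar> \<le> (\<bar>a\<bar> * C + \<bar>b\<bar> * D) * dist x y powr \<alpha>" for x y
  proof -
    have "(a * u x + b * v x) - (a * u y + b * v y) = a * (u x - u y) + b * (v x - v y)" by (simp add: algebra_simps)
    also have "\<bar>\<dots>\<bar> \<le> \<bar>a\<bar> * \<bar>u x - u y\<bar> + \<bar>b\<bar> * \<bar>v x - v y\<bar>"
      by (metis abs_mult abs_triangle_ineq)
    also have "\<dots> \<le> \<bar>a\<bar> * (C * dist x y powr \<alpha>) + \<bar>b\<bar> * (D * dist x y powr \<alpha>)"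
      using C D by (intro add_mono mult_left_mono) auto
    finally show ?thesis by (simp add: algebra_simps)
  qed
  then show ?thesis unfolding hoelder_continuous_def dist_real_def by blast
qed

lemma D1_lincomb: "0 < p \<Longrightarrow> u \<in> D1 p \<Longrightarrow> v \<in> D1 p \<Longrightarrow> (\<lambda>x. a * u x + b * v x) \<in> D1 p"
  using has_weak_gradient_lincomb[of p] hoelder_continuous_lincomb by (auto simp: D1_iff) blast

lemma D1_const: "0 < p \<Longrightarrow> (\<lambda>x. c) \<in> D1 p"
  unfolding D1_iff hoelder_continuous_def using has_weak_gradient_const[of p c] by (auto intro: exI[of _ 0])

lemma D1_scale: "0 < p \<Longrightarrow> u \<in> D1 p \<Longrightarrow> (\<lambda>x. a * u x) \<in> D1 p"
  using D1_lincomb[of p u "\<lambda>x. 0" a 0] D1_const[of p 0] by simp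

lemma has_weak_gradient_scale:
  "0 \<le> p \<Longrightarrow> has_weak_gradient p u G \<Longrightarrow> has_weak_gradient p (\<lambda>x. a * u x) (\<lambda>x. a *\<^sub>R G x)"
  using has_weak_gradient_lincomb[of p u G "\<lambda>x. 0" "\<lambda>x. 0" a 0] has_weak_gradient_const[of p 0] by simp

lemma energy_scale: "energy p (\<lambda>x. a *\<^sub>R G x) = \<bar>a\<bar> powr p * energy p G"
  unfolding energy_def by (simp add: powr_mult)

lemma grad_norm_scale:
  assumes p: "0 < p" and u: "u \<in> D1 p"
  shows "grad_norm p (\<lambda>x. a * u x) = \<bar>a\<bar> * grad_norm p u"
proof -
  obtain G where G: "has_weak_gradient p u G" using u D1_iff[OF p] by blast
  show ?thesis
    using grad_norm_eq[OF G] grad_norm_eq[OF has_weak_gradient_scale[OF less_imp_le[OF p] G, of a]] p energy_nonneg[of p G]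
    by (simp add: energy_scale powr_mult powr_powr)
qed

lemma grad_norm_nonneg: "0 \<le> grad_norm p u"
  unfolding grad_norm_def by simp

lemma grad_norm_add_const:
  assumes p: "0 < p" and u: "u \<in> D1 p"
  shows "grad_norm p (\<lambda>x. u x + c) = grad_norm p u" "(\<lambda>x. u x + c) \<in> D1 p"
proof -
  obtain G where G: "has_weak_gradient p u G" using u D1_iff[OF p] by blast
  show "grad_norm p (\<lambda>x. u x + c) = grad_norm p u"
    using has_weak_gradient_lincomb[OF less_imp_le[OF p] G has_weak_gradient_const[of p c], of 1 1] grad_norm_eq[OF G]
    by (simp add: grad_norm_eq)
  show "(\<lambda>x. u x + c) \<in> D1 p" using D1_lincomb[OF p u D1_const[OF p, of c], of 1 1] by simp
qed

lemma energy_eq_grad_norm_powr: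
  assumes "0 < p" "has_weak_gradient p u G"
  shows "energy p G = grad_norm p u powr p"
  using grad_norm_eq[OF assms(2)] assms(1) energy_nonneg[of p G] by (simp add: powr_powr)

section \<open>Morrey's inequality\<close>

lemma partial_prod_components:
  fixes i :: "'n::finite"
  assumes "finite J" "i \<notin> J" "\<And>k. smooth_k k b"
  shows "partial i (\<lambda>x. \<Prod>j\<in>J. b (x $ j)) x = 0"
  using assms(1,2)
proof (induction J)
  case empty show ?case by (simp add: partial_eq[OF has_derivative_const])
next
  case (insert j J)
  have C1: "C_k (Suc 0) (\<lambda>x::real^'n. b (x $ j))" "C_k (Suc 0) (\<lambda>x::real^'n. \<Prod>j\<in>J. b (x $ j))"
    by (intro C_k_component assms(3), intro C_k_prod C_k_component assms(3))
  obtain b' where b': "\<And>t. (b has_real_derivative b' t) (at t)" using assms(3)[of 1] by auto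
  have "partial i (\<lambda>x. b (x $ j) * (\<Prod>j\<in>J. b (x $ j))) x = 0"
    using C1 insert by (subst partial_mult) (auto simp: partial_component_comp[OF b'])
  then show ?case using insert by simp
qed

text \<open>On every line in direction \<open>e\<close> the bump and its unit translate have the
  same integral, so the primitive of their difference along that line has compact support. Only the
  factor in coordinate \<open>i\<close> needs integrating, because \<open>\<omega>\<close> is a
  product.\<close>

lemma bump_difference_primitive:
  fixes i :: "'n::finite" and r :: real
  defines "e \<equiv> axis i (1::real)" and "\<omega> \<equiv> box_bump (\<chi> j. - r) (\<chi> j. r) 1"
  assumes r: "0 < r"
  obtains \<phi> where "test_function \<phi>" "\<And>x. partial i \<phi> x = \<omega> x - \<omega> (x - e)"
proof -
  define b where "b = bump (- r) r 1"
  have sb: "smooth_k k b" for k unfolding b_def by (rule smooth_k_bump)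
  have b0: "b t = 0" if "t \<le> - r \<or> r \<le> t" for t using that by (auto simp: b_def bump_eq)
  obtain F where F: "\<And>t. (F has_real_derivative b t) (at t)"
  proof -
    have "\<exists>F. \<forall>x::real. - \<infinity> < ereal x \<longrightarrow> ereal x < \<infinity> \<longrightarrow> (F has_vector_derivative b x) (at x)"
      using sb[of 0] by (intro einterval_antiderivative) (auto simp: continuous_on_eq_continuous_at)
    then show ?thesis using that by (auto simp: has_real_derivative_iff_has_vector_derivative)
  qed
  define \<psi> where "\<psi> t = F t + (- 1) * F (1 * t + - 1)" for t
  have sF: "smooth_k k F" for k
  proof -
    have "smooth_k (Suc k) F" using F sb by auto
    then show ?thesis by (rule smooth_k_Suc_D)
  qed
  have s\<psi>: "smooth_k k \<psi>" for k
    unfolding \<psi>_def[abs_def] by (intro smooth_k_add smooth_k_mult smooth_k_const sF smooth_k_affine)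
  have d\<psi>: "(\<psi> has_real_derivative b t - b (t - 1)) (at t)" for t
    unfolding \<psi>_def[abs_def] by (auto intro!: derivative_eq_intros F DERIV_chain2[OF F])
  \<comment> \<open>The mean value point lies between \<open>t - 1\<close> and \<open>t\<close>,
    hence outside the interval from \<open>- r\<close> to \<open>r\<close> that carries
    \<open>b\<close>.\<close>
  have \<psi>0: "\<psi> t = 0" if t: "t \<le> - r \<or> 1 + r \<le> t" for t
  proof -
    obtain z where "t - 1 < z" "z < t" "F t - F (t - 1) = (t - (t - 1)) * b z"
      using MVT2[of "t - 1" t F b] F by auto
    then show ?thesis using t b0[of z] by (auto simp: \<psi>_def)
  qed
  define \<pi> where "\<pi> x = (\<Prod>j\<in>UNIV - {i}. b (x $ j))" for x :: "real^'n"
  define \<phi> where "\<phi> x = \<psi> (x $ i) * \<pi> x" for x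
  have C: "C_k k (\<lambda>x. \<psi> (x $ i))" "C_k k \<pi>" for k
    unfolding \<pi>_def by (intro C_k_component s\<psi>, intro C_k_prod C_k_component sb)
  have "test_function \<phi>"
  proof (rule test_functionI)
    show "C_k k \<phi>" for k unfolding \<phi>_def[abs_def] using C by (intro C_k_mult)
    have "x \<in> cbox (\<chi> j. - r) (\<chi> j. 1 + r)" if "\<phi> x \<noteq> 0" for x
    proof -
      have "\<psi> (x $ i) \<noteq> 0" "\<And>j. j \<noteq> i \<Longrightarrow> b (x $ j) \<noteq> 0"
        using that by (auto simp: \<phi>_def \<pi>_def)
      then have "- r \<le> x $ j \<and> x $ j \<le> 1 + r" for j
        using \<psi>0[of "x $ j"] b0[of "x $ j"] r by (cases "j = i") (force, metis le_add_same_cancel2 linorder_linear order_trans zero_le_one)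
      then show ?thesis by (simp add: mem_box_cart)
    qed
    then show "bounded {x. \<phi> x \<noteq> 0}" by (intro bounded_subset[OF bounded_cbox]) auto
  qed
  moreover have "partial i \<phi> x = \<omega> x - \<omega> (x - e)" for x
  proof -
    have "partial i \<phi> x = \<psi> (x $ i) * partial i \<pi> x + partial i (\<lambda>x. \<psi> (x $ i)) x * \<pi> x"
      unfolding \<phi>_def[abs_def] using C[of "Suc 0"] by (intro partial_mult) auto
    also have "partial i \<pi> x = 0"
      unfolding \<pi>_def[abs_def] using sb by (intro partial_prod_components) auto
    also have "partial i (\<lambda>x. \<psi> (x $ i)) x = b (x $ i) - b (x $ i - 1)"
      by (simp add: partial_component_comp[OF d\<psi>])
    finally have *: "partial i \<phi> x = b (x $ i) * \<pi> x - b (x $ i - 1) * \<pi> x" by (simp add: left_diff_distrib)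
    have \<omega>: "\<omega> y = b (y $ i) * \<pi> y" for y
      unfolding \<omega>_def box_bump_def \<pi>_def b_def by (subst prod.remove[of _ i]) auto
    have "\<pi> (x - e) = \<pi> x" unfolding \<pi>_def e_def by (intro prod.cong) (auto simp: axis_def)
    then show ?thesis unfolding * \<omega> by (simp add: e_def axis_def)
  qed
  ultimately show ?thesis by (rule that)
qed

text \<open>Plays the part of Hoelder's inequality: for functions of energy at most 1 it bounds the
  integral of the gradient over a bounded set by the volume plus 1.\<close>

lemma abs_le_1_powr: "1 \<le> p \<Longrightarrow> \<bar>t::real\<bar> \<le> 1 + \<bar>t\<bar> powr p"
proof (cases "\<bar>t\<bar> \<le> 1")
  case False
  assume "1 \<le> p"
  then have "\<bar>t\<bar> powr 1 \<le> \<bar>t\<bar> powr p" using False by (intro powr_mono) auto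
  then show ?thesis using False by simp
qed (simp add: add_increasing2)

text \<open>Comparing \<open>u\<close> with its averages near \<open>0\<close> and \<open>e\<close> costs a small multiple of the Hoelder
  constant; the difference of the averages is the pairing of \<open>u\<close> with a partial derivative.\<close>

lemma unit_step_bound:
  fixes i :: "'n::finite" and p :: real
  defines "\<alpha> \<equiv> 1 - real CARD('n) / p"
  assumes p: "real CARD('n) < p"
  obtains C where "0 \<le> C"
    "\<And>u H. u \<in> D1 p \<Longrightarrow> grad_norm p u \<le> 1 \<Longrightarrow> (\<And>x y. \<bar>u x - u y\<bar> \<le> H * norm (x - y) powr \<alpha>)
       \<Longrightarrow> \<bar>u 0 - u (axis i 1)\<bar> \<le> H / 2 + C"
proof -
  have n1: "1 \<le> real CARD('n)" by (simp add: Suc_leI)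
  have p1: "1 \<le> p" "0 < p" using p n1 by linarith+
  have \<alpha>: "0 < \<alpha>" using p p1 by (simp add: \<alpha>_def)
  define e :: "real^'n" where "e = axis i 1"
  \<comment> \<open>Chosen so that \<open>d powr \<alpha> = 1 / 4\<close>. Replacing a point value
    by an average over distances up to \<open>d\<close> costs \<open>H / 4\<close>; two points cost
    \<open>H / 2\<close>, a fraction below 1, which makes the later iteration contract.\<close>
  define d where "d = (1 / 4 :: real) powr (1 / \<alpha>)"
  have d: "0 < d" "d powr \<alpha> = 1 / 4" using \<alpha> by (simp_all add: d_def powr_powr)
  \<comment> \<open>The bump lives on a cube, and the norm is bounded by the sum of the absolute
    values of the coordinates; hence the division by the dimension.\<close>
  define r where "r = d / real CARD('n)"
  have r: "0 < r" using d by (simp add: r_def)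
  define \<omega> where "\<omega> = box_bump ((\<chi> j. - r) :: real^'n) (\<chi> j. r) 1"
  obtain \<phi> where t\<phi>: "test_function \<phi>" and \<phi>: "\<And>x. partial i \<phi> x = \<omega> x - \<omega> (x - e)"
    using bump_difference_primitive[OF r, of i] unfolding \<omega>_def e_def by blast
  have t\<omega>: "test_function \<omega>" unfolding \<omega>_def by (rule test_function_box_bump) simp
  have \<omega>0: "0 \<le> \<omega> x" for x unfolding \<omega>_def by (rule box_bump_bounds) simp
  have \<omega>s: "norm x \<le> d" if "\<omega> x \<noteq> 0" for x
  proof -
    have "x \<in> box (\<chi> j. - r) (\<chi> j. r)" using that box_bump_eq_0[of 1 x] unfolding \<omega>_def by auto
    then have "\<bar>x $ j\<bar> \<le> r" for j by (auto simp: mem_box_cart abs_le_iff less_imp_le minus_le_iff)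
    then have "(\<Sum>j\<in>UNIV. \<bar>x $ j\<bar>) \<le> (\<Sum>j\<in>(UNIV::'n set). r)" by (intro sum_mono)
    then show ?thesis using norm_le_l1_cart[of x] by (simp add: r_def)
  qed
  define c where "c = (LINT x|lebesgue. \<omega> x)"
  have i\<omega>: "integrable lebesgue \<omega>" using t\<omega> by (rule test_function_integrable)
  \<comment> \<open>A nonnegative function with integral zero vanishes almost everywhere, but the
    bump is positive on a nonempty open box.\<close>
  have "c \<noteq> 0"
  proof
    assume "c = 0"
    then have "AE x in lebesgue. \<omega> x = 0"
      using integral_nonneg_eq_0_iff_AE[OF i\<omega>] \<omega>0 by (simp add: c_def)
    then obtain N where "N \<in> null_sets lebesgue" "\<And>x. x \<notin> N \<Longrightarrow> \<omega> x = 0" by (auto elim: AE_E3)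
    then have "N \<in> null_sets lebesgue" "{x. \<omega> x \<noteq> 0} \<subseteq> N" by auto
    moreover have "box (\<chi> j. - r) (\<chi> j. r) \<subseteq> {x. \<omega> x \<noteq> 0}"
      by (auto simp: \<omega>_def box_bump_def mem_box_cart bump_eq)
    ultimately have "negligible (box (\<chi> j. - r) (\<chi> j. r) :: (real^'n) set)"
      unfolding negligible_iff_null_sets[symmetric] by (meson negligible_subset order_trans)
    moreover have "(0 :: real^'n) \<in> box (\<chi> j. - r) (\<chi> j. r)" using r by (simp add: mem_box_cart)
    ultimately show False using open_not_negligible[OF open_box] by blast
  qed
  moreover have "0 \<le> c" unfolding c_def using \<omega>0 by simp
  ultimately have c: "0 < c" by simp
  obtain B where B: "0 \<le> B" "\<And>x. \<bar>\<phi> x\<bar> \<le> B" using test_function_bounded[OF t\<phi>] by blast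
  obtain R where R: "\<And>x. \<phi> x \<noteq> 0 \<Longrightarrow> norm x \<le> R"
    using test_function_bounded_support[OF t\<phi>] unfolding bounded_iff by blast
  define V where "V = (LINT x|lebesgue. indicator (cball (0::real^'n) R) x :: real)"
  have V: "0 \<le> V" unfolding V_def by simp
  have ib: "integrable lebesgue (indicator (cball (0::real^'n) R) :: _ \<Rightarrow> real)"
    by (intro integrable_indicator_bounded) auto
  \<comment> \<open>\<open>B * (V + 1)\<close> bounds the pairing of the weak gradient with
    \<open>\<phi>\<close>, the summand 1 being the bound on the energy. Division by \<open>c\<close>
    accounts for the bump not being normalized.\<close>
  define C where "C = B * (V + 1) / c"
  have "\<bar>u 0 - u e\<bar> \<le> H / 2 + C"
    if u: "u \<in> D1 p" and N: "grad_norm p u \<le> 1" and H: "\<And>x y. \<bar>u x - u y\<bar> \<le> H * norm (x - y) powr \<alpha>" for u H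
  proof -
    obtain G where G: "has_weak_gradient p u G" using u D1_iff[OF p1(2)] by blast
    have E: "energy p G \<le> 1"
      using energy_eq_grad_norm_powr[OF p1(2) G] N grad_norm_nonneg[of p u] p1 by (simp add: powr_le1)
    have uL: "u \<in> L1_loc" using u by (simp add: D1_def)
    have H0: "0 \<le> H" using H[of 0 e] by (simp add: e_def)
    have avg: "integrable lebesgue (\<lambda>x. u x * \<omega> (x - z)) \<and> \<bar>(LINT x|lebesgue. u x * \<omega> (x - z)) - c * u z\<bar> \<le> c * (H / 4)" for z
    proof -
      have iz: "integrable lebesgue (\<lambda>x. \<omega> (x - z))" and cz: "(LINT x|lebesgue. \<omega> (x - z)) = c"
        using integrable_similarity[OF zero_less_one orthogonal_transformation_id i\<omega>, of "- z"]
          integral_similarity[OF zero_less_one orthogonal_transformation_id i\<omega>, of "- z"] by (simp_all add: c_def)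
      have tz: "test_function (\<lambda>x. \<omega> (x - z))"
      proof (rule test_functionI)
        show "C_k k (\<lambda>x. \<omega> (x - z))" for k
          using C_k_affine[OF linear_id, of k \<omega> "- z"] t\<omega> by (simp add: test_function_def)
        have "norm x \<le> d + norm z" if "\<omega> (x - z) \<noteq> 0" for x
          using \<omega>s[OF that] norm_triangle_sub[of x z] by linarith
        then show "bounded {x. \<omega> (x - z) \<noteq> 0}" by (auto simp: bounded_iff)
      qed
      have iu: "integrable lebesgue (\<lambda>x. u x * \<omega> (x - z))" using uL tz by (rule L1_loc_mult_test)
      have pt: "\<bar>(u x - u z) * \<omega> (x - z)\<bar> \<le> H / 4 * \<omega> (x - z)" for x
      proof (cases "\<omega> (x - z) = 0")
        case False
        have "norm (x - z) powr \<alpha> \<le> 1 / 4" using \<omega>s[OF False] \<alpha> d powr_mono2[of \<alpha> "norm (x - z)" d] by simp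
        then have "H * norm (x - z) powr \<alpha> \<le> H * (1 / 4)" using H0 by (intro mult_left_mono) auto
        then have "\<bar>u x - u z\<bar> \<le> H / 4" using H[of x z] by simp
        then have "\<bar>u x - u z\<bar> * \<omega> (x - z) \<le> H / 4 * \<omega> (x - z)" using \<omega>0 by (intro mult_right_mono)
        then show ?thesis using \<omega>0[of "x - z"] by (simp only: abs_mult abs_of_nonneg)
      qed simp
      have "(LINT x|lebesgue. u x * \<omega> (x - z)) - c * u z = (LINT x|lebesgue. (u x - u z) * \<omega> (x - z))"
        using iu iz by (simp add: left_diff_distrib cz)
      also have "\<bar>\<dots>\<bar> \<le> (LINT x|lebesgue. H / 4 * \<omega> (x - z))"
        using iu iz pt by (intro order_trans[OF integral_abs_bound] integral_mono)
          (auto simp: left_diff_distrib intro!: integrable_abs)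
      also have "\<dots> = c * (H / 4)" using cz by simp
      finally show ?thesis using iu by simp
    qed
    have "\<bar>LINT x|lebesgue. G x $ i * \<phi> x\<bar> \<le> B * (V + 1)"
    proof -
      have GL: "(\<lambda>x. G x $ i) \<in> L1_loc" and iG: "integrable lebesgue (\<lambda>x. norm (G x) powr p)"
        using G by (auto simp: has_weak_gradient_def has_weak_partial_def)
      have pt: "\<bar>G x $ i * \<phi> x\<bar> \<le> B * (indicator (cball 0 R) x + norm (G x) powr p)" for x
      proof (cases "\<phi> x = 0")
        case False
        have "\<bar>G x $ i\<bar> \<le> \<bar>norm (G x)\<bar>" using component_le_norm_cart[of "G x" i] by simp
        also have "\<dots> \<le> 1 + norm (G x) powr p" using abs_le_1_powr[OF p1(1), of "norm (G x)"] by simp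
        finally have "\<bar>G x $ i\<bar> * \<bar>\<phi> x\<bar> \<le> (1 + norm (G x) powr p) * B"
          using B(2)[of x] by (intro mult_mono) auto
        then show ?thesis using R[OF False] by (simp add: abs_mult mult.commute)
      qed (use B in simp)
      have "\<bar>LINT x|lebesgue. G x $ i * \<phi> x\<bar> \<le> (LINT x|lebesgue. B * (indicator (cball 0 R) x + norm (G x) powr p))"
        using L1_loc_mult_test[OF GL t\<phi>] ib iG pt
        by (intro order_trans[OF integral_abs_bound] integral_mono integrable_abs integrable_mult_right Bochner_Integration.integrable_add)
      also have "\<dots> = B * (V + energy p G)" using ib iG by (simp add: V_def energy_def)
      also have "\<dots> \<le> B * (V + 1)" using B E by (intro mult_left_mono) auto
      finally show ?thesis .
    qed
    moreover have "(LINT x|lebesgue. u x * partial i \<phi> x) = - (LINT x|lebesgue. G x $ i * \<phi> x)"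
      using G t\<phi> by (auto simp: has_weak_gradient_def has_weak_partial_def)
    moreover have "(LINT x|lebesgue. u x * partial i \<phi> x) = (LINT x|lebesgue. u x * \<omega> x) - (LINT x|lebesgue. u x * \<omega> (x - e))"
      using avg[of 0] avg[of e] by (simp add: \<phi> right_diff_distrib)
    ultimately have "\<bar>c * u 0 - c * u e\<bar> \<le> c * (H / 4) + c * (H / 4) + B * (V + 1)"
      using conjunct2[OF avg[of 0]] conjunct2[OF avg[of e]] by (simp only: diff_zero abs_le_iff) linarith
    moreover have "c * (H / 4) + c * (H / 4) + B * (V + 1) = c * (H / 2 + C)"
      using c by (simp add: C_def field_simps)
    moreover have "\<bar>c * u 0 - c * u e\<bar> = c * \<bar>u 0 - u e\<bar>"
      using c by (simp add: abs_mult right_diff_distrib[symmetric])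
    ultimately have "c * \<bar>u 0 - u e\<bar> \<le> c * (H / 2 + C)" by simp
    then show ?thesis using c by simp
  qed
  moreover have "0 \<le> C" unfolding C_def using B V c by simp
  ultimately show ?thesis using that unfolding e_def by blast
qed

text \<open>A similarity carries the pair \<open>0\<close>, \<open>e\<close> to any two distinct
  points, so \<open>unit_step_bound\<close> improves a global Hoelder constant \<open>H\<close> to
  \<open>H / 2 + C\<close>. Starting from whatever constant \<open>D1\<close> provides, iteration
  drives it to the fixed point \<open>2 * C\<close>.\<close>

lemma morrey_inequality:
  fixes p :: real
  defines "\<alpha> \<equiv> 1 - real CARD('n::finite) / p"
  assumes p: "real CARD('n) < p"
  obtains M where "0 \<le> M"
    "\<And>(u :: real^'n \<Rightarrow> real) x y. u \<in> D1 p \<Longrightarrow> \<bar>u x - u y\<bar> \<le> M * grad_norm p u * norm (x - y) powr \<alpha>"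
proof -
  have n1: "1 \<le> real CARD('n)" by (simp add: Suc_leI)
  have p1: "1 \<le> p" "0 < p" using p n1 by linarith+
  define i :: 'n where "i = undefined"
  define e :: "real^'n" where "e = axis i 1"
  obtain C where C0: "0 \<le> C" and C: "\<And>u H. u \<in> D1 p \<Longrightarrow> grad_norm p u \<le> 1 \<Longrightarrow>
     (\<And>x y. \<bar>u x - u y\<bar> \<le> H * norm (x - y) powr \<alpha>) \<Longrightarrow> \<bar>u 0 - u e\<bar> \<le> H / 2 + C"
    using unit_step_bound[OF p, of i] unfolding \<alpha>_def e_def by blast
  have step: "\<bar>u x - u y\<bar> \<le> (H / 2 + C) * norm (x - y) powr \<alpha>"
    if u: "u \<in> D1 p" "grad_norm p u \<le> 1" and H: "\<And>x y. \<bar>u x - u y\<bar> \<le> H * norm (x - y) powr \<alpha>"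
    for u :: "real^'n \<Rightarrow> real" and H x y
  proof (cases "x = y")
    case False
    define l where "l = norm (y - x)"
    have l: "0 < l" using False by (simp add: l_def)
    have "norm e = norm ((y - x) /\<^sub>R l)" using l by (simp add: e_def l_def)
    then obtain O' where O: "orthogonal_transformation O'" and Oe: "O' e = (y - x) /\<^sub>R l"
      by (rule orthogonal_transformation_exists)
    have lin: "linear O'" using O by (rule orthogonal_transformation_linear)
    \<comment> \<open>The prefactor compensates the effect of the similarity on the gradient norm
      and on the Hoelder constant at once, so \<open>v\<close> satisfies the same hypotheses as
      \<open>u\<close>.\<close>
    define v where "v w = l powr (- \<alpha>) * u (l *\<^sub>R O' w + x)" for w
    have D: "(\<lambda>w. u (l *\<^sub>R O' w + x)) \<in> D1 p" by (rule D1_similarity[OF l O u(1) p1(2)])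
    have v: "v \<in> D1 p" unfolding v_def[abs_def] by (rule D1_scale[OF p1(2) D])
    have "grad_norm p v = l powr (- \<alpha>) * (l powr \<alpha> * grad_norm p u)"
      unfolding v_def[abs_def] grad_norm_scale[OF p1(2) D] grad_norm_similarity[OF l O u(1) p1(2)] \<alpha>_def by simp
    then have Nv: "grad_norm p v \<le> 1" using u(2) l by (simp add: powr_minus mult.assoc[symmetric])
    have Hv: "\<bar>v a - v b\<bar> \<le> H * norm (a - b) powr \<alpha>" for a b
    proof -
      have "norm (l *\<^sub>R O' a + x - (l *\<^sub>R O' b + x)) = l * norm (a - b)"
        using l orthogonal_transformation_norm[OF O, of "a - b"] linear_diff[OF lin, of a b]
        by (simp add: scaleR_diff_right[symmetric])
      then have "\<bar>u (l *\<^sub>R O' a + x) - u (l *\<^sub>R O' b + x)\<bar> \<le> H * (l powr \<alpha> * norm (a - b) powr \<alpha>)"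
        using H[of "l *\<^sub>R O' a + x" "l *\<^sub>R O' b + x"] l by (simp add: powr_mult)
      then have "l powr (- \<alpha>) * \<bar>u (l *\<^sub>R O' a + x) - u (l *\<^sub>R O' b + x)\<bar> \<le> l powr (- \<alpha>) * (H * (l powr \<alpha> * norm (a - b) powr \<alpha>))"
        by (intro mult_left_mono) auto
      also have "\<dots> = H * norm (a - b) powr \<alpha>" using l by (simp add: powr_minus field_simps)
      finally show ?thesis by (simp add: v_def right_diff_distrib[symmetric] abs_mult)
    qed
    have "\<bar>v 0 - v e\<bar> \<le> H / 2 + C" using v Nv Hv by (rule C)
    moreover have "v 0 = l powr (- \<alpha>) * u x" "v e = l powr (- \<alpha>) * u y"
      using l by (simp_all add: v_def Oe linear_0[OF lin])
    ultimately have "l powr (- \<alpha>) * \<bar>u x - u y\<bar> \<le> H / 2 + C" by (simp add: right_diff_distrib[symmetric] abs_mult)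
    then have "\<bar>u x - u y\<bar> / l powr \<alpha> \<le> H / 2 + C" unfolding powr_minus divide_inverse[of _ "l powr _"] by (simp only: mult.commute)
    then have "\<bar>u x - u y\<bar> \<le> (H / 2 + C) * l powr \<alpha>" using l by (simp add: pos_divide_le_eq)
    then show ?thesis by (simp add: l_def norm_minus_commute)
  qed simp
  have unit: "\<bar>u x - u y\<bar> \<le> 2 * C * norm (x - y) powr \<alpha>" if u: "u \<in> D1 p" "grad_norm p u \<le> 1" for u :: "real^'n \<Rightarrow> real" and x y
  proof -
    obtain H where H: "\<And>x y. \<bar>u x - u y\<bar> \<le> H * norm (x - y) powr \<alpha>"
      using u(1) unfolding D1_def hoelder_continuous_def \<alpha>_def by (auto simp: dist_norm)
    have it: "\<bar>u x - u y\<bar> \<le> (2 * C + H * (1 / 2) ^ k) * norm (x - y) powr \<alpha>" for k x y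
    proof (induction k arbitrary: x y)
      case 0
      have "H * norm (x - y) powr \<alpha> \<le> (2 * C + H) * norm (x - y) powr \<alpha>" using C0 by (intro mult_right_mono) auto
      then show ?case using H[of x y] by simp
    next
      case (Suc k)
      have "(2 * C + H * (1 / 2) ^ k) / 2 + C = 2 * C + H * (1 / 2) ^ Suc k" by simp
      then show ?case using step[OF u Suc.IH, of x y] by (simp only:)
    qed
    have "(\<lambda>k. (2 * C + H * (1 / 2) ^ k) * norm (x - y) powr \<alpha>) \<longlonglongrightarrow> (2 * C + H * 0) * norm (x - y) powr \<alpha>"
      by (intro tendsto_mult tendsto_add tendsto_const LIMSEQ_realpow_zero) auto
    then show ?thesis using it[of x y] by (intro LIMSEQ_le_const[of _ _ "\<bar>u x - u y\<bar>"]) auto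
  qed
  have "\<bar>u x - u y\<bar> \<le> 2 * C * grad_norm p u * norm (x - y) powr \<alpha>" if u: "u \<in> D1 p" for u :: "real^'n \<Rightarrow> real" and x y
  proof -
    \<comment> \<open>Dividing by a number slightly above the gradient norm treats functions of
      gradient norm zero along with all others; the excess tends to 0 afterwards.\<close>
    have le: "\<bar>u x - u y\<bar> \<le> 2 * C * (grad_norm p u + inverse (real (Suc k))) * norm (x - y) powr \<alpha>" for k
    proof -
      define N where "N = grad_norm p u + inverse (real (Suc k))"
      have N: "0 < N" "grad_norm p u \<le> N" using grad_norm_nonneg[of p u] by (auto simp: N_def add_nonneg_pos)
      have "grad_norm p (\<lambda>x. (1 / N) * u x) \<le> 1"
        using grad_norm_scale[OF p1(2) u, of "1 / N"] N by simp
      from unit[OF D1_scale[OF p1(2) u] this, of x y] N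
      have "\<bar>u x - u y\<bar> / N \<le> 2 * C * norm (x - y) powr \<alpha>" by (simp add: diff_divide_distrib[symmetric])
      then have "\<bar>u x - u y\<bar> \<le> 2 * C * norm (x - y) powr \<alpha> * N" using N by (simp only: pos_divide_le_eq)
      then show ?thesis unfolding N_def[symmetric] by (simp only: mult_ac)
    qed
    have "(\<lambda>k. 2 * C * (grad_norm p u + inverse (real (Suc k))) * norm (x - y) powr \<alpha>)
       \<longlonglongrightarrow> 2 * C * (grad_norm p u + 0) * norm (x - y) powr \<alpha>"
      by (intro tendsto_mult tendsto_add tendsto_const LIMSEQ_inverse_real_of_nat)
    then show ?thesis using le by (intro LIMSEQ_le_const[of _ _ "\<bar>u x - u y\<bar>"]) auto
  qed
  then show ?thesis using C0 by (intro that[of "2 * C"]) auto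
qed


section \<open>Uniform convexity and completeness\<close>

text \<open>The mean value theorem on the two halves of the interval: the slope
  \<open>p * z powr (p - 1)\<close> is strictly larger on the right half. Derivatives are taken at
  interior points only, so \<open>s = 0\<close> is covered.\<close>

lemma powr_midpoint_less:
  fixes s t :: real
  assumes p: "1 < p" and st: "0 \<le> s" "s < t"
  shows "((s + t) / 2) powr p < (s powr p + t powr p) / 2"
proof -
  define m where "m = (s + t) / 2"
  have m: "s < m" "m < t" using st by (auto simp: m_def)
  have mv: "\<exists>z. a < z \<and> z < b \<and> b powr p - a powr p = (b - a) * (p * z powr (p - 1))" if ab: "0 \<le> a" "a < b" for a b :: real
  proof -
    have "\<exists>l z. a < z \<and> z < b \<and> ((\<lambda>x. x powr p) has_real_derivative l) (at z) \<and> b powr p - a powr p = (b - a) * l"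
    proof (rule MVT[OF ab(2)])
      show "continuous_on {a..b} (\<lambda>x. x powr p)" using ab p by (intro continuous_on_powr') (auto intro!: continuous_intros)
      show "(\<lambda>x. x powr p) differentiable at x" if "a < x" "x < b" for x
        using has_real_derivative_powr[of x p] that ab by (auto simp: real_differentiable_def)
    qed
    then obtain l z where z: "a < z" "z < b" "((\<lambda>x. x powr p) has_real_derivative l) (at z)" "b powr p - a powr p = (b - a) * l"
      by blast
    have "l = p * z powr (p - 1)"
      using DERIV_unique[OF z(3) has_real_derivative_powr] z ab by simp
    then show ?thesis using z by blast
  qed
  obtain y where y: "s < y" "y < m" "m powr p - s powr p = (m - s) * (p * y powr (p - 1))" using mv[OF st(1) m(1)] by blast
  obtain z where z: "m < z" "z < t" "t powr p - m powr p = (t - m) * (p * z powr (p - 1))" using mv[of m t] m st by auto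
  have "y powr (p - 1) < z powr (p - 1)" using y z st p by (intro powr_less_mono2) auto
  moreover have ms: "m - s = t - m" "0 < t - m" using m by (auto simp: m_def field_simps)
  ultimately have "(t - m) * (p * y powr (p - 1)) < (t - m) * (p * z powr (p - 1))"
    using p by (intro mult_strict_left_mono) auto
  then have "m powr p - s powr p < t powr p - m powr p" using y(3) z(3) ms(1) by simp
  then show ?thesis by (simp add: m_def[symmetric])
qed

text \<open>Strictness has two sources. Distinct vectors of equal norm are not positively parallel,
  so the triangle inequality is strict; for unequal norms the strict convexity of the power
  decides.\<close>

lemma norm_midpoint_powr_less:
  fixes a b :: "'a::real_inner"
  assumes p: "1 < p" and ab: "a \<noteq> b"
  shows "norm ((1/2) *\<^sub>R (a + b)) powr p < (norm a powr p + norm b powr p) / 2"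
proof (cases "norm a = norm b")
  case True
  have "norm (a + b) \<noteq> norm a + norm b"
  proof
    assume "norm (a + b) = norm a + norm b"
    then have "norm a *\<^sub>R b = norm b *\<^sub>R a" by (simp add: norm_triangle_eq)
    then show False using True ab by auto
  qed
  then have "norm ((1/2) *\<^sub>R (a + b)) < norm a" using norm_triangle_ineq[of a b] True by simp
  then have "norm ((1/2) *\<^sub>R (a + b)) powr p < norm a powr p" using p by (intro powr_less_mono2) auto
  then show ?thesis using True by simp
next
  case False
  have "norm ((1/2) *\<^sub>R (a + b)) powr p \<le> ((norm a + norm b) / 2) powr p"
    using p norm_triangle_ineq[of a b] by (intro powr_mono2) auto
  also have "\<dots> < (norm a powr p + norm b powr p) / 2"
    using powr_midpoint_less[OF p, of "norm a" "norm b"] powr_midpoint_less[OF p, of "norm b" "norm a"] False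
    by (cases "norm a" "norm b" rule: linorder_cases) (auto simp: add.commute)
  finally show ?thesis .
qed

lemma norm_midpoint_powr_le:
  fixes a b :: "'a::real_inner"
  assumes "1 < p"
  shows "norm ((1/2) *\<^sub>R (a + b)) powr p \<le> (norm a powr p + norm b powr p) / 2"
proof (cases "a = b")
  case True
  then show ?thesis by (simp add: scaleR_2[symmetric])
qed (use norm_midpoint_powr_less[OF assms] in fastforce)

text \<open>A pointwise form of uniform convexity. By homogeneity it suffices to treat the unit sphere,
  where compactness bounds the convexity gap from below as long as \<open>a\<close> and \<open>b\<close> stay apart.\<close>

lemma uniform_convexity_powr:
  assumes p: "1 < p" and \<epsilon>: "0 < \<epsilon>"
  obtains C where "0 \<le> C" "\<And>a b :: 'a::euclidean_space.
    norm (a - b) powr p \<le> \<epsilon> * (norm a powr p + norm b powr p)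
      + C * ((norm a powr p + norm b powr p) / 2 - norm ((1/2) *\<^sub>R (a + b)) powr p)"
proof -
  define D where "D z = (norm (fst z) powr p + norm (snd z) powr p) / 2 - norm ((1/2) *\<^sub>R (fst z + snd z)) powr p" for z :: "'a \<times> 'a"
  define K where "K = {z :: 'a \<times> 'a. norm (fst z) powr p + norm (snd z) powr p = 1 \<and> \<epsilon> \<le> norm (fst z - snd z) powr p}"
  have cont: "continuous_on A (\<lambda>z. norm (f z) powr p)" if "continuous_on A f" for A and f :: "'a \<times> 'a \<Rightarrow> 'a"
    using p that by (intro continuous_on_powr') (auto intro!: continuous_intros)
  have cD: "continuous_on A D" for A
    unfolding D_def by (intro cont continuous_on_diff continuous_on_divide continuous_on_add continuous_on_scaleR continuous_on_const continuous_on_fst continuous_on_snd continuous_on_id) simp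
  have n1: "norm (fst z) \<le> 1" "norm (snd z) \<le> 1" if "norm (fst z) powr p + norm (snd z) powr p = 1" for z :: "'a \<times> 'a"
  proof -
    have "norm (fst z) powr p \<le> 1" "norm (snd z) powr p \<le> 1"
      using that powr_ge_zero[of "norm (fst z)" p] powr_ge_zero[of "norm (snd z)" p] by linarith+
    then show "norm (fst z) \<le> 1" "norm (snd z) \<le> 1"
      using powr_less_mono2[of p 1 "norm (fst z)"] powr_less_mono2[of p 1 "norm (snd z)"] p
      by (auto simp: not_less[symmetric])
  qed
  have "compact K"
  proof -
    have "closed K"
      unfolding K_def by (intro closed_Collect_conj closed_Collect_eq closed_Collect_le cont continuous_on_diff continuous_on_divide continuous_on_add continuous_on_scaleR continuous_on_const continuous_on_fst continuous_on_snd continuous_on_id)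
    moreover have "norm z \<le> 2" if "z \<in> K" for z
      using that n1[of z] norm_Pair_le[of "fst z" "snd z"] by (simp add: K_def)
    ultimately show ?thesis unfolding compact_eq_bounded_closed bounded_iff by blast
  qed
  have Dpos: "0 < D z" if "z \<in> K" for z
  proof -
    have "fst z \<noteq> snd z" using that \<epsilon> by (auto simp: K_def)
    then show ?thesis using norm_midpoint_powr_less[OF p] by (simp add: D_def)
  qed
  \<comment> \<open>For large \<epsilon> the set \<open>K\<close> is empty and any positive gap
    serves; otherwise the minimum of \<open>D\<close> on \<open>K\<close> is taken.\<close>
  have "\<exists>\<delta>>0. \<forall>z\<in>K. \<delta> \<le> D z"
  proof (cases "K = {}")
    case False
    then obtain z0 where "z0 \<in> K" "\<And>z. z \<in> K \<Longrightarrow> D z0 \<le> D z"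
      using continuous_attains_inf[OF \<open>compact K\<close> _ cD] by blast
    then show ?thesis using Dpos by blast
  qed (auto intro: exI[of _ 1])
  then obtain \<delta> where \<delta>: "0 < \<delta>" "\<And>z. z \<in> K \<Longrightarrow> \<delta> \<le> D z" by blast
  have D0: "0 \<le> D z" for z using norm_midpoint_powr_le[OF p, of "fst z" "snd z"] by (simp add: D_def)
  \<comment> \<open>On the sphere both norms are at most 1, so the left side never exceeds
    \<open>2 powr p\<close>. The factor \<open>2 powr p / \<delta>\<close> makes the gap on
    \<open>K\<close> pay for this crude bound.\<close>
  have sphere: "norm (fst z - snd z) powr p \<le> \<epsilon> + 2 powr p / \<delta> * D z"
    if z: "norm (fst z) powr p + norm (snd z) powr p = 1" for z
  proof (cases "z \<in> K")
    case True
    have "norm (fst z - snd z) powr p \<le> 2 powr p"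
      using n1[OF z] norm_triangle_ineq4[of "fst z" "snd z"] p by (intro powr_mono2) auto
    also have "\<dots> = 2 powr p / \<delta> * \<delta>" using \<delta> by simp
    also have "\<dots> \<le> 2 powr p / \<delta> * D z" using \<delta> True by (intro mult_left_mono) auto
    finally show ?thesis using \<epsilon> by simp
  next
    case False
    then have "norm (fst z - snd z) powr p < \<epsilon>" using z by (simp add: K_def)
    moreover have "0 \<le> 2 powr p / \<delta> * D z" using \<delta> D0 by simp
    ultimately show ?thesis by simp
  qed
  have "norm (a - b) powr p \<le> \<epsilon> * (norm a powr p + norm b powr p)
      + 2 powr p / \<delta> * ((norm a powr p + norm b powr p) / 2 - norm ((1/2) *\<^sub>R (a + b)) powr p)" for a b :: 'a
  proof (cases "norm a powr p + norm b powr p = 0")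
    case True
    then have "a = 0" "b = 0" using powr_ge_zero[of "norm a" p] powr_ge_zero[of "norm b" p]
      by (auto simp: add_nonneg_eq_0_iff)
    then show ?thesis by simp
  next
    case False
    define S where "S = norm a powr p + norm b powr p"
    have S: "0 < S" using False by (simp add: S_def less_le)
    define t where "t = S powr (1 / p)"
    have t: "0 < t" "t powr p = S" using S p by (simp_all add: t_def powr_powr)
    have sc: "norm ((1 / t) *\<^sub>R x) powr p = norm x powr p / S" for x :: 'a
      using t by (simp add: powr_divide)
    have m: "(1/2) *\<^sub>R ((1 / t) *\<^sub>R a + (1 / t) *\<^sub>R b) = (1 / t) *\<^sub>R ((1/2) *\<^sub>R (a + b))"
      by (simp add: scaleR_add_right mult.commute)
    have d: "(1 / t) *\<^sub>R a - (1 / t) *\<^sub>R b = (1 / t) *\<^sub>R (a - b)" by (simp add: scaleR_diff_right)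
    have one: "norm a powr p / S + norm b powr p / S = 1"
      using S by (simp add: S_def add_divide_distrib[symmetric])
    then have "norm ((1 / t) *\<^sub>R a) powr p + norm ((1 / t) *\<^sub>R b) powr p = 1" unfolding sc .
    from sphere[of "((1 / t) *\<^sub>R a, (1 / t) *\<^sub>R b)", simplified fst_conv snd_conv D_def, OF this]
    have "norm (a - b) powr p / S \<le> \<epsilon> + 2 powr p / \<delta> * ((norm a powr p / S + norm b powr p / S) / 2 - norm ((1/2) *\<^sub>R (a + b)) powr p / S)"
      unfolding m d sc one .
    also have "\<dots> = (\<epsilon> * S + 2 powr p / \<delta> * ((norm a powr p + norm b powr p) / 2 - norm ((1/2) *\<^sub>R (a + b)) powr p)) / S"
      using S by (simp add: add_divide_distrib diff_divide_distrib right_diff_distrib distrib_left)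
    finally show ?thesis using S by (simp add: divide_le_cancel S_def[symmetric])
  qed
  then show ?thesis using \<delta> by (intro that[of "2 powr p / \<delta>"]) auto
qed

section \<open>Convergence in \<open>L_p\<close> and stability of weak gradients\<close>

lemma AE_summable:
  fixes f :: "nat \<Rightarrow> 'a \<Rightarrow> real"
  assumes f: "\<And>k. integrable M (f k)" "\<And>k x. 0 \<le> f k x" and s: "summable (\<lambda>k. \<integral>x. f k x \<partial>M)"
  shows "AE x in M. summable (\<lambda>k. f k x)"
proof -
  have m: "f k \<in> borel_measurable M" for k using f(1) by (rule borel_measurable_integrable)
  have "(\<integral>\<^sup>+x. (\<Sum>k. ennreal (f k x)) \<partial>M) = (\<Sum>k. \<integral>\<^sup>+x. ennreal (f k x) \<partial>M)"
    using m by (intro nn_integral_suminf) simp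
  also have "\<dots> = (\<Sum>k. ennreal (\<integral>x. f k x \<partial>M))" using f by (simp add: nn_integral_eq_integral)
  also have "\<dots> \<noteq> top" using s f by (intro ennreal_suminf_neq_top) auto
  finally have "AE x in M. (\<Sum>k. ennreal (f k x)) \<noteq> \<infinity>"
    using m by (intro nn_integral_noteq_infinite) auto
  then show ?thesis
    by (rule AE_mp) (use f(2) in \<open>auto intro!: AE_I2 summable_suminf_not_top\<close>)
qed

text \<open>A Riesz-Fischer argument. The rate \<open>(1/4) ^ k\<close> leaves room for the weight
  \<open>2 ^ k\<close> in \<open>f\<close>: the weighted powers still have summable integrals, so
  their sum \<open>V\<close> is integrable. Each increment is then at most
  \<open>V x powr (1 / p)\<close> times \<open>(1/2) ^ k\<close>, and the geometric series gives
  both pointwise convergence and a single majorant for all \<open>k\<close>.\<close>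

lemma Lp_fast_Cauchy_limit:
  fixes G :: "nat \<Rightarrow> 'b \<Rightarrow> 'a::{banach, second_countable_topology}"
  assumes p: "1 \<le> p" and m: "\<And>k. G k \<in> borel_measurable M"
    and i: "\<And>k. integrable M (\<lambda>x. norm (G (Suc k) x - G k x) powr p)"
    and fast: "\<And>k. (\<integral>x. norm (G (Suc k) x - G k x) powr p \<partial>M) \<le> ((1/4) ^ k) powr p"
  obtains g W where "g \<in> borel_measurable M" "integrable M W" "\<And>x. 0 \<le> W x"
    "AE x in M. (\<lambda>k. G k x) \<longlonglongrightarrow> g x" "AE x in M. \<forall>k. norm (G k x - g x) powr p \<le> W x"
proof -
  define f where "f k x = (2 ^ k) powr p * norm (G (Suc k) x - G k x) powr p" for k x
  have f: "integrable M (f k)" "0 \<le> f k x" for k x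
    unfolding f_def using i by (auto intro!: integrable_mult_right)
  have fi: "0 \<le> (\<integral>x. f k x \<partial>M)" "(\<integral>x. f k x \<partial>M) \<le> (1/2) ^ k" for k
  proof -
    show "0 \<le> (\<integral>x. f k x \<partial>M)" using f by simp
    have "(\<integral>x. f k x \<partial>M) \<le> (2 ^ k) powr p * ((1/4) ^ k) powr p"
      unfolding f_def using fast[of k] by (simp add: mult_left_mono)
    also have "\<dots> = ((1/2) ^ k) powr p"
      by (subst powr_mult[symmetric]) (simp_all add: power_mult_distrib[symmetric])
    also have "\<dots> \<le> ((1/2) ^ k) powr 1" using p by (intro powr_mono') (auto simp: power_le_one)
    finally show "(\<integral>x. f k x \<partial>M) \<le> (1/2) ^ k" by simp
  qed
  have sf: "summable (\<lambda>k. \<integral>x. f k x \<partial>M)"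
    by (rule summable_comparison_test'[OF summable_geometric[of "1/2::real"], of 0]) (use fi in auto)
  have ae: "AE x in M. summable (\<lambda>k. f k x)" using f sf by (intro AE_summable)
  define V where "V x = (\<Sum>k. f k x)" for x
  have iV: "integrable M V"
    unfolding V_def[abs_def] using f ae sf by (intro integrable_suminf) auto
  define g where "g x = lim (\<lambda>k. G k x)" for x
  have gm: "g \<in> borel_measurable M" unfolding g_def[abs_def] using m by (rule borel_measurable_lim_metric)
  have key: "(\<lambda>k. G k x) \<longlonglongrightarrow> g x \<and> (\<forall>k. norm (G k x - g x) powr p \<le> 2 powr p * \<bar>V x\<bar>)" if s: "summable (\<lambda>k. f k x)" for x
  proof -
    define w where "w = V x powr (1 / p)"
    have V0: "0 \<le> V x" unfolding V_def using f(2) s by (intro suminf_nonneg)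
    have w: "0 \<le> w" "w powr p = V x" using V0 p by (auto simp: w_def powr_powr)
    have dk: "norm (G (Suc k) x - G k x) \<le> w * (1/2) ^ k" for k
    proof -
      have "f k x \<le> V x" unfolding V_def using f(2) s sum_le_suminf[OF s, of "{k}"] by simp
      then have "(2 ^ k * norm (G (Suc k) x - G k x)) powr p \<le> w powr p" unfolding w(2) f_def by (simp add: powr_mult)
      then have "2 ^ k * norm (G (Suc k) x - G k x) \<le> w"
        using powr_less_mono2[of p w "2 ^ k * norm (G (Suc k) x - G k x)"] w p by (auto simp: not_less[symmetric])
      then show ?thesis by (simp add: power_one_over field_simps)
    qed
    have sg: "summable (\<lambda>k. w * (1/2) ^ k)" by (intro summable_mult summable_geometric) auto
    have "summable (\<lambda>k. G (Suc k) x - G k x)"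
      by (rule summable_comparison_test'[OF sg, of 0]) (use dk in auto)
    then have "convergent (\<lambda>n. \<Sum>k<n. (G (Suc k) x - G k x))" by (simp add: summable_iff_convergent)
    then have "convergent (\<lambda>n. G n x - G 0 x)" using sum_lessThan_telescope[of "\<lambda>k. G k x"] by simp
    then have "convergent (\<lambda>n. (G n x - G 0 x) + G 0 x)" by (intro convergent_add convergent_const)
    then have lim: "(\<lambda>k. G k x) \<longlonglongrightarrow> g x" unfolding g_def by (simp add: convergent_LIMSEQ_iff)
    have "norm (G k x - g x) powr p \<le> 2 powr p * \<bar>V x\<bar>" for k
    proof -
      have "norm (G k x - G (k + n) x) \<le> 2 * w" for n
      proof -
        have "norm (G k x - G (k + n) x) = norm (\<Sum>j<n. G (Suc (k + j)) x - G (k + j) x)"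
          using sum_lessThan_telescope[of "\<lambda>j. G (k + j) x" n] by (simp add: norm_minus_commute)
        also have "\<dots> \<le> (\<Sum>j<n. w * (1/2) ^ j)"
        proof (rule sum_norm_le)
          fix j
          have "w * (1/2) ^ (k + j) \<le> w * (1/2) ^ j" using w by (intro mult_left_mono power_decreasing) auto
          then show "norm (G (Suc (k + j)) x - G (k + j) x) \<le> w * (1/2) ^ j" using dk[of "k + j"] by linarith
        qed
        also have "\<dots> \<le> (\<Sum>j. w * (1/2) ^ j)" using w by (intro sum_le_suminf sg) auto
        also have "\<dots> = 2 * w" by (simp add: suminf_mult suminf_geometric)
        finally show ?thesis .
      qed
      moreover have "(\<lambda>n. norm (G k x - G (k + n) x)) \<longlonglongrightarrow> norm (G k x - g x)"
        using LIMSEQ_ignore_initial_segment[OF lim, of k] by (intro tendsto_intros) (simp add: add.commute)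
      ultimately have "norm (G k x - g x) \<le> 2 * w" by (intro LIMSEQ_le_const2) auto
      then have "norm (G k x - g x) powr p \<le> (2 * w) powr p" using p by (intro powr_mono2) auto
      then show ?thesis using w V0 by (simp add: powr_mult)
    qed
    then show ?thesis using lim by blast
  qed
  \<comment> \<open>The absolute value keeps the majorant nonnegative everywhere: on the null set
    where the series diverges, \<open>V x\<close> is an unspecified number.\<close>
  show ?thesis
  proof (rule that[of g "\<lambda>x. 2 powr p * \<bar>V x\<bar>"])
    show "AE x in M. (\<lambda>k. G k x) \<longlonglongrightarrow> g x" "AE x in M. \<forall>k. norm (G k x - g x) powr p \<le> 2 powr p * \<bar>V x\<bar>"
      using ae by (auto elim!: eventually_mono dest: key)
  qed (use gm iV in auto)
qed

text \<open>Dominated convergence throughout. \<open>Q\<close> is bounded on the support of a test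
  function and controls the values; \<open>W\<close> and the power of the limit control the
  gradients. The single majorant \<open>E\<close> gives actual convergence of the energies, not only
  lower semicontinuity.\<close>

lemma has_weak_gradient_limit:
  fixes u :: "nat \<Rightarrow> real^'n \<Rightarrow> real"
  assumes p: "1 \<le> p" and wg: "\<And>k. has_weak_gradient p (u k) (G k)"
    and lim: "\<And>x. (\<lambda>k. u k x) \<longlonglongrightarrow> v x" and cv: "continuous_on UNIV v"
    and Q: "continuous_on UNIV Q" "\<And>k x. \<bar>u k x\<bar> \<le> Q x"
    and g: "g \<in> borel_measurable lebesgue" and W: "integrable lebesgue W" "\<And>x. 0 \<le> W x"
    and glim: "AE x in lebesgue. (\<lambda>k. G k x) \<longlonglongrightarrow> g x"
    and gW: "AE x in lebesgue. \<forall>k. norm (G k x - g x) powr p \<le> W x"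
  shows "has_weak_gradient p v g" "(\<lambda>k. energy p (G k)) \<longlonglongrightarrow> energy p g"
proof -
  have p0: "0 \<le> p" using p by simp
  have Gm: "G k \<in> borel_measurable lebesgue" and Gi: "integrable lebesgue (\<lambda>x. norm (G k x) powr p)" for k
    using wg[of k] by (auto simp: has_weak_gradient_def)
  have tri: "norm a powr p \<le> 2 powr p * (norm b powr p + norm (a - b) powr p)" for a b :: "real^'n"
    using norm_powr_lincomb_le[OF p0, of 1 b 1 "a - b"] by simp
  have gi: "integrable lebesgue (\<lambda>x. norm (g x) powr p)"
  proof (rule Bochner_Integration.integrable_bound)
    show "integrable lebesgue (\<lambda>x. 2 powr p * (norm (G 0 x) powr p + W x))"
      using Gi W by (intro integrable_mult_right Bochner_Integration.integrable_add)
    show "AE x in lebesgue. norm (norm (g x) powr p) \<le> norm (2 powr p * (norm (G 0 x) powr p + W x))"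
      using gW
    proof eventually_elim
      case (elim x)
      have "norm (g x) powr p \<le> 2 powr p * (norm (G 0 x) powr p + norm (g x - G 0 x) powr p)" by (rule tri)
      also have "\<dots> \<le> 2 powr p * (norm (G 0 x) powr p + W x)"
        using elim by (intro mult_left_mono add_left_mono) (auto simp: norm_minus_commute)
      finally show ?case using W(2)[of x] by simp
    qed
  qed (use g in simp)
  define E where "E x = 2 powr p * (norm (g x) powr p + W x)" for x
  have iE: "integrable lebesgue E"
    unfolding E_def using gi W by (intro integrable_mult_right Bochner_Integration.integrable_add)
  have GE: "AE x in lebesgue. \<forall>k. norm (G k x) powr p \<le> E x"
    using gW
  proof eventually_elim
    case (elim x)
    show ?case
    proof
      fix k
      have "norm (G k x) powr p \<le> 2 powr p * (norm (g x) powr p + norm (G k x - g x) powr p)" by (rule tri)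
      also have "\<dots> \<le> E x" unfolding E_def using elim by (intro mult_left_mono add_left_mono) auto
      finally show "norm (G k x) powr p \<le> E x" .
    qed
  qed
  show "(\<lambda>k. energy p (G k)) \<longlonglongrightarrow> energy p g"
    unfolding energy_def
  proof (rule integral_dominated_convergence[where w=E])
    show "AE x in lebesgue. (\<lambda>k. norm (G k x) powr p) \<longlonglongrightarrow> norm (g x) powr p"
      using glim by eventually_elim (use p in \<open>auto intro!: tendsto_powr' tendsto_norm\<close>)
    show "AE x in lebesgue. norm (norm (G k x) powr p) \<le> E x" for k using GE by eventually_elim simp
  qed (use g Gm iE in auto)
  have gL: "(\<lambda>x. g x $ i) \<in> L1_loc" for i
    unfolding L1_loc_def set_integrable_def
  proof clarify
    fix K :: "(real^'n) set" assume K: "compact K"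
    then have ms: "K \<in> sets lebesgue" by (simp add: compact_imp_closed)
    show "integrable lebesgue (\<lambda>x. indicator K x *\<^sub>R g x $ i)"
    proof (rule Bochner_Integration.integrable_bound)
      show "integrable lebesgue (\<lambda>x. indicator K x + norm (g x) powr p)"
        using gi K ms by (intro Bochner_Integration.integrable_add integrable_indicator_bounded) (auto intro: compact_imp_bounded)
      show "(\<lambda>x. indicator K x *\<^sub>R g x $ i) \<in> borel_measurable lebesgue"
        using g ms by (intro borel_measurable_scaleR borel_measurable_indicator) (auto simp: borel_measurable_vec_iff)
      have "norm (indicator K x *\<^sub>R g x $ i) \<le> norm (indicator K x + norm (g x) powr p)" for x
        using component_le_norm_cart[of "g x" i] abs_le_1_powr[OF p, of "norm (g x)"] by (auto simp: indicator_def)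
      then show "AE x in lebesgue. norm (indicator K x *\<^sub>R g x $ i) \<le> norm (indicator K x + norm (g x) powr p)" by simp
    qed
  qed
  show "has_weak_gradient p v g"
    unfolding has_weak_gradient_def has_weak_partial_def
  proof (intro conjI allI impI)
    show "v \<in> L1_loc" using cv by (rule continuous_imp_L1_loc)
    show "(\<lambda>x. g x $ i) \<in> L1_loc" for i by (rule gL)
    show "g \<in> borel_measurable lebesgue" "integrable lebesgue (\<lambda>x. norm (g x) powr p)" by (rule g, rule gi)
    fix i and \<phi> :: "real^'n \<Rightarrow> real" assume t: "test_function \<phi>"
    note t' = test_function_partial[OF t, of i]
    have 1: "(\<lambda>k. LINT x|lebesgue. u k x * partial i \<phi> x) \<longlonglongrightarrow> (LINT x|lebesgue. v x * partial i \<phi> x)"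
    proof (rule integral_dominated_convergence[where w="\<lambda>x. \<bar>Q x * partial i \<phi> x\<bar>"])
      show "(\<lambda>x. v x * partial i \<phi> x) \<in> borel_measurable lebesgue"
        using L1_loc_mult_test[OF continuous_imp_L1_loc[OF cv] t'] by simp
      show "(\<lambda>x. u k x * partial i \<phi> x) \<in> borel_measurable lebesgue" for k
        using L1_loc_mult_test[OF _ t', of "u k"] wg[of k] by (simp add: has_weak_gradient_def)
      show "integrable lebesgue (\<lambda>x. \<bar>Q x * partial i \<phi> x\<bar>)"
        using L1_loc_mult_test[OF continuous_imp_L1_loc[OF Q(1)] t'] by simp
      show "AE x in lebesgue. (\<lambda>k. u k x * partial i \<phi> x) \<longlonglongrightarrow> v x * partial i \<phi> x"
        using lim by (intro always_eventually allI tendsto_mult tendsto_const)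
      show "AE x in lebesgue. norm (u k x * partial i \<phi> x) \<le> \<bar>Q x * partial i \<phi> x\<bar>" for k
        using order_trans[OF Q(2)[of k] abs_ge_self] by (auto simp: abs_mult intro!: mult_right_mono)
    qed
    have 2: "(\<lambda>k. LINT x|lebesgue. G k x $ i * \<phi> x) \<longlonglongrightarrow> (LINT x|lebesgue. g x $ i * \<phi> x)"
    proof -
      obtain B where B: "0 \<le> B" "\<And>x. \<bar>\<phi> x\<bar> \<le> B" using test_function_bounded[OF t] by blast
      show ?thesis
      proof (rule integral_dominated_convergence[where w="\<lambda>x. \<bar>\<phi> x\<bar> + B * E x"])
        show "(\<lambda>x. g x $ i * \<phi> x) \<in> borel_measurable lebesgue" using L1_loc_mult_test[OF gL t] by simp
        show "(\<lambda>x. G k x $ i * \<phi> x) \<in> borel_measurable lebesgue" for k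
          using L1_loc_mult_test[OF _ t, of "\<lambda>x. G k x $ i"] wg[of k] by (simp add: has_weak_gradient_def has_weak_partial_def)
        show "integrable lebesgue (\<lambda>x. \<bar>\<phi> x\<bar> + B * E x)" using test_function_integrable[OF t] iE by simp
        show "AE x in lebesgue. (\<lambda>k. G k x $ i * \<phi> x) \<longlonglongrightarrow> g x $ i * \<phi> x"
          using glim by eventually_elim (intro tendsto_mult tendsto_const tendsto_vec_nth)
        show "AE x in lebesgue. norm (G k x $ i * \<phi> x) \<le> \<bar>\<phi> x\<bar> + B * E x" for k
          using GE
        proof eventually_elim
          case (elim x)
          have "\<bar>G k x $ i\<bar> \<le> 1 + norm (G k x) powr p"
            using component_le_norm_cart[of "G k x" i] abs_le_1_powr[OF p, of "norm (G k x)"] by simp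
          also have "\<dots> \<le> 1 + E x" using elim by simp
          finally have "\<bar>G k x $ i\<bar> * \<bar>\<phi> x\<bar> \<le> (1 + E x) * \<bar>\<phi> x\<bar>" by (intro mult_right_mono) auto
          also have "\<dots> = \<bar>\<phi> x\<bar> + \<bar>\<phi> x\<bar> * E x" by (simp add: algebra_simps)
          also have "\<dots> \<le> \<bar>\<phi> x\<bar> + B * E x" using B(2)[of x] W(2)[of x] by (intro add_left_mono mult_right_mono) (auto simp: E_def)
          finally show ?case by (simp add: abs_mult)
        qed
      qed
    qed
    have 3: "(LINT x|lebesgue. u k x * partial i \<phi> x) = - (LINT x|lebesgue. G k x $ i * \<phi> x)" for k
      using wg[of k] t by (auto simp: has_weak_gradient_def has_weak_partial_def)
    show "(LINT x|lebesgue. v x * partial i \<phi> x) = - (LINT x|lebesgue. g x $ i * \<phi> x)"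
      using 1 tendsto_minus[OF 2] unfolding 3 by (rule LIMSEQ_unique)
  qed
qed


section \<open>Existence of an extremal\<close>

lemma hoelder_continuous_imp_continuous_on:
  fixes u :: "'a::metric_space \<Rightarrow> 'b::metric_space"
  assumes "0 < a" "hoelder_continuous a u"
  shows "continuous_on A u"
proof (rule continuous_at_imp_continuous_on, rule ballI)
  fix x :: "'a"
  obtain C where C: "\<And>x y. dist (u x) (u y) \<le> C * dist x y powr a"
    using assms(2) by (auto simp: hoelder_continuous_def)
  have "((\<lambda>y. C * dist y x powr a) \<longlongrightarrow> C * 0 powr a) (at x)"
    by (intro tendsto_mult tendsto_const tendsto_powr') (use assms(1) in \<open>auto intro!: tendsto_eq_intros\<close>)
  then have "((\<lambda>y. C * dist y x powr a) \<longlongrightarrow> 0) (at x)" using assms(1) by simp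
  then have "((\<lambda>y. dist (u y) (u x)) \<longlongrightarrow> 0) (at x)"
    by (rule Lim_null_comparison[rotated]) (use C in auto)
  then show "isCont u x" unfolding isCont_def by (subst tendsto_dist_iff)
qed

lemma D1_continuous:
  fixes u :: "real^'n \<Rightarrow> real"
  assumes "real CARD('n) < p" "u \<in> D1 p"
  shows "continuous_on A u"
proof (rule hoelder_continuous_imp_continuous_on)
  have "0 < p" using assms(1) of_nat_0_le_iff[of "CARD('n)"] by linarith
  then show "0 < 1 - real CARD('n) / p" using assms(1) by simp
qed (use assms(2) in \<open>simp add: D1_def\<close>)

text \<open>Within distance 1 the Lipschitz bound is stronger than the Hoelder bound, since the
  exponent is at most 1; beyond that distance boundedness suffices.\<close>

lemma test_function_D1:
  fixes f :: "real^'n \<Rightarrow> real"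
  assumes p: "real CARD('n) < p" and f: "test_function f"
  shows "f \<in> D1 p"
proof -
  have p0: "0 < p" using p of_nat_0_le_iff[of "CARD('n)"] by linarith
  define \<alpha> where "\<alpha> = 1 - real CARD('n) / p"
  have \<alpha>: "0 < \<alpha>" "\<alpha> \<le> 1" using p p0 by (auto simp: \<alpha>_def)
  obtain L where L: "0 \<le> L" "\<And>x y. \<bar>f x - f y\<bar> \<le> L * norm (x - y)" using test_function_lipschitz[OF f] by blast
  obtain B where B: "0 \<le> B" "\<And>x. \<bar>f x\<bar> \<le> B" using test_function_bounded[OF f] by blast
  have "\<bar>f x - f y\<bar> \<le> (L + 2 * B) * norm (x - y) powr \<alpha>" for x y
  proof (cases "norm (x - y) \<le> 1")
    case True
    have "norm (x - y) \<le> norm (x - y) powr \<alpha>"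
      using powr_mono'[of \<alpha> 1 "norm (x - y)"] \<alpha> True by simp
    then have "L * norm (x - y) \<le> (L + 2 * B) * norm (x - y) powr \<alpha>" using L B by (intro mult_mono) auto
    then show ?thesis using L(2)[of x y] by linarith
  next
    case False
    have "1 \<le> norm (x - y) powr \<alpha>" using False \<alpha> by (simp add: ge_one_powr_ge_zero)
    then have "(L + 2 * B) * 1 \<le> (L + 2 * B) * norm (x - y) powr \<alpha>" using L B by (intro mult_left_mono) auto
    moreover have "\<bar>f x - f y\<bar> \<le> (L + 2 * B) * 1" using abs_triangle_ineq4[of "f x" "f y"] B(2)[of x] B(2)[of y] L(1) by simp
    ultimately show ?thesis by linarith
  qed
  then have "hoelder_continuous \<alpha> f"
    unfolding hoelder_continuous_def by (auto simp: dist_norm)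
  then show ?thesis
    using has_weak_gradient_test_function[OF f p0] unfolding D1_iff[OF p0] \<alpha>_def by blast
qed

locale morrey_extremal = balanced_compact_measure \<rho>
  for \<rho> :: "(real^'n) set \<Rightarrow> real" +
  fixes p :: real
  assumes p_gt: "real CARD('n) < p" and moment: "signed_integral \<rho> (\<lambda>y. y) \<noteq> 0"
begin

abbreviation "L \<equiv> (signed_integral \<rho> :: (real^'n \<Rightarrow> real) \<Rightarrow> real)"

lemma p_gt1: "1 < p"
proof -
  have "1 \<le> real CARD('n)" by (simp add: Suc_leI)
  then show ?thesis using p_gt by linarith
qed

lemma p_pos: "0 < p" using p_gt1 by simp

lemma exponent_pos: "0 < (1 - real CARD('n) / p)" using p_gt p_pos by simp

lemmas cont = D1_continuous[OF p_gt]

lemma L_add: "u \<in> D1 p \<Longrightarrow> v \<in> D1 p \<Longrightarrow> L (\<lambda>x. u x + v x) = L u + L v"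
  by (intro signed_integral_add cont)

lemma L_scale: "u \<in> D1 p \<Longrightarrow> L (\<lambda>x. a * u x) = a * L u"
  by (intro signed_integral_bounded_linear cont bounded_linear_mult_right)

lemma L_add_const: "u \<in> D1 p \<Longrightarrow> L (\<lambda>x. u x + c) = L u"
  using L_add[OF _ D1_const[OF p_pos, of c]] by simp

lemma support_norm_bound:
  obtains R where "0 \<le> R" "\<And>x. x \<in> signed_support \<rho> \<Longrightarrow> norm x \<le> R"
proof -
  obtain R where "\<And>x. x \<in> signed_support \<rho> \<Longrightarrow> norm x \<le> R"
    using compact_imp_bounded[OF compact_support] unfolding bounded_iff by blast
  then show ?thesis by (intro that[of "max 0 R"]) (auto simp: le_max_iff_disj)
qed

lemma L_bounded:
  obtains K where "0 \<le> K" "\<And>u. u \<in> D1 p \<Longrightarrow> \<bar>L u\<bar> \<le> K * grad_norm p u"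
proof -
  obtain M where M: "0 \<le> M" "\<And>(u :: real^'n \<Rightarrow> real) x y. u \<in> D1 p \<Longrightarrow> \<bar>u x - u y\<bar> \<le> M * grad_norm p u * norm (x - y) powr (1 - real CARD('n) / p)"
    using morrey_inequality[OF p_gt] by blast
  obtain R where R: "0 \<le> R" "\<And>x. x \<in> signed_support \<rho> \<Longrightarrow> norm x \<le> R" using support_norm_bound by blast
  obtain C where C: "0 \<le> C"
    "\<And>f B. \<lbrakk>continuous_on UNIV f; \<And>x. x \<in> signed_support \<rho> \<Longrightarrow> \<bar>f x\<bar> \<le> B; 0 \<le> B\<rbrakk> \<Longrightarrow> \<bar>L f\<bar> \<le> C * B"
    using signed_integral_bounded by blast
  have "\<bar>L u\<bar> \<le> C * M * R powr (1 - real CARD('n) / p) * grad_norm p u" if u: "u \<in> D1 p" for u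
  proof -
    note uc = grad_norm_add_const(2)[OF p_pos u, of "- u 0"]
    have b: "\<bar>u x + - u 0\<bar> \<le> M * grad_norm p u * R powr (1 - real CARD('n) / p)" if x: "x \<in> signed_support \<rho>" for x
    proof -
      have "norm x powr (1 - real CARD('n) / p) \<le> R powr (1 - real CARD('n) / p)" using R(2)[OF x] exponent_pos by (intro powr_mono2) auto
      then have "M * grad_norm p u * norm x powr (1 - real CARD('n) / p) \<le> M * grad_norm p u * R powr (1 - real CARD('n) / p)"
        using M(1) grad_norm_nonneg[of p u] by (intro mult_left_mono) auto
      then show ?thesis using M(2)[OF u, of x 0] by simp
    qed
    have "\<bar>L (\<lambda>x. u x + - u 0)\<bar> \<le> C * (M * grad_norm p u * R powr (1 - real CARD('n) / p))"
      using M(1) grad_norm_nonneg[of p u] b by (intro C(2) cont[OF uc]) auto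
    then show ?thesis by (simp only: L_add_const[OF u] mult_ac)
  qed
  then show ?thesis using C M by (intro that[of "C * M * R powr (1 - real CARD('n) / p)"]) auto
qed

text \<open>The dual norm of \<open>L\<close> with respect to the gradient seminorm. No absolute
  value is taken because the unit ball is symmetric under \<open>u\<close> to
  \<open>- u\<close>.\<close>

definition extremal_value :: real where "extremal_value = Sup {L v |v. v \<in> D1 p \<and> grad_norm p v \<le> 1}"

lemma extremal_value_upper:
  assumes "v \<in> D1 p" "grad_norm p v \<le> 1"
  shows "L v \<le> extremal_value"
proof -
  obtain K where K: "0 \<le> K" "\<And>u. u \<in> D1 p \<Longrightarrow> \<bar>L u\<bar> \<le> K * grad_norm p u" using L_bounded by blast
  have "L v \<le> K" if "v \<in> D1 p" "grad_norm p v \<le> 1" for v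
    using K(2)[OF that(1)] mult_left_mono[OF that(2) K(1)] by linarith
  then have "bdd_above {L v |v. v \<in> D1 p \<and> grad_norm p v \<le> 1}" unfolding bdd_above_def by blast
  then show ?thesis unfolding extremal_value_def using assms by (intro cSup_upper) auto
qed

lemma L_le:
  assumes u: "u \<in> D1 p"
  shows "\<bar>L u\<bar> \<le> extremal_value * grad_norm p u"
proof (cases "grad_norm p u = 0")
  \<comment> \<open>Such \<open>u\<close> cannot be normalized; the a priori bound
    \<open>L_bounded\<close> shows directly that \<open>L u = 0\<close>.\<close>
  case True
  obtain K where "\<And>u. u \<in> D1 p \<Longrightarrow> \<bar>L u\<bar> \<le> K * grad_norm p u" using L_bounded by blast
  from this[OF u] True show ?thesis by simp
next
  case False
  then have N: "0 < grad_norm p u" using grad_norm_nonneg[of p u] by simp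
  have le: "c * L u \<le> extremal_value" if c: "\<bar>c\<bar> = 1 / grad_norm p u" for c
    using extremal_value_upper[OF D1_scale[OF p_pos u, of c]] N grad_norm_scale[OF p_pos u, of c] c L_scale[OF u, of c] by simp
  have "L u / grad_norm p u \<le> extremal_value" "- L u / grad_norm p u \<le> extremal_value"
    using le[of "1 / grad_norm p u"] le[of "- 1 / grad_norm p u"] N by simp_all
  then have "L u \<le> extremal_value * grad_norm p u" "- L u \<le> extremal_value * grad_norm p u" using N by (simp_all only: pos_divide_le_eq)
  then show ?thesis by linarith
qed

text \<open>\<open>L\<close> takes the positive value \<open>m \<bullet> m\<close> on the linear
  function with slope \<open>m\<close>, which has constant nonzero gradient and hence infinite
  energy. Multiplying by bumps that tend to 1 on a box around the support gives test functions whose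
  values under \<open>L\<close> tend to \<open>m \<bullet> m\<close>. The margin 1 around
  \<open>R\<close> puts the support inside the open box.\<close>

lemma extremal_value_pos: "0 < extremal_value"
proof -
  define m where "m = signed_integral \<rho> (\<lambda>y. y)"
  obtain R where R: "0 \<le> R" "\<And>x. x \<in> signed_support \<rho> \<Longrightarrow> norm x \<le> R" using support_norm_bound by blast
  define f where "f k x = (m \<bullet> x) * box_bump (\<chi> i. - (R + 1)) (\<chi> i. R + 1) (real (Suc k)) x" for k and x :: "real^'n"
  have tf: "test_function (f k)" for k
    unfolding f_def[abs_def]
  proof (rule test_function_mult)
    show "C_k j (\<lambda>x. m \<bullet> x)" for j
    proof -
      have "smooth_k j (\<lambda>t. t)"
        by (cases j) (auto intro!: exI[of _ "\<lambda>t. 1"] smooth_k_const)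
      then have "C_k j (\<lambda>x. \<Sum>i\<in>UNIV. m $ i * x $ i)"
        by (intro C_k_sum C_k_mult C_k_const C_k_component)
      then show ?thesis by (simp add: inner_vec_def)
    qed
  qed (rule test_function_box_bump, simp)
  have lim: "(\<lambda>k. L (f k)) \<longlonglongrightarrow> L (\<lambda>x. m \<bullet> x)"
  proof (rule signed_integral_LIMSEQ[where B="norm m * R"])
    show "continuous_on UNIV (f k)" for k using tf by (rule test_function_continuous)
    show "continuous_on UNIV (\<lambda>x. m \<bullet> x)" by (intro continuous_intros)
    fix x assume x: "x \<in> signed_support \<rho>"
    have "- (R + 1) < x $ i \<and> x $ i < R + 1" for i using component_le_norm_cart[of x i] R(2)[OF x] by linarith
    then have "x \<in> box (\<chi> i. - (R + 1)) (\<chi> i. R + 1)" by (simp only: mem_box_cart vec_lambda_beta simp_thms)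
    then have "(\<lambda>k. f k x) \<longlonglongrightarrow> (m \<bullet> x) * 1"
      unfolding f_def using box_bump_LIMSEQ[of _ _ x] by (intro tendsto_mult tendsto_const) (metis indicator_simps(1))
    then show "(\<lambda>k. f k x) \<longlonglongrightarrow> m \<bullet> x" by simp
    fix k
    have "\<bar>m \<bullet> x\<bar> \<le> norm m * R"
      using Cauchy_Schwarz_ineq2[of m x] mult_left_mono[OF R(2)[OF x], of "norm m"] by simp
    then have "\<bar>m \<bullet> x\<bar> * \<bar>box_bump (\<chi> i. - (R + 1)) (\<chi> i. R + 1) (real (Suc k)) x\<bar> \<le> (norm m * R) * 1"
      using box_bump_bounds[of "real (Suc k)" _ _ x] R(1) by (intro mult_mono) auto
    then show "norm (f k x) \<le> norm m * R" by (simp add: f_def abs_mult)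
  qed
  have "L (\<lambda>x. m \<bullet> x) = m \<bullet> m"
    unfolding m_def by (rule signed_integral_bounded_linear[OF continuous_on_id bounded_linear_inner_right])
  moreover have "0 < m \<bullet> m" using moment by (simp add: m_def)
  ultimately have "\<forall>\<^sub>F k in sequentially. 0 < L (f k)" using lim by (intro order_tendstoD(1)[OF lim]) simp
  then obtain k where k: "0 < L (f k)" by (auto simp: eventually_sequentially)
  have "0 < extremal_value * grad_norm p (f k)" using L_le[OF test_function_D1[OF p_gt tf], of k] k by linarith
  then show ?thesis using grad_norm_nonneg[of p "f k"] by (auto simp: zero_less_mult_iff)
qed

text \<open>If \<open>L v\<close> and \<open>L w\<close> are almost maximal then so is the value at the midpoint; its gradient therefore
  has almost full energy, and uniform convexity makes the gradients of \<open>v\<close> and \<open>w\<close> close in \<open>L\<^sup>p\<close>.\<close>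

lemma near_maximal_gradients_close:
  assumes \<epsilon>: "0 < \<epsilon>"
  obtains d where "d < extremal_value"
    "\<And>v w G H. has_weak_gradient p v G \<Longrightarrow> has_weak_gradient p w H \<Longrightarrow> v \<in> D1 p \<Longrightarrow> w \<in> D1 p \<Longrightarrow>
       grad_norm p v \<le> 1 \<Longrightarrow> grad_norm p w \<le> 1 \<Longrightarrow> d \<le> L v \<Longrightarrow> d \<le> L w \<Longrightarrow> energy p (\<lambda>x. G x - H x) \<le> \<epsilon>"
proof -
  \<comment> \<open>With \<open>\<epsilon> / 4\<close> the first term contributes at most
    \<open>\<epsilon> / 2\<close>, as the two energies are at most 1. The other half of \<epsilon>
    is left for the convexity gap, which becomes small as \<open>d\<close> approaches
    \<open>extremal_value\<close>.\<close>
  obtain C where C: "0 \<le> C" "\<And>a b :: real^'n. norm (a - b) powr p \<le> \<epsilon> / 4 * (norm a powr p + norm b powr p)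
      + C * ((norm a powr p + norm b powr p) / 2 - norm ((1/2) *\<^sub>R (a + b)) powr p)"
    using uniform_convexity_powr[OF p_gt1, of "\<epsilon> / 4"] \<epsilon> by auto
  have "((\<lambda>s. C * (1 - (s / extremal_value) powr p)) \<longlongrightarrow> C * (1 - (extremal_value / extremal_value) powr p)) (at_left extremal_value)"
    using extremal_value_pos p_pos by (intro tendsto_intros) auto
  then have "((\<lambda>s. C * (1 - (s / extremal_value) powr p)) \<longlongrightarrow> 0) (at_left extremal_value)" using extremal_value_pos by simp
  then have "\<forall>\<^sub>F s in at_left extremal_value. C * (1 - (s / extremal_value) powr p) < \<epsilon> / 2" using \<epsilon> by (intro order_tendstoD(2)) auto
  moreover have "\<forall>\<^sub>F s in at_left extremal_value. 0 < s \<and> s < extremal_value"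
    using extremal_value_pos by (auto simp: eventually_at_left_field intro!: exI[of _ 0])
  ultimately have "\<forall>\<^sub>F s in at_left extremal_value. C * (1 - (s / extremal_value) powr p) < \<epsilon> / 2 \<and> 0 < s \<and> s < extremal_value" by eventually_elim auto
  then obtain d where d: "C * (1 - (d / extremal_value) powr p) < \<epsilon> / 2" "0 < d" "d < extremal_value"
    using eventually_happens[of _ "at_left extremal_value"] by (auto simp: trivial_limit_at_left_real)
  have "energy p (\<lambda>x. G x - H x) \<le> \<epsilon>"
    if G: "has_weak_gradient p v G" and H: "has_weak_gradient p w H" and vw: "v \<in> D1 p" "w \<in> D1 p"
      and N: "grad_norm p v \<le> 1" "grad_norm p w \<le> 1" and l: "d \<le> L v" "d \<le> L w" for v w G H
  proof -
    have mid: "has_weak_gradient p (\<lambda>x. 1/2 * v x + 1/2 * w x) (\<lambda>x. (1/2) *\<^sub>R G x + (1/2) *\<^sub>R H x)"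
      by (rule has_weak_gradient_lincomb[OF less_imp_le[OF p_pos] G H])
    have diff: "has_weak_gradient p (\<lambda>x. 1 * v x + (-1) * w x) (\<lambda>x. 1 *\<^sub>R G x + (-1) *\<^sub>R H x)"
      by (rule has_weak_gradient_lincomb[OF less_imp_le[OF p_pos] G H])
    define F where "F x = (1/2) *\<^sub>R (G x + H x)" for x
    have F: "has_weak_gradient p (\<lambda>x. 1/2 * v x + 1/2 * w x) F"
      using mid unfolding F_def by (simp add: scaleR_add_right)
    have I: "integrable lebesgue (\<lambda>x. norm (G x) powr p)" "integrable lebesgue (\<lambda>x. norm (H x) powr p)"
      "integrable lebesgue (\<lambda>x. norm (F x) powr p)" "integrable lebesgue (\<lambda>x. norm (G x - H x) powr p)"
      using G H F diff by (auto simp: has_weak_gradient_def)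
    have E: "energy p G \<le> 1" "energy p H \<le> 1"
      using energy_eq_grad_norm_powr[OF p_pos G] energy_eq_grad_norm_powr[OF p_pos H] N grad_norm_nonneg[of p v] grad_norm_nonneg[of p w] p_pos
      by (auto intro!: powr_le1)
    have mD: "(\<lambda>x. 1/2 * v x + 1/2 * w x) \<in> D1 p" by (rule D1_lincomb[OF p_pos vw])
    have "L (\<lambda>x. 1/2 * v x + 1/2 * w x) = 1/2 * L v + 1/2 * L w"
      using L_add[OF D1_scale[OF p_pos vw(1)] D1_scale[OF p_pos vw(2)], of "1/2" "1/2"] L_scale[OF vw(1), of "1/2"] L_scale[OF vw(2), of "1/2"]
      by simp
    then have "d \<le> extremal_value * grad_norm p (\<lambda>x. 1/2 * v x + 1/2 * w x)" using L_le[OF mD] l by linarith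
    then have "d / extremal_value \<le> grad_norm p (\<lambda>x. 1/2 * v x + 1/2 * w x)" using extremal_value_pos by (simp add: pos_divide_le_eq mult.commute)
    \<comment> \<open>\<open>L\<close> at the midpoint is at least \<open>d\<close>, and the
      gradient norm of a function bounds its value under \<open>L\<close>; hence the midpoint must
      carry almost full energy.\<close>
    then have EF: "(d / extremal_value) powr p \<le> energy p F"
      unfolding energy_eq_grad_norm_powr[OF p_pos F] using d extremal_value_pos p_pos by (intro powr_mono2) auto
    have "energy p (\<lambda>x. G x - H x) \<le> (LINT x|lebesgue. \<epsilon> / 4 * (norm (G x) powr p + norm (H x) powr p)
      + C * ((norm (G x) powr p + norm (H x) powr p) / 2 - norm (F x) powr p))"
      unfolding energy_def using I C(2) by (intro integral_mono) (auto simp: F_def)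
    also have "\<dots> = \<epsilon> / 4 * (energy p G + energy p H) + C * ((energy p G + energy p H) / 2 - energy p F)"
      unfolding energy_def using I by simp
    also have "\<dots> \<le> \<epsilon> / 4 * 2 + C * (1 - (d / extremal_value) powr p)"
    proof (intro add_mono mult_left_mono)
      show "(energy p G + energy p H) / 2 - energy p F \<le> 1 - (d / extremal_value) powr p" using E EF by argo
    qed (use E C(1) \<epsilon> in auto)
    also have "\<dots> \<le> \<epsilon>" using d(1) by simp
    finally show ?thesis .
  qed
  then show ?thesis using d(3) by (intro that[of d]) blast+
qed

text \<open>Closeness of consecutive gradients at a prescribed rate is bought by choosing the values
  of \<open>L\<close> high enough, one threshold \<open>d k\<close> for each tolerance. This makes
  the sequence itself fast Cauchy, with no passage to a subsequence.\<close>

lemma fast_maximizing_sequence: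
  obtains v G where "\<And>k::nat. v k \<in> D1 p" "\<And>k. grad_norm p (v k) \<le> 1" "\<And>k. has_weak_gradient p (v k) (G k)"
    "(\<lambda>k. L (v k)) \<longlonglongrightarrow> extremal_value" "\<And>k. energy p (\<lambda>x. G (Suc k) x - G k x) \<le> ((1/4) ^ k) powr p"
proof -
  define close where "close k d \<longleftrightarrow> (\<forall>v w G H. has_weak_gradient p v G \<longrightarrow> has_weak_gradient p w H \<longrightarrow> v \<in> D1 p \<longrightarrow> w \<in> D1 p \<longrightarrow>
       grad_norm p v \<le> 1 \<longrightarrow> grad_norm p w \<le> 1 \<longrightarrow> d \<le> L v \<longrightarrow> d \<le> L w \<longrightarrow> energy p (\<lambda>x. G x - H x) \<le> ((1/4) ^ k) powr p)"
    for k :: nat and d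
  have "\<exists>d. d < extremal_value \<and> close k d" for k :: nat
  proof -
    have "0 < ((1/4) ^ k :: real) powr p" by simp
    then show ?thesis
    proof (rule near_maximal_gradients_close, goal_cases)
      case (1 d)
      have "close k d" unfolding close_def by (intro allI impI) (rule 1(2))
      then show ?case using 1(1) by blast
    qed
  qed
  then have "\<forall>k. \<exists>d. d < extremal_value \<and> close k d" by blast
  from choice[OF this] obtain d where d: "\<And>k. d k < extremal_value" "\<And>k. close k (d k)" by blast
  \<comment> \<open>Taking the maximum over all earlier thresholds makes \<open>v (Suc k)\<close>
    pass the test for \<open>d k\<close> as well, so that neighbours can be compared. The additional
    entry forces the values of \<open>L\<close> to converge to
    \<open>extremal_value\<close>.\<close>
  define D where "D k = Max (insert (extremal_value - 1 / real (Suc k)) (d ` {..k}))" for k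
  have D1: "D k < extremal_value" for k
    unfolding D_def using d(1) by (subst Max_less_iff) auto
  have D2: "d j \<le> D k" if "j \<le> k" for j k
    unfolding D_def by (rule Max_ge) (use that in auto)
  have D3: "extremal_value - 1 / real (Suc k) \<le> D k" for k
    unfolding D_def by (rule Max_ge) simp_all
  have "\<exists>v. v \<in> D1 p \<and> grad_norm p v \<le> 1 \<and> D k < L v" for k
  proof -
    have ne: "{L v |v. v \<in> D1 p \<and> grad_norm p v \<le> 1} \<noteq> {}"
    proof -
      have z: "(\<lambda>x::real^'n. 0) \<in> D1 p" by (rule D1_const[OF p_pos])
      then have "grad_norm p (\<lambda>x::real^'n. 0) = 0" using grad_norm_scale[OF p_pos z, of 0] by simp
      then show ?thesis using z by (auto intro!: exI[of _ "\<lambda>x. 0"])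
    qed
    have "D k < Sup {L v |v. v \<in> D1 p \<and> grad_norm p v \<le> 1}" using D1[of k] unfolding extremal_value_def by simp
    from less_cSupD[OF ne this] show ?thesis by auto
  qed
  then obtain v where v: "\<And>k. v k \<in> D1 p" "\<And>k. grad_norm p (v k) \<le> 1" "\<And>k. D k < L (v k)" by metis
  have "\<forall>k. \<exists>G. has_weak_gradient p (v k) G" using v(1) unfolding D1_iff[OF p_pos] by blast
  from choice[OF this] obtain G where G: "\<And>k. has_weak_gradient p (v k) (G k)" by blast
  have lim: "(\<lambda>k. L (v k)) \<longlonglongrightarrow> extremal_value"
  proof (rule tendsto_sandwich)
    show "\<forall>\<^sub>F k in sequentially. extremal_value - 1 / real (Suc k) \<le> L (v k)"
      using order_trans[OF D3 less_imp_le[OF v(3)]] by (intro always_eventually allI)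
    show "\<forall>\<^sub>F k in sequentially. L (v k) \<le> extremal_value" using extremal_value_upper v by simp
    have "(\<lambda>k. extremal_value - inverse (real (Suc k))) \<longlonglongrightarrow> extremal_value - 0" by (intro tendsto_diff tendsto_const LIMSEQ_inverse_real_of_nat)
    then show "(\<lambda>k. extremal_value - 1 / real (Suc k)) \<longlonglongrightarrow> extremal_value" by (simp add: inverse_eq_divide)
  qed simp
  have en: "energy p (\<lambda>x. G (Suc k) x - G k x) \<le> ((1/4) ^ k) powr p" for k
  proof -
    have l: "d k \<le> L (v k)" "d k \<le> L (v (Suc k))"
      using D2[of k k] D2[of k "Suc k"] v(3)[of k] v(3)[of "Suc k"] by linarith+
    show ?thesis by (rule d(2)[of k, unfolded close_def, rule_format, OF G G v(1) v(1) v(2) v(2) l(2) l(1)])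
  qed
  show ?thesis by (rule that[OF v(1,2) G lim en])
qed

lemma extremal_exists:
  obtains u where "u \<in> D1 p" "grad_norm p u = 1" "L u = extremal_value"
proof -
  obtain v G where v: "\<And>k::nat. v k \<in> D1 p" "\<And>k. grad_norm p (v k) \<le> 1" "\<And>k. has_weak_gradient p (v k) (G k)"
    "(\<lambda>k. L (v k)) \<longlonglongrightarrow> extremal_value" "\<And>k. energy p (\<lambda>x. G (Suc k) x - G k x) \<le> ((1/4) ^ k) powr p"
    using fast_maximizing_sequence by blast
  obtain M where M: "0 \<le> M" "\<And>(u :: real^'n \<Rightarrow> real) x y. u \<in> D1 p \<Longrightarrow> \<bar>u x - u y\<bar> \<le> M * grad_norm p u * norm (x - y) powr (1 - real CARD('n) / p)"
    using morrey_inequality[OF p_gt] by blast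
  have diff: "has_weak_gradient p (\<lambda>x. v (Suc k) x - v k x) (\<lambda>x. G (Suc k) x - G k x)" for k
    using has_weak_gradient_lincomb[OF less_imp_le[OF p_pos] v(3) v(3), of 1 "Suc k" "-1" k] by simp
  have Gm: "G k \<in> borel_measurable lebesgue" for k using v(3)[of k] by (simp add: has_weak_gradient_def)
  obtain g W where g: "g \<in> borel_measurable lebesgue" "integrable lebesgue W" "\<And>x. 0 \<le> W x"
    "AE x in lebesgue. (\<lambda>k. G k x) \<longlonglongrightarrow> g x" "AE x in lebesgue. \<forall>k. norm (G k x - g x) powr p \<le> W x"
  proof (rule Lp_fast_Cauchy_limit[of p G lebesgue])
    show "integrable lebesgue (\<lambda>x. norm (G (Suc k) x - G k x) powr p)" for k using diff[of k] by (simp add: has_weak_gradient_def)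
    show "(LINT x|lebesgue. norm (G (Suc k) x - G k x) powr p) \<le> ((1/4) ^ k) powr p" for k
      using v(5)[of k] by (simp add: energy_def)
  qed (use p_gt1 Gm in auto)
  define w where "w k x = v k x + - v k 0" for k x
  have w: "w k \<in> D1 p" "grad_norm p (w k) \<le> 1" "L (w k) = L (v k)" "has_weak_gradient p (w k) (G k)" for k
    using grad_norm_add_const[OF p_pos v(1), of k "- v k 0"] v(2)[of k] L_add_const[OF v(1), of k "- v k 0"]
      has_weak_gradient_lincomb[OF less_imp_le[OF p_pos] v(3)[of k] has_weak_gradient_const[of p "- v k 0"], of 1 1]
    by (simp_all add: w_def[abs_def])
  have wdiff: "\<bar>w k x - w k y\<bar> \<le> M * norm (x - y) powr (1 - real CARD('n) / p)" for k x y
  proof -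
    have "M * grad_norm p (w k) * norm (x - y) powr (1 - real CARD('n) / p) \<le> M * 1 * norm (x - y) powr (1 - real CARD('n) / p)"
      using M(1) w(2) by (intro mult_right_mono mult_left_mono) auto
    then show ?thesis using M(2)[OF w(1), of k x y] by simp
  qed
  have wb: "\<bar>w k x\<bar> \<le> M * norm x powr (1 - real CARD('n) / p)" for k x using wdiff[of k x 0] by (simp add: w_def)
  \<comment> \<open>The increment of \<open>v\<close> has gradient norm at most
    \<open>(1/4) ^ k\<close>. Since both members of the normalized sequence vanish at 0, Morrey's
    inequality between \<open>x\<close> and 0 turns this into a summable pointwise bound.\<close>
  have step: "norm (w (Suc k) x - w k x) \<le> M * norm x powr (1 - real CARD('n) / p) * (1/4) ^ k" for k x
  proof -
    have D: "(\<lambda>x. v (Suc k) x - v k x) \<in> D1 p" using D1_lincomb[OF p_pos v(1) v(1), of 1 "Suc k" "-1" k] by simp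
    have "grad_norm p (\<lambda>x. v (Suc k) x - v k x) powr p \<le> ((1/4) ^ k) powr p"
      using v(5)[of k] energy_eq_grad_norm_powr[OF p_pos diff[of k]] by simp
    then have "grad_norm p (\<lambda>x. v (Suc k) x - v k x) \<le> (1/4) ^ k"
      using powr_less_mono2[of p "(1/4) ^ k" "grad_norm p (\<lambda>x. v (Suc k) x - v k x)"] p_pos by (auto simp: not_less[symmetric])
    then have "M * grad_norm p (\<lambda>x. v (Suc k) x - v k x) * norm x powr (1 - real CARD('n) / p) \<le> M * (1/4) ^ k * norm x powr (1 - real CARD('n) / p)"
      using M(1) by (intro mult_right_mono mult_left_mono) auto
    moreover have "w (Suc k) x - w k x = (v (Suc k) x - v k x) - (v (Suc k) 0 - v k 0)" by (simp add: w_def)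
    ultimately show ?thesis using M(2)[OF D, of x 0] by (simp add: mult_ac)
  qed
  define u where "u x = lim (\<lambda>k. w k x)" for x
  have lim: "(\<lambda>k. w k x) \<longlonglongrightarrow> u x" for x
  proof -
    have "summable (\<lambda>k. w (Suc k) x - w k x)"
      by (rule summable_comparison_test'[of "\<lambda>k. M * norm x powr (1 - real CARD('n) / p) * (1/4) ^ k" 0])
         (use step in \<open>auto intro!: summable_mult summable_geometric\<close>)
    then have "convergent (\<lambda>n. \<Sum>k<n. (w (Suc k) x - w k x))" by (simp add: summable_iff_convergent)
    then have "convergent (\<lambda>n. w n x - w 0 x)" using sum_lessThan_telescope[of "\<lambda>k. w k x"] by simp
    then have "convergent (\<lambda>n. (w n x - w 0 x) + w 0 x)" by (intro convergent_add convergent_const)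
    then show ?thesis unfolding u_def by (simp add: convergent_LIMSEQ_iff)
  qed
  have ud: "\<bar>u x - u y\<bar> \<le> M * norm (x - y) powr (1 - real CARD('n) / p)" for x y
  proof (rule LIMSEQ_le_const2)
    show "(\<lambda>k. \<bar>w k x - w k y\<bar>) \<longlonglongrightarrow> \<bar>u x - u y\<bar>" by (intro tendsto_intros lim)
  qed (use wdiff in blast)
  have hu: "hoelder_continuous (1 - real CARD('n) / p) u"
    unfolding hoelder_continuous_def using ud by (auto simp: dist_norm)
  have cu: "continuous_on UNIV u" using exponent_pos hu by (rule hoelder_continuous_imp_continuous_on)
  have cQ: "continuous_on UNIV (\<lambda>x::real^'n. M * norm x powr (1 - real CARD('n) / p))"
    using exponent_pos by (intro continuous_on_mult continuous_on_const continuous_on_powr' continuous_on_norm continuous_on_id) auto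
  note wl = has_weak_gradient_limit[OF less_imp_le[OF p_gt1] w(4) lim cu cQ wb g]
  have uD: "u \<in> D1 p" using wl(1) hu D1_iff[OF p_pos] by blast
  have "energy p (G k) \<le> 1" for k
    using energy_eq_grad_norm_powr[OF p_pos v(3)[of k]] v(2)[of k] grad_norm_nonneg[of p "v k"] p_pos by (auto intro!: powr_le1)
  then have "energy p g \<le> 1" using wl(2) by (intro LIMSEQ_le_const2) auto
  then have Nu: "grad_norm p u \<le> 1"
    using grad_norm_eq[OF wl(1)] energy_nonneg[of p g] p_pos by (simp add: powr_le1)
  obtain R where R: "0 \<le> R" "\<And>x. x \<in> signed_support \<rho> \<Longrightarrow> norm x \<le> R" using support_norm_bound by blast
  have "(\<lambda>k. L (w k)) \<longlonglongrightarrow> L u"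
  proof (rule signed_integral_LIMSEQ[where B="M * R powr (1 - real CARD('n) / p)"])
    show "norm (w k x) \<le> M * R powr (1 - real CARD('n) / p)" if "x \<in> signed_support \<rho>" for k x
    proof -
      have "M * norm x powr (1 - real CARD('n) / p) \<le> M * R powr (1 - real CARD('n) / p)"
        using R(2)[OF that] exponent_pos M(1) by (intro mult_left_mono powr_mono2) auto
      then show ?thesis using wb[of k x] by simp
    qed
  qed (use cont[OF w(1)] cu lim in auto)
  then have LA: "L u = extremal_value" using v(4) unfolding w(3) by (rule LIMSEQ_unique)
  \<comment> \<open>The limit could a priori lose energy, but \<open>L u\<close> has kept its full
    positive value, and \<open>L_le\<close> then leaves no room for a gradient norm below 1.\<close>
  have "extremal_value \<le> extremal_value * grad_norm p u" using L_le[OF uD] LA extremal_value_pos by simp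
  then have "grad_norm p u = 1" using Nu extremal_value_pos by simp
  then show ?thesis using uD LA that by blast
qed

section \<open>The seminorm and the sharp constant\<close>

lemma push_forward_similarity:
  fixes O' :: "real^'n \<Rightarrow> real^'n" and z :: "real^'n"
  assumes l: "l > 0" and O: "orthogonal_transformation O'" and u: "u \<in> D1 p"
  defines "S \<equiv> \<lambda>y. l *\<^sub>R O' y + z"
  shows "signed_integral (push_forward S \<rho>) u = L (\<lambda>x. u (S x))"
    and "norm (signed_integral (push_forward S \<rho>) (\<lambda>x. x)) = l * norm (signed_integral \<rho> (\<lambda>x. x))"
proof -
  note inv = orthogonal_transformation_inverse[OF O]
  have lin: "linear O'" using O by (rule orthogonal_transformation_linear)
  define T where "T y = (1 / l) *\<^sub>R inv O' y + (1 / l) *\<^sub>R inv O' (- z)" for y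
  have linT: "linear (inv O')" using inv(3) by (rule orthogonal_transformation_linear)
  have h: "homeomorphism UNIV UNIV S T"
  proof (rule homeomorphismI)
    show "continuous_on UNIV S" unfolding S_def using O by (rule continuous_on_similarity)
    show "continuous_on UNIV T" unfolding T_def using inv(3) by (rule continuous_on_similarity)
  qed (use l inv in \<open>simp_all add: S_def T_def linear_add[OF linT] linear_scale[OF linT] linear_neg[OF linT]
      linear_diff[OF lin] linear_scale[OF lin] scaleR_add_right scaleR_diff_right\<close>)
  show "signed_integral (push_forward S \<rho>) u = L (\<lambda>x. u (S x))"
    by (rule signed_integral_push_forward[OF signed h borel_measurable_continuous_onI[OF cont[OF u]]])
  have "signed_integral (push_forward S \<rho>) (\<lambda>x. x) = signed_integral \<rho> S"
    using signed_integral_push_forward[OF signed h, of "\<lambda>x. x"] by simp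
  \<comment> \<open>The translation drops out because constants integrate to zero, and the
    orthogonal map preserves the norm, so only the ratio \<open>l\<close> survives.\<close>
  also have "\<dots> = signed_integral \<rho> (\<lambda>x. l *\<^sub>R O' x) + signed_integral \<rho> (\<lambda>x. z)"
    unfolding S_def using continuous_on_similarity[OF O, of UNIV l 0]
    by (intro signed_integral_add continuous_on_const) simp
  also have "signed_integral \<rho> (\<lambda>x. l *\<^sub>R O' x) = l *\<^sub>R O' (signed_integral \<rho> (\<lambda>x. x))"
    using linear_compose_scale_right[OF lin, of l] unfolding linear_conv_bounded_linear
    by (rule signed_integral_bounded_linear[OF continuous_on_id])
  finally show "norm (signed_integral (push_forward S \<rho>) (\<lambda>x. x)) = l * norm (signed_integral \<rho> (\<lambda>x. x))"
    using l orthogonal_transformation_norm[OF O] by simp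
qed

lemma morrey_seminorm_le:
  assumes u: "u \<in> D1 p"
  shows "morrey_seminorm p \<rho> u \<le> ereal (extremal_value / norm (signed_integral \<rho> (\<lambda>x. x)) powr (1 - real CARD('n) / p) * grad_norm p u)"
  unfolding morrey_seminorm_def
proof (rule SUP_least, clarsimp simp only: mem_Collect_eq similarities_def)
  define m where "m = norm (signed_integral \<rho> (\<lambda>x. x))"
  have m: "0 < m" using moment by (simp add: m_def)
  fix l :: real and O' :: "real^'n \<Rightarrow> real^'n" and z :: "real^'n"
  assume l: "0 < l" and O: "orthogonal_transformation O'"
  note pf = push_forward_similarity[OF l O u, of z]
  have "\<bar>L (\<lambda>x. u (l *\<^sub>R O' x + z))\<bar> \<le> extremal_value * (l powr (1 - real CARD('n) / p) * grad_norm p u)"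
    using L_le[OF D1_similarity[OF l O u p_pos]] grad_norm_similarity[OF l O u p_pos] by simp
  then have "\<bar>L (\<lambda>x. u (l *\<^sub>R O' x + z))\<bar> / (l * m) powr (1 - real CARD('n) / p) \<le> extremal_value * (l powr (1 - real CARD('n) / p) * grad_norm p u) / (l * m) powr (1 - real CARD('n) / p)"
    by (intro divide_right_mono) auto
  also have "\<dots> = extremal_value / m powr (1 - real CARD('n) / p) * grad_norm p u" using l m by (simp add: powr_mult)
  finally show "ereal (\<bar>signed_integral (push_forward (\<lambda>y. l *\<^sub>R O' y + z) \<rho>) u\<bar> /
      norm (signed_integral (push_forward (\<lambda>y. l *\<^sub>R O' y + z) \<rho>) (\<lambda>x. x)) powr (1 - real CARD('n) / p))
      \<le> ereal (extremal_value / norm (signed_integral \<rho> (\<lambda>x. x)) powr (1 - real CARD('n) / p) * grad_norm p u)"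
    unfolding pf by (simp add: m_def)
qed

text \<open>The identity is a similarity, so \<rho> itself competes in the supremum.\<close>

lemma morrey_seminorm_ge:
  "ereal (\<bar>L u\<bar> / norm (signed_integral \<rho> (\<lambda>x. x)) powr (1 - real CARD('n) / p)) \<le> morrey_seminorm p \<rho> u"
proof -
  have "(\<lambda>y. y) \<in> similarities"
    unfolding similarities_def using orthogonal_transformation_id
    by (intro CollectI exI[of _ "1::real"] exI[of _ "\<lambda>y. y"] exI[of _ 0]) simp
  then have "\<rho> \<in> {push_forward S \<rho> |S. S \<in> similarities}"
    by (auto simp: push_forward_def intro!: exI[of _ "\<lambda>y. y"])
  then show ?thesis unfolding morrey_seminorm_def by (rule SUP_upper)
qed

text \<open>On the reals \<open>LEAST\<close> has a meaning only once a minimum is exhibited. The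
  value is an admissible constant by \<open>morrey_seminorm_le\<close>, and testing any other
  admissible constant on the extremal of gradient norm 1 shows that none is smaller.\<close>

lemma morrey_constant_eq:
  "morrey_constant p \<rho> = extremal_value / norm (signed_integral \<rho> (\<lambda>x. x)) powr (1 - real CARD('n) / p)"
  unfolding morrey_constant_def
proof (rule Least_equality)
  fix C assume C: "\<forall>u\<in>D1 p. morrey_seminorm p \<rho> u \<le> ereal (C * grad_norm p u)"
  obtain u where u: "u \<in> D1 p" "grad_norm p u = 1" "L u = extremal_value" by (rule extremal_exists)
  have "ereal (\<bar>L u\<bar> / norm (signed_integral \<rho> (\<lambda>x. x)) powr (1 - real CARD('n) / p)) \<le> ereal (C * grad_norm p u)"
    using morrey_seminorm_ge C u(1) order_trans by blast
  then show "extremal_value / norm (signed_integral \<rho> (\<lambda>x. x)) powr (1 - real CARD('n) / p) \<le> C" using u extremal_value_pos by simp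
qed (use morrey_seminorm_le in blast)

end

theorem proposition3p1:
  fixes p :: real and \<rho> :: "(real^'n) set \<Rightarrow> real"
  assumes "real CARD('n) < p"
    and "admissible_measure \<rho>"
  shows "\<exists>u \<in> D1 p. \<not> u constant_on UNIV \<and>
           morrey_seminorm p \<rho> u = ereal (morrey_constant p \<rho> * grad_norm p u)"
proof -
  interpret morrey_extremal \<rho> p
    by unfold_locales (use assms in \<open>auto simp: admissible_measure_def\<close>)
  obtain u where u: "u \<in> D1 p" "grad_norm p u = 1" "L u = extremal_value" by (rule extremal_exists)
  have "\<not> u constant_on UNIV"
  proof
    assume "u constant_on UNIV"
    then obtain c where "u = (\<lambda>x. c)" by (auto simp: constant_on_def)
    then have "L u = 0" by simp
    then show False using u(3) extremal_value_pos by simp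
  qed
  \<comment> \<open>The quotient at \<rho> itself already reaches the upper bound valid for all
    similarities, so the supremum is attained at the identity.\<close>
  moreover have "morrey_seminorm p \<rho> u = ereal (morrey_constant p \<rho> * grad_norm p u)"
    using morrey_seminorm_le[OF u(1)] morrey_seminorm_ge[of u] u extremal_value_pos
    by (intro antisym) (simp_all add: morrey_constant_eq)
  ultimately show ?thesis using u(1) by blast
qed

end
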